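(* Assume $0 < a_{1} \leq a_{2} \leq \cdots$ with $a_i\to\infty$, and $B>0$ fixed. Let $d(\varepsilon)=\lfloor 1/\varepsilon^{2}\rfloor$. Suppose $\tilde\varepsilon=\tilde\varepsilon(\varepsilon)$ satisfies $1/\tilde{\varepsilon}=\mathrm{O}(1/\varepsilon)$ as $\varepsilon\to 0$ and \[ \log(1/\varepsilon^{2})\sum_{i=1}^{d(\varepsilon)}a_{i}^{4}\left(\tau^{*}_{i}(\varepsilon,\tilde{\varepsilon})\right)^{4} =\mathrm{o}(1) \quad\text{as } \varepsilon\to 0. \] Then \[ \lim_{\varepsilon\rightarrow 0} \left[ \left\{\inf_{\widehat{Q}\in \mathcal{D}}\sup_{\theta\in\Theta(a,B)} R(\theta,\widehat{Q})\right\} \bigg/ \sum_{i=1}^{T(\varepsilon,\tilde{\varepsilon})}\frac{1}{2} \log\left(\frac{1+(\tau^{*}_{i}(\varepsilon,\tilde{\varepsilon}))^{2}/v^{2}_{\varepsilon,\tilde{\varepsilon}}} {1+(\tau^{*}_{i}(\varepsilon,\tilde{\varepsilon}))^{2}/v^{2}_{\varepsilon}}\right) \right] =1. \] Further, the Bayesian predictive distribution based on $\mathrm{G}_{\tau^{*}(\varepsilon,\tilde{\varepsilon})}$ is asymptotically minimax: \[ \sup_{\theta\in\Theta(a,B)}R(\theta,Q_{\mathrm{G}_{\tau^{*}(\varepsilon,\tilde{\varepsilon})}})=(1+\mathrm{o}(1)) \inf_{\widehat{Q}\in\mathcal{D}} \sup_{\theta\in\Theta(a,B)}R(\theta,\widehat{Q})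 \quad\text{as } \varepsilon\to 0. \]
   Context: Model: $\varepsilon>0$, $\tilde\varepsilon>0$; for $\theta\in l_2$, the observation $X$ has law $P_{\theta}=\bigotimes_{i\ge1}\mathcal{N}(\theta_{i},\varepsilon^{2})$ and the future observation $Y$ has law $Q_{\theta}=\bigotimes_{i\ge1}\mathcal{N}(\theta_{i},\tilde{\varepsilon}^{2})$ on $(\mathbb{R}^\infty,\mathcal{R}^\infty)$ (product Borel $\sigma$-field). $\mathcal{D}$ is the set of all predictive distributions, i.e. maps $x\mapsto\widehat Q(\cdot;x)$ from $\mathbb{R}^\infty$ to probability measures on $(\mathbb{R}^\infty,\mathcal{R}^\infty)$. Kullback--Leibler loss: $l(\theta,Q)=\int\log\frac{\mathrm dQ_\theta}{\mathrm dQ}\,\mathrm dQ_\theta$ if $Q_\theta\ll Q$, else $\infty$; risk $R(\theta,\widehat Q)=\int l(\theta,\widehat Q(\cdot;x))\,\mathrm dP_\theta(x)$. Parameter space: $\Theta(a,B)=\{\theta\in l_{2}:\sum_{i=1}^{\infty} a_{i}^{2}\theta_{i}^{2}\leq B\}$. Gaussian priors: for $\tau=(\tau_1,\tau_2,\dots)$ with $\tau_i\ge0$, $\mathrm{G}_{\tau}=\bigotimes_{i}\mathcal{N}(0,\tau_{i}^{2})$, and the Bayesian predictive distribution based on $\mathrm G_\tau$ is $Q_{\mathrm{G}_{\tau}}(\cdot|X=x)=\bigotimes_{i}\mathcal{N}\Big(\frac{1/\varepsilon^{2}}{1/\varepsilon^{2}+1/\tau^{2}_{i}}x_{i},\ \frac{1}{1/\varepsilon^{2}+1/\tau^{2}_{i}}+\tilde{\varepsilon}^{2}\Big)$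 (with the convention that a coordinate with $\tau_i=0$ gives $\mathcal N(0,\tilde\varepsilon^2)$). Let $v^{2}_{\varepsilon,\tilde{\varepsilon}}=1/(1/\varepsilon^{2}+1/\tilde{\varepsilon}^{2})$ and $v^{2}_{\varepsilon}=\varepsilon^{2}$. For $\lambda>0$ set $(\tau^{*}_{i})^{2}=\frac{1}{2}\Big[(v^{2}_{\varepsilon}-v^{2}_{\varepsilon,\tilde{\varepsilon}})\sqrt{1+\frac{4}{2\lambda a^{2}_{i}(v^{2}_{\varepsilon}-v^{2}_{\varepsilon,\tilde{\varepsilon}})}}-(v^{2}_{\varepsilon}+v^{2}_{\varepsilon,\tilde{\varepsilon}})\Big]_{+}$, $[t]_+=\max\{t,0\}$, $\tau_i^*\ge0$; $\tau^*(\varepsilon,\tilde\varepsilon)=(\tau^*_1(\varepsilon,\tilde\varepsilon),\tau^*_2(\varepsilon,\tilde\varepsilon),\dots)$ denotes this sequence with $\lambda=\lambda(\varepsilon,\tilde\varepsilon)$ the (unique) $\lambda>0$ for which $\sum_{i=1}^{\infty}a_{i}^{2}(\tau^{*}_{i})^{2}=B$. Finally $T(\varepsilon,\tilde{\varepsilon})=\sup\{i:\tau^{*}_{i}(\varepsilon,\tilde{\varepsilon})\neq 0\}=\sup\{i: 1/(\lambda(\varepsilon,\tilde\varepsilon)a_i^2)>2\tilde\varepsilon^2\}$. *)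

theory Defs
  imports "HOL-Probability.Probability" "HOL-Library.Landau_Symbols"
begin

text \<open>Coordinates are indexed from 0: index i here is coordinate i+1 of the paper.\<close>

definition Rinf :: "(nat \<Rightarrow> real) measure" where
  "Rinf = PiM UNIV (\<lambda>_. lborel)"

definition gauss_prod :: "(nat \<Rightarrow> real) \<Rightarrow> (nat \<Rightarrow> real) \<Rightarrow> (nat \<Rightarrow> real) measure" where
  "gauss_prod m s = PiM UNIV (\<lambda>i. density lborel (\<lambda>x. ennreal (normal_density (m i) (s i) x)))"

definition P_obs :: "real \<Rightarrow> (nat \<Rightarrow> real) \<Rightarrow> (nat \<Rightarrow> real) measure" where
  "P_obs eps \<theta> = gauss_prod \<theta> (\<lambda>_. eps)"

definition Q_fut :: "real \<Rightarrow> (nat \<Rightarrow> real) \<Rightarrow> (nat \<Rightarrow> real) measure" where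
  "Q_fut epst \<theta> = gauss_prod \<theta> (\<lambda>_. epst)"

text \<open>Kullback--Leibler loss l(theta,Q) = int log (dQ_theta/dQ) dQ_theta if Q_theta << Q,
  and infinity otherwise.  The integral of the extended-real function is the usual
  positive part minus negative part (the negative part is always finite).\<close>
definition kl_loss :: "'a measure \<Rightarrow> 'a measure \<Rightarrow> ennreal" where
  "kl_loss Pt Q =
     (if absolutely_continuous Q Pt
      then e2ennreal
        (enn2ereal (\<integral>\<^sup>+ y. ennreal (max 0 (ln (enn2real (RN_deriv Q Pt y)))) \<partial>Pt)
         - enn2ereal (\<integral>\<^sup>+ y. ennreal (max 0 (- ln (enn2real (RN_deriv Q Pt y)))) \<partial>Pt))
      else \<infinity>)"

definition pred_dists :: "((nat \<Rightarrow> real) \<Rightarrow> (nat \<Rightarrow> real) measure) set" where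
  "pred_dists = {Qh. Qh \<in> Rinf \<rightarrow>\<^sub>M prob_algebra Rinf}"

definition risk :: "real \<Rightarrow> real \<Rightarrow> (nat \<Rightarrow> real) \<Rightarrow> ((nat \<Rightarrow> real) \<Rightarrow> (nat \<Rightarrow> real) measure) \<Rightarrow> ennreal" where
  "risk eps epst \<theta> Qh = (\<integral>\<^sup>+ x. kl_loss (Q_fut epst \<theta>) (Qh x) \<partial>(P_obs eps \<theta>))"

definition Theta :: "(nat \<Rightarrow> real) \<Rightarrow> real \<Rightarrow> (nat \<Rightarrow> real) set" where
  "Theta a B = {\<theta>. summable (\<lambda>i. (\<theta> i)\<^sup>2) \<and> summable (\<lambda>i. (a i)\<^sup>2 * (\<theta> i)\<^sup>2)
                   \<and> (\<Sum>i. (a i)\<^sup>2 * (\<theta> i)\<^sup>2) \<le> B}"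

text \<open>Bayesian predictive distribution based on the Gaussian prior G_tau.
  The mean factor (1/eps^2)/(1/eps^2+1/tau^2) is written tau^2/(tau^2+eps^2) and the
  variance 1/(1/eps^2+1/tau^2) as tau^2 eps^2/(tau^2+eps^2); this covers tau_i = 0.\<close>
definition bayes_pred :: "real \<Rightarrow> real \<Rightarrow> (nat \<Rightarrow> real) \<Rightarrow> (nat \<Rightarrow> real) \<Rightarrow> (nat \<Rightarrow> real) measure" where
  "bayes_pred eps epst \<tau> x =
     gauss_prod (\<lambda>i. (\<tau> i)\<^sup>2 / ((\<tau> i)\<^sup>2 + eps\<^sup>2) * x i)
                (\<lambda>i. sqrt ((\<tau> i)\<^sup>2 * eps\<^sup>2 / ((\<tau> i)\<^sup>2 + eps\<^sup>2) + epst\<^sup>2))"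

definition v2_joint :: "real \<Rightarrow> real \<Rightarrow> real" where
  "v2_joint eps epst = 1 / (1 / eps\<^sup>2 + 1 / epst\<^sup>2)"

definition v2_obs :: "real \<Rightarrow> real" where
  "v2_obs eps = eps\<^sup>2"

definition tau_sq :: "(nat \<Rightarrow> real) \<Rightarrow> real \<Rightarrow> real \<Rightarrow> real \<Rightarrow> nat \<Rightarrow> real" where
  "tau_sq a eps epst lam i =
     max 0 ((v2_obs eps - v2_joint eps epst)
              * sqrt (1 + 4 / (2 * lam * (a i)\<^sup>2 * (v2_obs eps - v2_joint eps epst)))
            - (v2_obs eps + v2_joint eps epst)) / 2"

definition lam_star :: "(nat \<Rightarrow> real) \<Rightarrow> real \<Rightarrow> real \<Rightarrow> real \<Rightarrow> real" where
  "lam_star a B eps epst =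
     (THE lam. lam > 0 \<and> (\<lambda>i. (a i)\<^sup>2 * tau_sq a eps epst lam i) sums B)"

definition tau_star :: "(nat \<Rightarrow> real) \<Rightarrow> real \<Rightarrow> real \<Rightarrow> real \<Rightarrow> nat \<Rightarrow> real" where
  "tau_star a B eps epst i = sqrt (tau_sq a eps epst (lam_star a B eps epst) i)"

text \<open>T(eps, epst) = sup{i : tau*_i /= 0} in the paper's 1-based indexing (sup {} = 0).\<close>
definition T_star :: "(nat \<Rightarrow> real) \<Rightarrow> real \<Rightarrow> real \<Rightarrow> real \<Rightarrow> nat" where
  "T_star a B eps epst = Sup {Suc i | i. tau_star a B eps epst i \<noteq> 0}"

definition minimax_risk :: "(nat \<Rightarrow> real) \<Rightarrow> real \<Rightarrow> real \<Rightarrow> real \<Rightarrow> ennreal" where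
  "minimax_risk a B eps epst =
     (INF Qh\<in>pred_dists. SUP \<theta>\<in>Theta a B. risk eps epst \<theta> Qh)"

end

theory Submission
  imports Defs "HOL-Real_Asymp.Real_Asymp"
begin

text \<open>The risk of the predictive distribution based on a Gaussian prior splits over the coordinates
  and is affine in each \<open>\<theta>\<^sub>i\<^sup>2\<close>. For the prior \<open>\<tau>*\<close> the slopes are at most \<open>\<lambda> a\<^sub>i\<^sup>2\<close>, with equality where
  \<open>\<tau>*\<^sub>i > 0\<close>, so on the ellipsoid the risk never exceeds the sum \<open>D\<close> in the denominator.

  For the converse, the Gaussian prior with variances \<open>(1 - \<delta>) \<tau>*\<^sub>i\<^sup>2\<close>, whose Bayes risk is at least
  \<open>(1 - \<delta>) D\<close>, is conditioned on the ellipsoid. The conditioning costs at most the mean divergence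
  between posterior draws inside and outside of the ellipsoid. Posterior draws are so close to each
  other that this is of order \<open>sqrt P * D\<close>, where \<open>P\<close> is the prior mass outside, uniformly in
  the variance of the future observation; hence it suffices that \<open>P\<close> tends to 0. By Chebyshev's inequality
  \<open>P\<close> is at most a multiple of \<open>\<Sum> a\<^sub>i\<^sup>4 \<tau>*\<^sub>i\<^sup>4\<close> over all \<open>i\<close>. The active coordinates may extend beyond
  \<open>d(\<epsilon>)\<close>, but there \<open>a\<^sub>i\<^sup>2 \<tau>*\<^sub>i\<^sup>2\<close> is already decreasing, so the hypothesis controls the whole sum.\<close>

section \<open>Infinite product measures\<close>

text \<open>Nothing is known about a competing predictive distribution: it may be singular to every
  \<open>Q_fut\<close>, and its loss may be infinite. Hence divergences are integrated through
  \<open>klf\<close>, whose integrand is nonnegative; negative terms are carried to the other side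
  of each inequality and cancelled only when finite. Conditioning a prior on the ellipsoid destroys
  its product form, so the conditioned predictive density is never computed, only compared with the
  Gaussian one, for which everything is explicit. The optimal prior charges finitely many
  coordinates, so all laws that the lower bound has to compute have finite products as densities. In
  the upper bound \<open>\<theta>\<close> may have infinitely many nonzero coordinates, and there
  absolute continuity has to be proved. The shrinkage by \<open>1 - \<delta>\<close> leaves the
  margin \<open>\<delta> * B\<close> that Chebyshev's inequality needs; without it the mean of the
  quadratic form would lie on the boundary. The assumption on \<open>1 / epst\<close> bounds
  \<open>(u - v) / v = e^2 / s^2\<close>, which makes the posterior spread comparable with the
  information gain.\<close>

lemma nn_integral_PiM_prod:
  fixes M :: "'i \<Rightarrow> 'a measure" and f :: "'i \<Rightarrow> 'a \<Rightarrow> ennreal"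
  assumes M: "\<And>i. prob_space (M i)" and J: "finite J"
    and f: "\<And>i. i \<in> J \<Longrightarrow> f i \<in> borel_measurable (M i)"
  shows "(\<integral>\<^sup>+x. (\<Prod>i\<in>J. f i (x i)) \<partial>PiM UNIV M) = (\<Prod>i\<in>J. integral\<^sup>N (M i) (f i))"
proof -
  interpret P: product_prob_space M UNIV
    by (intro product_prob_spaceI M)
  have meas: "(\<lambda>x. \<Prod>i\<in>J. f i (x i)) \<in> borel_measurable (PiM J M)"
    by (intro borel_measurable_prod_ennreal measurable_compose[OF measurable_component_singleton] f)
  have "(\<Prod>i\<in>J. integral\<^sup>N (M i) (f i)) = (\<integral>\<^sup>+x. (\<Prod>i\<in>J. f i (x i)) \<partial>PiM J M)"
    by (intro P.product_nn_integral_prod[symmetric] J f)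
  also have "\<dots> = (\<integral>\<^sup>+x. (\<Prod>i\<in>J. f i (x i)) \<partial>distr (PiM UNIV M) (PiM J M) (\<lambda>x. restrict x J))"
    by (subst P.distr_PiM_restrict_finite) (auto simp: J)
  also have "\<dots> = (\<integral>\<^sup>+x. (\<Prod>i\<in>J. f i (x i)) \<partial>PiM UNIV M)"
    by (subst nn_integral_distr[OF measurable_restrict_subset]) (use meas in auto)
  finally show ?thesis by simp
qed

lemma distr_PiM_component':
  fixes M :: "'i \<Rightarrow> 'a measure"
  assumes "\<And>i. prob_space (M i)"
  shows "distr (PiM UNIV M) (M i) (\<lambda>x. x i) = M i"
  by (intro distr_PiM_component assms) simp

lemma nn_integral_PiM_component:
  fixes M :: "'i \<Rightarrow> 'a measure"
  assumes "\<And>i. prob_space (M i)" and f: "f \<in> borel_measurable (M i)"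
  shows "(\<integral>\<^sup>+x. f (x i) \<partial>PiM UNIV M) = integral\<^sup>N (M i) f"
proof -
  have "integral\<^sup>N (M i) f = (\<integral>\<^sup>+x. f x \<partial>distr (PiM UNIV M) (M i) (\<lambda>x. x i))"
    by (subst distr_PiM_component'[of M i]) (auto intro: assms)
  then show ?thesis
    by (simp add: nn_integral_distr f measurable_component_singleton)
qed

lemma integral_PiM_component:
  fixes M :: "'i \<Rightarrow> 'a measure" and f :: "'a \<Rightarrow> real"
  assumes "\<And>i. prob_space (M i)" and f: "f \<in> borel_measurable (M i)"
  shows "(\<integral>x. f (x i) \<partial>PiM UNIV M) = integral\<^sup>L (M i) f"
proof -
  have "integral\<^sup>L (M i) f = (\<integral>x. f x \<partial>distr (PiM UNIV M) (M i) (\<lambda>x. x i))"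
    by (subst distr_PiM_component'[of M i]) (auto intro: assms)
  then show ?thesis
    by (simp add: integral_distr f measurable_component_singleton)
qed

lemma integrable_PiM_component:
  fixes M :: "'i \<Rightarrow> 'a measure" and f :: "'a \<Rightarrow> real"
  assumes "\<And>i. prob_space (M i)" and f: "integrable (M i) f"
  shows "integrable (PiM UNIV M) (\<lambda>x. f (x i))"
  using f by (subst (asm) distr_PiM_component'[OF assms(1), symmetric])
     (auto simp: integrable_distr_eq measurable_component_singleton borel_measurable_integrable[OF f])

lemma eq_PiM_probI:
  fixes N :: "'i \<Rightarrow> 'a measure"
  assumes N: "\<And>i. prob_space (N i)" and sets: "sets P = sets (PiM UNIV N)"
    and eq: "\<And>J F. finite J \<Longrightarrow> (\<And>j. j \<in> J \<Longrightarrow> F j \<in> sets (N j)) \<Longrightarrow>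
      emeasure P (prod_emb UNIV N J (Pi\<^sub>E J F)) = (\<Prod>j\<in>J. emeasure (N j) (F j))"
  shows "P = PiM UNIV N"
proof (rule measure_eqI_PiM_infinite[symmetric])
  interpret N: product_prob_space N UNIV
    by (intro product_prob_spaceI N)
  fix F and J :: "'i set"
  assume "finite J" "\<And>i. i \<in> J \<Longrightarrow> F i \<in> sets (N i)"
  then show "emeasure (PiM UNIV N) (prod_emb UNIV N J (Pi\<^sub>E J F)) = emeasure P (prod_emb UNIV N J (Pi\<^sub>E J F))"
    by (subst N.emeasure_PiM_emb) (auto intro!: eq[symmetric])
next
  interpret N: product_prob_space N UNIV
    by (intro product_prob_spaceI N)
  show "finite_measure (PiM UNIV N)" by unfold_locales
qed (use sets in auto)

text \<open>On a cylinder set both sides factor over the coordinates. Only finitely many factors are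
  reweighted here; reweighting all of them is the subject of \<open>product_ratio\<close>.\<close>

lemma density_PiM:
  fixes M :: "'i \<Rightarrow> 'a measure" and r :: "'i \<Rightarrow> 'a \<Rightarrow> ennreal"
  assumes M: "\<And>i. prob_space (M i)" and K: "finite K"
    and r[measurable]: "\<And>i. i \<in> K \<Longrightarrow> r i \<in> borel_measurable (M i)"
    and int: "\<And>i. i \<in> K \<Longrightarrow> integral\<^sup>N (M i) (r i) = 1"
  shows "density (PiM UNIV M) (\<lambda>x. \<Prod>i\<in>K. r i (x i))
    = PiM UNIV (\<lambda>i. if i \<in> K then density (M i) (r i) else M i)" (is "?L = PiM UNIV ?N")
proof -
  have N: "prob_space (?N i)" for i
    using M[of i] int[of i] r[of i]
    by (auto intro!: prob_spaceI simp: emeasure_density cong: nn_integral_cong_simp)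
  interpret N: product_prob_space ?N UNIV
    by (intro product_prob_spaceI N)
  interpret P: product_prob_space M UNIV
    by (intro product_prob_spaceI M)
  have sets_eq: "sets (PiM UNIV ?N) = sets (PiM UNIV M)"
    by (intro sets_PiM_cong) auto
  show ?thesis
  proof (rule eq_PiM_probI[OF N])
    show "sets ?L = sets (PiM UNIV ?N)" using sets_eq by simp
  next
    fix J F assume J: "finite J" and F: "\<And>j. j \<in> J \<Longrightarrow> F j \<in> sets (?N j)"
    have F': "F j \<in> sets (M j)" if "j \<in> J" for j using F[OF that] by (auto split: if_splits)
    have spN: "space (?N i) = space (M i)" for i by auto
    let ?E = "prod_emb UNIV ?N J (Pi\<^sub>E J F)"
    have E: "?E \<in> sets (PiM UNIV M)"
      unfolding sets_eq[symmetric] using J F by (intro sets_PiM_I) auto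
    have meas: "(\<lambda>x. \<Prod>i\<in>K. r i (x i)) \<in> borel_measurable (PiM UNIV M)"
      by (intro borel_measurable_prod_ennreal measurable_compose[OF measurable_component_singleton] r) auto
    \<comment> \<open>Each factor defaults to 1 outside its own index set, so reweighted coordinates
      and coordinates constrained by the cylinder fit into one product over
      \<open>K \<union> J\<close>.\<close>
    define g where "g i y = (if i \<in> K then r i y else 1) * (if i \<in> J then indicator (F i) y else 1)" for i y
    have g: "g i \<in> borel_measurable (M i)" for i
      unfolding g_def using r[of i] F'[of i] by (cases "i \<in> K"; cases "i \<in> J") auto
    have "emeasure ?L ?E = (\<integral>\<^sup>+x. (\<Prod>i\<in>K. r i (x i)) * indicator ?E x \<partial>PiM UNIV M)"
      by (rule emeasure_density[OF meas E])
    also have "\<dots> = (\<integral>\<^sup>+x. (\<Prod>i\<in>K \<union> J. g i (x i)) \<partial>PiM UNIV M)"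
    proof (rule nn_integral_cong)
      fix x assume x: "x \<in> space (PiM UNIV M)"
      have "(\<Prod>i\<in>K \<union> J. if i \<in> K then r i (x i) else 1) = (\<Prod>i\<in>K. r i (x i))"
        using K J by (intro prod.mono_neutral_cong_right) auto
      moreover have "(\<Prod>i\<in>K \<union> J. if i \<in> J then indicator (F i) (x i) else 1) = (\<Prod>i\<in>J. indicator (F i) (x i) :: ennreal)"
        using K J by (intro prod.mono_neutral_cong_right) auto
      moreover have "(\<Prod>i\<in>J. indicator (F i) (x i) :: ennreal) = indicator ?E x"
      proof (cases "x \<in> ?E")
        case True
        then have "x i \<in> F i" if "i \<in> J" for i
          using that by (auto simp: prod_emb_def restrict_def PiE_iff)
        then show ?thesis using True by simp
      next
        case False
        then obtain i where "i \<in> J" "x i \<notin> F i"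
          using x by (auto simp: prod_emb_def PiE_iff space_PiM spN)
        then show ?thesis using False J by (auto simp: indicator_def intro!: prod_zero)
      qed
      ultimately show "(\<Prod>i\<in>K. r i (x i)) * indicator ?E x = (\<Prod>i\<in>K \<union> J. g i (x i))"
        by (simp add: g_def prod.distrib)
    qed
    also have "\<dots> = (\<Prod>i\<in>K \<union> J. integral\<^sup>N (M i) (g i))"
      using K J g by (intro nn_integral_PiM_prod M) auto
    also have "\<dots> = (\<Prod>i\<in>K \<union> J. if i \<in> J then emeasure (?N i) (F i) else 1)"
    proof (rule prod.cong[OF refl])
      fix i assume "i \<in> K \<union> J"
      show "integral\<^sup>N (M i) (g i) = (if i \<in> J then emeasure (?N i) (F i) else 1)"
        using r[of i] int[of i] F'[of i] prob_space.emeasure_space_1[OF M[of i]]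
        by (auto simp: g_def[abs_def] emeasure_density)
    qed
    also have "\<dots> = (\<Prod>i\<in>J. emeasure (?N i) (F i))"
      using K J by (intro prod.mono_neutral_cong_right) auto
    finally show "emeasure ?L ?E = (\<Prod>j\<in>J. emeasure (?N j) (F j))" .
  qed
qed

section \<open>Gaussian product measures and their densities\<close>

abbreviation gauss :: "real \<Rightarrow> real \<Rightarrow> real measure" where
  "gauss m s \<equiv> density lborel (\<lambda>x. ennreal (normal_density m s x))"

lemma prob_space_gauss: "0 < s \<Longrightarrow> prob_space (gauss m s)"
  by (rule prob_space_normal_density)

lemma sets_gauss_prod [measurable_cong]: "sets (gauss_prod m s) = sets Rinf"
  unfolding gauss_prod_def Rinf_def by (intro sets_PiM_cong) auto

lemma space_gauss_prod [simp]: "space (gauss_prod m s) = UNIV"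
  by (simp add: gauss_prod_def space_PiM)

lemma space_Rinf [simp]: "space Rinf = UNIV"
  by (simp add: Rinf_def space_PiM)

lemma sets_Rinf: "sets Rinf = sets (PiM UNIV (\<lambda>_. borel))"
  unfolding Rinf_def by (intro sets_PiM_cong) auto

lemma measurable_Rinf_component: "(\<lambda>x. x i) \<in> borel_measurable Rinf"
  using measurable_component_singleton[of i UNIV "\<lambda>_. borel"] 
  by (simp add: measurable_cong_sets[OF sets_Rinf refl])

lemma prob_space_gauss_prod: "(\<And>i. 0 < s i) \<Longrightarrow> prob_space (gauss_prod m s)"
  unfolding gauss_prod_def by (intro prob_space_PiM prob_space_gauss)

text \<open>Densities are taken relative to a Gaussian and not to Lebesgue measure, because a
  density on sequence space needs a reference measure that has an infinite product.\<close>

definition nratio :: "real \<Rightarrow> real \<Rightarrow> real \<Rightarrow> real \<Rightarrow> real \<Rightarrow> real" where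
  "nratio m s m' s' x = normal_density m s x / normal_density m' s' x"

lemma nratio_measurable [measurable]: 
  assumes [measurable]: "f \<in> borel_measurable N" "g \<in> borel_measurable N" "h \<in> borel_measurable N"
  shows "(\<lambda>x. nratio (f x) s (g x) s' (h x)) \<in> borel_measurable N"
  unfolding nratio_def normal_density_def by measurable

lemma nratio_pos: "0 < s \<Longrightarrow> 0 < s' \<Longrightarrow> 0 < nratio m s m' s' x"
  by (simp add: nratio_def normal_density_pos)

lemma gauss_eq_density:
  assumes "0 < s" "0 < s'"
  shows "gauss m s = density (gauss m' s') (\<lambda>x. ennreal (nratio m s m' s' x))"
proof -
  have "ennreal (normal_density m' s' x) * ennreal (nratio m s m' s' x) = ennreal (normal_density m s x)" for x
    using assms normal_density_pos[of s' m' x] normal_density_pos[of s m x]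
    by (simp add: nratio_def ennreal_mult[symmetric])
  then show ?thesis
    by (subst density_density_eq) (auto intro!: density_cong)
qed

lemma nn_integral_nratio:
  assumes "0 < s" "0 < s'"
  shows "(\<integral>\<^sup>+x. ennreal (nratio m s m' s' x) \<partial>gauss m' s') = 1"
proof -
  have "(\<integral>\<^sup>+x. ennreal (nratio m s m' s' x) \<partial>gauss m' s') = emeasure (gauss m s) UNIV"
    by (simp add: gauss_eq_density[OF assms, of m m'] emeasure_density[of _ "gauss m' s'"])
  also have "\<dots> = 1"
    using prob_space.emeasure_space_1[OF prob_space_gauss[OF assms(1), of m]] by simp
  finally show ?thesis .
qed

text \<open>Agreement from \<open>n\<close> on keeps the density a finite product. This is the
  source of the explicit densities on sequence space used below.\<close>

lemma gauss_prod_eq_density: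
  assumes s: "\<And>i. 0 < s i" "\<And>i. 0 < s' i"
    and eq: "\<And>i. n \<le> i \<Longrightarrow> m i = m' i" "\<And>i. n \<le> i \<Longrightarrow> s i = s' i"
  shows "gauss_prod m s = density (gauss_prod m' s')
    (\<lambda>x. ennreal (\<Prod>i<n. nratio (m i) (s i) (m' i) (s' i) (x i)))"
proof -
  have "gauss_prod m s = PiM UNIV (\<lambda>i. if i \<in> {..<n}
      then density (gauss (m' i) (s' i)) (\<lambda>x. ennreal (nratio (m i) (s i) (m' i) (s' i) x))
      else gauss (m' i) (s' i))"
    unfolding gauss_prod_def using eq s
    by (intro PiM_cong refl) (auto simp flip: gauss_eq_density)
  also have "\<dots> = density (gauss_prod m' s')
    (\<lambda>x. \<Prod>i<n. ennreal (nratio (m i) (s i) (m' i) (s' i) (x i)))"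
    unfolding gauss_prod_def using s
    by (intro density_PiM[symmetric]) (auto intro!: prob_space_gauss nn_integral_nratio)
  also have "(\<lambda>x::nat \<Rightarrow> real. \<Prod>i<n. ennreal (nratio (m i) (s i) (m' i) (s' i) (x i))) =
     (\<lambda>x. ennreal (\<Prod>i<n. nratio (m i) (s i) (m' i) (s' i) (x i)))"
    by (intro ext prod_ennreal less_imp_le nratio_pos s)
  finally show ?thesis .
qed

section \<open>Kullback--Leibler divergence\<close>

text \<open>The extra \<open>- a + b\<close> integrates to zero over two probability densities and
  makes the integrand the Bregman divergence of \<open>z * ln z\<close>, hence nonnegative
  pointwise. At \<open>a = 0\<close> it takes its limiting value \<open>b\<close>.\<close>

definition klf :: "real \<Rightarrow> real \<Rightarrow> real" where
  "klf a b = a * ln (a / b) - a + b"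

lemma klf_measurable [measurable]:
  assumes [measurable]: "f \<in> borel_measurable M" "g \<in> borel_measurable M"
  shows "(\<lambda>x. klf (f x) (g x)) \<in> borel_measurable M"
  unfolding klf_def by measurable

lemma klf_nonneg:
  assumes "0 \<le> a" "0 < b"
  shows "0 \<le> klf a b"
proof (cases "a = 0")
  case False
  then have a: "0 < a" using assms by simp
  have "ln (b / a) \<le> b / a - 1"
    using assms a by (intro ln_le_minus_one) simp
  then have "a * ln (b / a) \<le> a * (b / a - 1)"
    using a by (intro mult_left_mono) auto
  also have "\<dots> = b - a" using a by (simp add: field_simps)
  finally have "a * ln (b / a) \<le> b - a" .
  moreover have "ln (b / a) = - ln (a / b)" using a assms by (simp add: ln_div)
  ultimately show ?thesis by (simp add: klf_def)
qed (use assms in \<open>simp add: klf_def\<close>)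

text \<open>Young's inequality for the conjugate pair \<open>r * ln r - r\<close> and
  \<open>exp\<close>: it is \<open>klf r z \<ge> 0\<close> with the terms regrouped.\<close>

lemma klf_variational:
  assumes "0 \<le> r" "0 < z"
  shows "r * ln z + 1 \<le> klf r 1 + z"
proof (cases "r = 0")
  case False
  have "0 \<le> klf r z" by (rule klf_nonneg) fact+
  then show ?thesis using assms False by (simp add: klf_def ln_div algebra_simps)
qed (use assms in \<open>simp add: klf_def\<close>)

context
  fixes P Q :: "'a measure"
  assumes P: "prob_space P" and Q: "prob_space Q" and sets_PQ: "sets P = sets Q"
    and ac: "absolutely_continuous Q P"
begin

text \<open>The derivative is finite almost everywhere, so passing to a real function changes it on
  a null set only.\<close>

lemma density_enn2real_RN_deriv: "density Q (\<lambda>y. ennreal (enn2real (RN_deriv Q P y))) = P"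
proof -
  interpret P: prob_space P by fact
  interpret Q: prob_space Q by fact
  have "AE y in Q. RN_deriv Q P y \<noteq> \<infinity>"
    by (rule Q.RN_deriv_finite) (use ac sets_PQ in \<open>auto intro: P.sigma_finite_measure\<close>)
  then have "density Q (\<lambda>y. ennreal (enn2real (RN_deriv Q P y))) = density Q (RN_deriv Q P)"
    by (intro density_cong) (auto elim!: eventually_mono simp: less_top)
  then show ?thesis
    using Q.density_RN_deriv[OF ac] sets_PQ by simp
qed

text \<open>Since \<open>r * (- ln r) \<le> 1\<close>, the negative part of the log ratio has
  integral at most 1. The subtraction in the loss is therefore harmless, and the divergence becomes
  a single nonnegative integral.\<close>

lemma kl_loss_eq_klf: "kl_loss P Q = (\<integral>\<^sup>+y. ennreal (klf (enn2real (RN_deriv Q P y)) 1) \<partial>Q)"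
proof -
  interpret P: prob_space P by fact
  interpret Q: prob_space Q by fact
  define r where "r y = enn2real (RN_deriv Q P y)" for y
  have r[measurable]: "r \<in> borel_measurable Q" unfolding r_def by measurable
  have r0: "0 \<le> r y" for y by (simp add: r_def)
  have Pr: "P = density Q r" unfolding r_def by (rule density_enn2real_RN_deriv[symmetric])
  define Pos where "Pos = (\<integral>\<^sup>+y. ennreal (max 0 (ln (r y))) \<partial>P)"
  define Neg where "Neg = (\<integral>\<^sup>+y. ennreal (max 0 (- ln (r y))) \<partial>P)"
  define K where "K = (\<integral>\<^sup>+y. ennreal (klf (r y) 1) \<partial>Q)"
  have Pos: "Pos = (\<integral>\<^sup>+y. ennreal (r y * max 0 (ln (r y))) \<partial>Q)"
    unfolding Pos_def Pr by (subst nn_integral_density) (auto simp: ennreal_mult r0)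
  have Neg: "Neg = (\<integral>\<^sup>+y. ennreal (r y * max 0 (- ln (r y))) \<partial>Q)"
    unfolding Neg_def Pr by (subst nn_integral_density) (auto simp: ennreal_mult r0)
  have one: "(\<integral>\<^sup>+y. ennreal (r y) \<partial>Q) = 1"
    using P.emeasure_space_1 unfolding Pr by (simp add: emeasure_density cong: nn_integral_cong_simp)
  have neg_le: "r y * max 0 (- ln (r y)) \<le> 1" for y
    using klf_nonneg[of "r y" 1] r0[of y] by (auto simp: klf_def max_def)
  have "Neg \<le> (\<integral>\<^sup>+y. 1 \<partial>Q)" unfolding Neg
    by (intro nn_integral_mono) (use neg_le ennreal_leI in fastforce)
  then have Neg_fin: "Neg \<le> 1" by (simp add: Q.emeasure_space_1)
  \<comment> \<open>The common mass 1, of \<open>Q\<close> and of the density \<open>r\<close>, is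
    added so that the pointwise identity holds between nonnegative terms.\<close>
  have "Pos + 1 = (\<integral>\<^sup>+y. ennreal (r y * max 0 (ln (r y))) + 1 \<partial>Q)"
    unfolding Pos by (subst nn_integral_add) (auto simp: Q.emeasure_space_1)
  also have "\<dots> = (\<integral>\<^sup>+y. ennreal (klf (r y) 1) + ennreal (r y) + ennreal (r y * max 0 (- ln (r y))) \<partial>Q)"
  proof (rule nn_integral_cong)
    fix y
    have "r y * max 0 (ln (r y)) + 1 = klf (r y) 1 + r y + r y * max 0 (- ln (r y))"
      by (auto simp: klf_def max_def)
    then have "ennreal (r y * max 0 (ln (r y)) + 1) = ennreal (klf (r y) 1 + r y + r y * max 0 (- ln (r y)))"
      by simp
    then show "ennreal (r y * max 0 (ln (r y))) + 1 =
        ennreal (klf (r y) 1) + ennreal (r y) + ennreal (r y * max 0 (- ln (r y)))"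
      using r0[of y] klf_nonneg[of "r y" 1] by (simp add: ennreal_plus)
  qed
  also have "\<dots> = K + 1 + Neg"
    unfolding K_def Neg one[symmetric] by (simp add: nn_integral_add)
  finally have "1 + Pos = 1 + (K + Neg)" by (simp add: ac_simps)
  then have PK: "Pos = K + Neg" by (simp add: ennreal_add_left_cancel)
  obtain n where n: "Neg = ennreal n" "0 \<le> n" using Neg_fin
    by (cases Neg) (auto simp: top_unique)
  have "enn2ereal Pos - enn2ereal Neg = enn2ereal K"
    unfolding PK n by (cases K) (auto simp: plus_ennreal.rep_eq n)
  then have "kl_loss P Q = K"
    using ac unfolding kl_loss_def Pos_def Neg_def r_def by simp
  then show ?thesis by (simp add: K_def r_def)
qed

end

text \<open>The Donsker--Varadhan inequality with test function \<open>ln (q / b)\<close>, in a form in which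
  every term is nonnegative, so that no integrability has to be assumed.\<close>
lemma kl_loss_variational:
  fixes q b :: "'a \<Rightarrow> real"
  assumes Qh: "prob_space Qh" "sets Qh = sets Q0"
    and q[measurable]: "q \<in> borel_measurable Q0" and b[measurable]: "b \<in> borel_measurable Q0"
    and q0: "\<And>y. 0 < q y" and b0: "\<And>y. 0 < b y"
    and q1: "(\<integral>\<^sup>+y. ennreal (q y) \<partial>Q0) = 1" and b1: "(\<integral>\<^sup>+y. ennreal (b y) \<partial>Q0) = 1"
  shows "(\<integral>\<^sup>+y. ennreal (klf (q y) (b y)) \<partial>Q0) + 1
    \<le> kl_loss (density Q0 q) Qh + (\<integral>\<^sup>+y. ennreal (q y / b y) \<partial>Qh)"
proof (cases "absolutely_continuous Qh (density Q0 q)")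
  case False
  then show ?thesis by (simp add: kl_loss_def)
next
  case ac: True
  let ?P = "density Q0 q"
  interpret Qh: prob_space Qh by fact
  have P: "prob_space ?P"
    by (intro prob_spaceI) (simp add: emeasure_density q1 cong: nn_integral_cong_simp)
  note [measurable_cong] = Qh(2)
  define r where "r y = enn2real (RN_deriv Qh ?P y)" for y
  have r[measurable]: "r \<in> borel_measurable Qh" unfolding r_def by measurable
  have r0: "0 \<le> r y" for y by (simp add: r_def)
  have sets: "sets ?P = sets Qh" using Qh(2) by simp
  have Pr: "?P = density Qh r"
    unfolding r_def by (rule density_enn2real_RN_deriv[OF P Qh(1) sets ac, symmetric])
  define g where "g y = ln (q y / b y)" for y
  have g[measurable]: "g \<in> borel_measurable Q0" unfolding g_def by measurable
  define Gp where "Gp = (\<integral>\<^sup>+y. ennreal (max 0 (g y)) \<partial>?P)"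
  define Gn where "Gn = (\<integral>\<^sup>+y. ennreal (max 0 (- g y)) \<partial>?P)"
  \<comment> \<open>Both parts of \<open>g\<close> under \<open>?P\<close> are written twice: over
    \<open>Q0\<close> with density \<open>q\<close>, which produces the divergence of
    \<open>q\<close> from \<open>b\<close>, and over \<open>Qh\<close> with density
    \<open>r\<close>, where the variational inequality applies pointwise. The finite part
    \<open>Gn\<close> cancels in the end.\<close>
  have Gpq: "Gp = (\<integral>\<^sup>+y. ennreal (q y * max 0 (g y)) \<partial>Q0)"
    unfolding Gp_def by (subst nn_integral_density) (auto simp: ennreal_mult q0 less_imp_le)
  have Gnq: "Gn = (\<integral>\<^sup>+y. ennreal (q y * max 0 (- g y)) \<partial>Q0)"
    unfolding Gn_def by (subst nn_integral_density) (auto simp: ennreal_mult q0 less_imp_le)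
  have Gpr: "Gp = (\<integral>\<^sup>+y. ennreal (r y * max 0 (g y)) \<partial>Qh)"
    unfolding Gp_def Pr by (subst nn_integral_density) (auto simp: ennreal_mult r0)
  have Gnr: "Gn = (\<integral>\<^sup>+y. ennreal (r y * max 0 (- g y)) \<partial>Qh)"
    unfolding Gn_def Pr by (subst nn_integral_density) (auto simp: ennreal_mult r0)
  have g_eq: "q y * g y = klf (q y) (b y) + q y - b y" for y
    by (simp add: klf_def g_def)
  have "q y * max 0 (- g y) \<le> b y" for y
    using klf_nonneg[of "q y" "b y"] q0[of y] b0[of y] g_eq[of y] by (auto simp: max_def)
  then have "Gn \<le> (\<integral>\<^sup>+y. ennreal (b y) \<partial>Q0)"
    unfolding Gnq by (intro nn_integral_mono ennreal_leI)
  then have Gn: "Gn < top" using b1 by (simp add: order_le_less_trans)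
  have kl: "kl_loss ?P Qh = (\<integral>\<^sup>+y. ennreal (klf (r y) 1) \<partial>Qh)"
    unfolding r_def by (rule kl_loss_eq_klf[OF P Qh(1) sets ac])
  have "Gp + 1 = (\<integral>\<^sup>+y. ennreal (r y * max 0 (g y)) + 1 \<partial>Qh)"
    unfolding Gpr by (subst nn_integral_add) (auto simp: Qh.emeasure_space_1)
  also have "\<dots> \<le> (\<integral>\<^sup>+y. ennreal (klf (r y) 1) + ennreal (q y / b y) + ennreal (r y * max 0 (- g y)) \<partial>Qh)"
  proof (rule nn_integral_mono)
    fix y
    have "r y * g y + 1 \<le> klf (r y) 1 + q y / b y"
      unfolding g_def using r0 q0 b0 by (intro klf_variational) auto
    moreover have "r y * max 0 (g y) = r y * g y + r y * max 0 (- g y)"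
      by (auto simp: max_def)
    ultimately have "r y * max 0 (g y) + 1 \<le> klf (r y) 1 + q y / b y + r y * max 0 (- g y)"
      by simp
    then have "ennreal (r y * max 0 (g y) + 1) \<le> ennreal (klf (r y) 1 + q y / b y + r y * max 0 (- g y))"
      by (rule ennreal_leI)
    then show "ennreal (r y * max 0 (g y)) + 1 \<le> ennreal (klf (r y) 1) + ennreal (q y / b y) + ennreal (r y * max 0 (- g y))"
      using r0[of y] q0[of y] b0[of y] klf_nonneg[of "r y" 1] by (simp add: ennreal_plus)
  qed
  also have "\<dots> = kl_loss ?P Qh + (\<integral>\<^sup>+y. ennreal (q y / b y) \<partial>Qh) + Gn"
    unfolding kl Gnr by (simp add: nn_integral_add)
  finally have 1: "Gp + 1 \<le> \<dots>" .
  have "Gp + 1 = (\<integral>\<^sup>+y. ennreal (q y * max 0 (g y)) + ennreal (b y) \<partial>Q0)"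
    unfolding Gpq b1[symmetric] by (subst nn_integral_add) auto
  also have "\<dots> = (\<integral>\<^sup>+y. ennreal (klf (q y) (b y)) + ennreal (q y) + ennreal (q y * max 0 (- g y)) \<partial>Q0)"
  proof (rule nn_integral_cong)
    fix y
    have "q y * max 0 (g y) + b y = klf (q y) (b y) + q y + q y * max 0 (- g y)"
      using g_eq[of y] by (auto simp: max_def)
    then have "ennreal (q y * max 0 (g y) + b y) = ennreal (klf (q y) (b y) + q y + q y * max 0 (- g y))"
      by simp
    then show "ennreal (q y * max 0 (g y)) + ennreal (b y) =
        ennreal (klf (q y) (b y)) + ennreal (q y) + ennreal (q y * max 0 (- g y))"
      using q0[of y] b0[of y] klf_nonneg[of "q y" "b y"] by (simp add: ennreal_plus less_imp_le)
  qed
  also have "\<dots> = (\<integral>\<^sup>+y. ennreal (klf (q y) (b y)) \<partial>Q0) + 1 + Gn"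
    unfolding Gnq q1[symmetric] by (simp add: nn_integral_add)
  finally have "Gn + ((\<integral>\<^sup>+y. ennreal (klf (q y) (b y)) \<partial>Q0) + 1)
      \<le> Gn + (kl_loss ?P Qh + (\<integral>\<^sup>+y. ennreal (q y / b y) \<partial>Qh))"
    using 1 by (simp add: ac_simps)
  then show ?thesis
    using Gn by (auto simp: ennreal_add_left_cancel_le)
qed

text \<open>Where the log ratio is integrable, the nonnegative integral is the usual signed one,
  because the correction \<open>- a + b\<close> has integral zero.\<close>

lemma nn_integral_klf:
  fixes a b :: "'a \<Rightarrow> real"
  assumes a[measurable]: "a \<in> borel_measurable M" and b[measurable]: "b \<in> borel_measurable M"
    and a0: "\<And>y. 0 < a y" and b0: "\<And>y. 0 < b y"
    and a1: "(\<integral>\<^sup>+y. ennreal (a y) \<partial>M) = 1" and b1: "(\<integral>\<^sup>+y. ennreal (b y) \<partial>M) = 1"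
    and int: "integrable (density M a) (\<lambda>y. ln (a y / b y))"
  shows "(\<integral>\<^sup>+y. ennreal (klf (a y) (b y)) \<partial>M) = ennreal (\<integral>y. ln (a y / b y) \<partial>density M a)"
    and "0 \<le> (\<integral>y. ln (a y / b y) \<partial>density M a)"
proof -
  have ia: "integrable M a" "integral\<^sup>L M a = 1" and ib: "integrable M b" "integral\<^sup>L M b = 1"
    using a0 b0 a1 b1 by (auto intro!: integrableI_nonneg simp: integral_eq_nn_integral less_imp_le)
  have il: "integrable M (\<lambda>y. a y * ln (a y / b y))"
    using int a0 by (subst (asm) integrable_density) (auto simp: less_imp_le)
  have "(\<integral>\<^sup>+y. ennreal (klf (a y) (b y)) \<partial>M) = ennreal (\<integral>y. klf (a y) (b y) \<partial>M)"
    using il ia ib a0 b0 by (intro nn_integral_eq_integral) (auto simp: klf_def[abs_def] less_imp_le intro!: AE_I2 klf_nonneg[unfolded klf_def])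
  moreover have eq: "(\<integral>y. klf (a y) (b y) \<partial>M) = (\<integral>y. ln (a y / b y) \<partial>density M a)"
    using il ia ib a0 by (subst integral_density) (auto simp: klf_def[abs_def] less_imp_le)
  ultimately show "(\<integral>\<^sup>+y. ennreal (klf (a y) (b y)) \<partial>M) = ennreal (\<integral>y. ln (a y / b y) \<partial>density M a)"
    by simp
  show "0 \<le> (\<integral>y. ln (a y / b y) \<partial>density M a)"
    unfolding eq[symmetric] using a0 b0 by (intro integral_nonneg_AE AE_I2 klf_nonneg) (auto simp: less_imp_le)
qed

section \<open>Divergence between infinite products\<close>

text \<open>Likelihood ratios may tend to 0, so continuity is needed at the endpoint too, where
  \<open>z * ln z\<close> tends to 0.\<close>

lemma continuous_on_klf_1: "continuous_on {0..} (\<lambda>z. klf z 1)"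
proof -
  have "((\<lambda>z::real. klf z 1) \<longlongrightarrow> klf 0 1) (at 0 within {0..})"
  proof -
    have "((\<lambda>z::real. z * ln z) \<longlongrightarrow> 0) (at_right 0)" by real_asymp
    then have "((\<lambda>z::real. z * ln z - z + 1) \<longlongrightarrow> 0 - 0 + 1) (at_right 0)"
      by (intro tendsto_intros)
    then show ?thesis
      by (simp add: klf_def at_within_Ici_at_right)
  qed
  moreover have "((\<lambda>z::real. klf z 1) \<longlongrightarrow> klf x 1) (at x within {0..})" if "x > 0" for x
    unfolding klf_def using that by (auto intro!: tendsto_eq_intros)
  ultimately show ?thesis
    unfolding continuous_on by (metis atLeast_iff less_eq_real_def)
qed

text \<open>Kakutani's condition enters as a bound on second moments with summable exponents,
  required only from \<open>T\<close> on: in the Gaussian application the two variances agree there,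
  and the second moment is exactly \<open>exp (s i)\<close>.\<close>

locale product_ratio =
  fixes M :: "nat \<Rightarrow> 'a measure" and r :: "nat \<Rightarrow> 'a \<Rightarrow> real" and s :: "nat \<Rightarrow> real" and T :: nat
  assumes prob_M: "\<And>i. prob_space (M i)"
    and r_meas: "\<And>i. r i \<in> borel_measurable (M i)"
    and r_pos: "\<And>i y. 0 < r i y"
    and r_int: "\<And>i. (\<integral>\<^sup>+y. ennreal (r i y) \<partial>M i) = 1"
    and r_sq: "\<And>i. T \<le> i \<Longrightarrow> (\<integral>\<^sup>+y. ennreal ((r i y)\<^sup>2) \<partial>M i) \<le> ennreal (exp (s i))"
    and s_summable: "summable s"
begin

abbreviation "N i \<equiv> density (M i) (\<lambda>y. ennreal (r i y))"

abbreviation "Q \<equiv> PiM UNIV M"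

definition L :: "nat \<Rightarrow> (nat \<Rightarrow> 'a) \<Rightarrow> real" where
  "L n x = (\<Prod>i<n. r i (x i))"

lemma r_comp_meas: "(\<lambda>x. r i (x i)) \<in> borel_measurable Q"
  using measurable_compose[OF measurable_component_singleton[of i UNIV M] r_meas[of i]] by simp

lemma L_meas [measurable]: "L n \<in> borel_measurable Q"
  unfolding L_def[abs_def] by (intro borel_measurable_prod r_comp_meas)

lemma L_pos: "0 < L n x"
  unfolding L_def by (intro prod_pos) (auto simp: r_pos)

lemma prob_N: "prob_space (N i)"
  using r_meas r_int[of i] by (intro prob_spaceI) (simp add: emeasure_density cong: nn_integral_cong_simp)

sublocale Q: prob_space Q by (intro prob_space_PiM prob_M)

lemma density_L: "density Q (\<lambda>x. ennreal (L n x)) = PiM UNIV (\<lambda>i. if i < n then N i else M i)"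
proof -
  have "density Q (\<lambda>x. \<Prod>i\<in>{..<n}. ennreal (r i (x i)))
      = PiM UNIV (\<lambda>i. if i \<in> {..<n} then density (M i) (\<lambda>y. ennreal (r i y)) else M i)"
    by (intro density_PiM prob_M) (use r_meas r_int in auto)
  moreover have "(\<Prod>i\<in>{..<n}. ennreal (r i (x i))) = ennreal (L n x)" for x
    unfolding L_def using r_pos by (intro prod_ennreal) (auto simp: less_imp_le)
  ultimately show ?thesis by simp
qed

lemma prob_mixed: "prob_space (if i < n then N i else M i)"
  using prob_N prob_M by auto

lemma nn_integral_L: "(\<integral>\<^sup>+x. ennreal (L n x) \<partial>Q) = 1"
proof -
  have "prob_space (PiM UNIV (\<lambda>i. if i < n then N i else M i))"
    by (intro prob_space_PiM prob_mixed)
  then have "emeasure (density Q (\<lambda>x. ennreal (L n x))) (space Q) = 1"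
    unfolding density_L[symmetric] using prob_space.emeasure_space_1 by fastforce
  then show ?thesis by (simp add: emeasure_density cong: nn_integral_cong_simp)
qed

text \<open>With \<open>R\<close> the product of the factors from \<open>m\<close> to
  \<open>n\<close>, the second moment of \<open>R - 1\<close> under the density \<open>L m\<close>
  is at most \<open>\<mu>^2\<close>. The inequality
  \<open>2 * \<mu> * |R - 1| \<le> (R - 1)^2 + \<mu>^2\<close> takes the place of
  Cauchy-Schwarz.\<close>

lemma L1_bound:
  assumes "T \<le> m" "m \<le> n" and \<mu>: "0 < \<mu>" "exp (\<Sum>i\<in>{m..<n}. s i) - 1 \<le> \<mu>\<^sup>2"
  shows "(\<integral>\<^sup>+x. ennreal \<bar>L n x - L m x\<bar> \<partial>Q) \<le> ennreal \<mu>"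
proof -
  define R where "R x = (\<Prod>i\<in>{m..<n}. r i (x i))" for x
  have R[measurable]: "R \<in> borel_measurable Q"
    unfolding R_def[abs_def] by (intro borel_measurable_prod r_comp_meas)
  have LR: "L n x = L m x * R x" for x
  proof -
    have "{..<n} = {..<m} \<union> {m..<n}" using assms by auto
    then show ?thesis unfolding L_def R_def by (simp add: prod.union_disjoint ivl_disj_int)
  qed
  have "(\<integral>\<^sup>+x. ennreal (L m x * (R x)\<^sup>2) \<partial>Q)
     = (\<integral>\<^sup>+x. (\<Prod>i\<in>{..<n}. ennreal (if i < m then r i (x i) else (r i (x i))\<^sup>2)) \<partial>Q)"
  proof (intro nn_integral_cong)
    fix x
    have eq: "{..<n} = {..<m} \<union> {m..<n}" using assms by auto
    have "(\<Prod>i\<in>{..<n}. if i < m then r i (x i) else (r i (x i))\<^sup>2) = L m x * (R x)\<^sup>2"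
      unfolding eq L_def R_def by (subst prod.union_disjoint) (auto simp: prod_power_distrib)
    then show "ennreal (L m x * (R x)\<^sup>2) = (\<Prod>i\<in>{..<n}. ennreal (if i < m then r i (x i) else (r i (x i))\<^sup>2))"
      by (subst prod_ennreal) (auto simp: less_imp_le r_pos)
  qed
  also have "\<dots> = (\<Prod>i\<in>{..<n}. \<integral>\<^sup>+y. ennreal (if i < m then r i y else (r i y)\<^sup>2) \<partial>M i)"
    using r_meas by (intro nn_integral_PiM_prod[where f = "\<lambda>i y. ennreal (if i < m then r i y else (r i y)\<^sup>2)"] prob_M) auto
  also have "\<dots> \<le> (\<Prod>i\<in>{..<n}. if i < m then 1 else ennreal (exp (s i)))"
    using assms r_int r_sq by (intro prod_mono_ennreal) auto
  also have "\<dots> = (\<Prod>i\<in>{m..<n}. ennreal (exp (s i)))"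
    using assms by (intro prod.mono_neutral_cong_right) auto
  also have "\<dots> = ennreal (exp (\<Sum>i\<in>{m..<n}. s i))"
    by (subst prod_ennreal) (auto simp: exp_sum)
  also have "\<dots> \<le> ennreal (1 + \<mu>\<^sup>2)" using \<mu> by (intro ennreal_leI) simp
  finally have R2: "(\<integral>\<^sup>+x. ennreal (L m x * (R x)\<^sup>2) \<partial>Q) \<le> ennreal (1 + \<mu>\<^sup>2)" .
  have e2: "2 * ennreal z = ennreal (2 * z)" for z
    by (metis ennreal_mult' ennreal_numeral zero_le_numeral)
  have e1: "1 + ennreal (\<mu>\<^sup>2) = ennreal (1 + \<mu>\<^sup>2)" by simp
  define X where "X = (\<integral>\<^sup>+x. ennreal \<bar>L n x - L m x\<bar> \<partial>Q)"
  \<comment> \<open>Expanding the square leaves a term \<open>- 2 * L n\<close>; it is moved to the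
    left, where it contributes the 2.\<close>
  have "ennreal (2 * \<mu>) * X + 2 = (\<integral>\<^sup>+x. ennreal (2 * \<mu>) * ennreal \<bar>L n x - L m x\<bar> + 2 * ennreal (L n x) \<partial>Q)"
    unfolding X_def by (simp add: nn_integral_add nn_integral_cmult nn_integral_L)
  also have "\<dots> \<le> (\<integral>\<^sup>+x. ennreal (L m x * (R x)\<^sup>2) + (1 + ennreal (\<mu>\<^sup>2)) * ennreal (L m x) \<partial>Q)"
  proof (rule nn_integral_mono)
    fix x
    have "2 * \<mu> * \<bar>R x - 1\<bar> \<le> (R x - 1)\<^sup>2 + \<mu>\<^sup>2"
      using sum_squares_bound[of "\<bar>R x - 1\<bar>" \<mu>] by (simp add: mult.commute mult.left_commute)
    then have "L m x * (2 * \<mu> * \<bar>R x - 1\<bar>) \<le> L m x * ((R x - 1)\<^sup>2 + \<mu>\<^sup>2)"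
      using L_pos[of m x] by (intro mult_left_mono) auto
    moreover have "\<bar>L n x - L m x\<bar> = L m x * \<bar>R x - 1\<bar>"
    proof -
      have "L n x - L m x = L m x * (R x - 1)" by (simp add: LR algebra_simps)
      then show ?thesis using L_pos[of m x] by (simp add: abs_mult)
    qed
    ultimately have "2 * \<mu> * \<bar>L n x - L m x\<bar> + 2 * L n x \<le> L m x * (R x)\<^sup>2 + (1 + \<mu>\<^sup>2) * L m x"
      unfolding LR by (simp add: power2_eq_square algebra_simps)
    then have "ennreal (2 * \<mu> * \<bar>L n x - L m x\<bar> + 2 * L n x) \<le> ennreal (L m x * (R x)\<^sup>2 + (1 + \<mu>\<^sup>2) * L m x)"
      by (rule ennreal_leI)
    then show "ennreal (2 * \<mu>) * ennreal \<bar>L n x - L m x\<bar> + 2 * ennreal (L n x)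
        \<le> ennreal (L m x * (R x)\<^sup>2) + (1 + ennreal (\<mu>\<^sup>2)) * ennreal (L m x)"
      unfolding e2 e1 using \<mu> L_pos[of m x] L_pos[of n x]
      by (simp del: ennreal_plus add: less_imp_le flip: ennreal_plus ennreal_mult)
  qed
  also have "\<dots> = (\<integral>\<^sup>+x. ennreal (L m x * (R x)\<^sup>2) \<partial>Q) + (1 + ennreal (\<mu>\<^sup>2))"
    by (simp add: nn_integral_add nn_integral_cmult nn_integral_L)
  also have "\<dots> \<le> ennreal (1 + \<mu>\<^sup>2) + (1 + ennreal (\<mu>\<^sup>2))"
    by (rule add_right_mono[OF R2])
  also have "\<dots> = ennreal (2 * \<mu> * \<mu>) + 2"
  proof -
    have "ennreal (1 + \<mu>\<^sup>2) + ennreal (1 + \<mu>\<^sup>2) = ennreal (2 * \<mu> * \<mu> + 2)"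
      by (subst ennreal_plus[symmetric]) (auto simp: power2_eq_square algebra_simps)
    also have "\<dots> = ennreal (2 * \<mu> * \<mu>) + ennreal 2"
      using \<mu> by (intro ennreal_plus) auto
    finally show ?thesis by (simp only: e1 ennreal_numeral)
  qed
  also have "ennreal (2 * \<mu> * \<mu>) = ennreal (2 * \<mu>) * ennreal \<mu>"
    using \<mu> by (intro ennreal_mult) auto
  finally have "2 + ennreal (2 * \<mu>) * X \<le> 2 + ennreal (2 * \<mu>) * ennreal \<mu>"
    by (simp only: add.commute)
  then have "ennreal (2 * \<mu>) * X \<le> ennreal (2 * \<mu>) * ennreal \<mu>"
    using ennreal_add_left_cancel_le[of 2 "ennreal (2 * \<mu>) * X" "ennreal (2 * \<mu>) * ennreal \<mu>"] by auto
  then show ?thesis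
    using \<mu> unfolding X_def[symmetric] by (subst (asm) ennreal_mult_le_mult_iff) auto
qed

text \<open>The rate \<open>(1/2) ^ k\<close> is chosen because it is summable, which yields almost
  sure convergence in \<open>ex_limit\<close>.\<close>

lemma ex_subseq:
  obtains n :: "nat \<Rightarrow> nat" where "\<And>k. k \<le> n k"
    "\<And>k j. k \<le> j \<Longrightarrow> (\<integral>\<^sup>+x. ennreal \<bar>L (n j) x - L (n k) x\<bar> \<partial>Q) \<le> ennreal ((1/2) ^ k)"
proof -
  have "\<exists>K. \<forall>m\<ge>K. \<forall>j. exp (\<Sum>i\<in>{m..<j}. s i) - 1 \<le> ((1/2) ^ k)\<^sup>2" for k
  proof -
    define e where "e = ln (1 + ((1/2::real) ^ k)\<^sup>2)"
    have "0 < ((1/2::real) ^ k)\<^sup>2" by simp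
    then have e: "e > 0" unfolding e_def by (simp add: ln_gt_zero)
    then obtain K where K: "\<forall>m\<ge>K. \<forall>j. norm (\<Sum>i\<in>{m..<j}. s i) < e"
      using s_summable unfolding summable_Cauchy by blast
    have "exp (\<Sum>i\<in>{m..<j}. s i) - 1 \<le> ((1/2) ^ k)\<^sup>2" if "m \<ge> K" for m j
    proof -
      have "(\<Sum>i\<in>{m..<j}. s i) \<le> e" using K that by (metis abs_ge_self less_imp_le order_trans real_norm_def)
      then have "exp (\<Sum>i\<in>{m..<j}. s i) \<le> exp e" by simp
      also have "exp e = 1 + ((1/2) ^ k)\<^sup>2" unfolding e_def by (rule exp_ln) (simp add: add_pos_nonneg)
      finally show ?thesis by simp
    qed
    then show ?thesis by blast
  qed
  then obtain K where K: "\<And>k m j. m \<ge> K k \<Longrightarrow> exp (\<Sum>i\<in>{m..<j}. s i) - 1 \<le> ((1/2) ^ k)\<^sup>2"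
    by metis
  \<comment> \<open>The summands put \<open>n k\<close> beyond \<open>T\<close>, make it unbounded,
    and let it dominate \<open>K k\<close> while staying monotone.\<close>
  define n where "n k = T + k + (\<Sum>i\<le>k. K i)" for k
  have nK: "K k \<le> n k" for k
    unfolding n_def using member_le_sum[of k "{..k}" K] by auto
  have mono: "mono n"
    unfolding n_def by (intro monoI add_mono sum_mono2) auto
  show ?thesis
  proof
    show "k \<le> n k" for k by (simp add: n_def)
    show "(\<integral>\<^sup>+x. ennreal \<bar>L (n j) x - L (n k) x\<bar> \<partial>Q) \<le> ennreal ((1/2) ^ k)" if "k \<le> j" for k j
      using monoD[OF mono that] K[OF nK]
      by (intro L1_bound) (auto simp: n_def)
  qed
qed

text \<open>The increments along the subsequence are absolutely summable almost surely, because
  their expectations are. Fatou's lemma carries the rate in mean over to the limit.\<close>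

lemma ex_limit:
  obtains Linf n where "Linf \<in> borel_measurable Q" "\<And>x. 0 \<le> Linf x" "\<And>k. k \<le> n k"
    "AE x in Q. (\<lambda>k. L (n k) x) \<longlonglongrightarrow> Linf x"
    "\<And>k. (\<integral>\<^sup>+x. ennreal \<bar>Linf x - L (n k) x\<bar> \<partial>Q) \<le> ennreal ((1/2) ^ k)"
proof -
  obtain n where n: "\<And>k. k \<le> n k"
    and L1: "\<And>k j. k \<le> j \<Longrightarrow> (\<integral>\<^sup>+x. ennreal \<bar>L (n j) x - L (n k) x\<bar> \<partial>Q) \<le> ennreal ((1/2) ^ k)"
    using ex_subseq by metis
  \<comment> \<open>The maximum with 0 gives nonnegativity everywhere, also on the null set where
    \<open>lim\<close> is unspecified.\<close>
  define Linf where "Linf x = max 0 (lim (\<lambda>k. L (n k) x))" for x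
  have meas[measurable]: "Linf \<in> borel_measurable Q"
    unfolding Linf_def[abs_def] by measurable
  have "(\<integral>\<^sup>+x. (\<Sum>k. ennreal \<bar>L (n (Suc k)) x - L (n k) x\<bar>) \<partial>Q)
      = (\<Sum>k. \<integral>\<^sup>+x. ennreal \<bar>L (n (Suc k)) x - L (n k) x\<bar> \<partial>Q)"
    by (intro nn_integral_suminf) measurable
  also have "\<dots> \<le> (\<Sum>k. ennreal ((1/2) ^ k))"
    by (intro suminf_le L1) auto
  also have "\<dots> < \<infinity>"
    by (subst suminf_ennreal2) (auto intro!: summable_geometric)
  finally have "AE x in Q. (\<Sum>k. ennreal \<bar>L (n (Suc k)) x - L (n k) x\<bar>) \<noteq> \<infinity>"
    by (intro nn_integral_PInf_AE) auto
  then have conv: "AE x in Q. (\<lambda>k. L (n k) x) \<longlonglongrightarrow> Linf x"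
  proof eventually_elim
    case (elim x)
    then have "summable (\<lambda>k. \<bar>L (n (Suc k)) x - L (n k) x\<bar>)"
      by (intro summable_suminf_not_top) auto
    then have "summable (\<lambda>k. L (n (Suc k)) x - L (n k) x)"
      by (rule summable_rabs_cancel)
    then have "convergent (\<lambda>m. \<Sum>k<m. L (n (Suc k)) x - L (n k) x)"
      by (simp add: summable_iff_convergent)
    then have "convergent (\<lambda>m. L (n m) x - L (n 0) x)"
      by (subst (asm) sum_lessThan_telescope)
    then have "convergent (\<lambda>m. (L (n m) x - L (n 0) x) + L (n 0) x)"
      by (intro convergent_add convergent_const)
    then have "(\<lambda>k. L (n k) x) \<longlonglongrightarrow> lim (\<lambda>k. L (n k) x)"
      by (simp add: convergent_LIMSEQ_iff)
    moreover from this have "0 \<le> lim (\<lambda>k. L (n k) x)"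
      by (intro LIMSEQ_le_const) (auto intro!: less_imp_le L_pos)
    ultimately show ?case by (simp add: Linf_def max_def)
  qed
  have "(\<integral>\<^sup>+x. ennreal \<bar>Linf x - L (n k) x\<bar> \<partial>Q) \<le> ennreal ((1/2) ^ k)" for k
  proof -
    have "(\<integral>\<^sup>+x. ennreal \<bar>Linf x - L (n k) x\<bar> \<partial>Q)
        = (\<integral>\<^sup>+x. liminf (\<lambda>j. ennreal \<bar>L (n j) x - L (n k) x\<bar>) \<partial>Q)"
    proof (rule nn_integral_cong_AE, use conv in eventually_elim)
      case (elim x)
      then have "(\<lambda>j. ennreal \<bar>L (n j) x - L (n k) x\<bar>) \<longlonglongrightarrow> ennreal \<bar>Linf x - L (n k) x\<bar>"
        by (intro tendsto_ennrealI tendsto_intros)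
      then show ?case by (intro lim_imp_Liminf[symmetric]) simp_all
    qed
    also have "\<dots> \<le> liminf (\<lambda>j. \<integral>\<^sup>+x. ennreal \<bar>L (n j) x - L (n k) x\<bar> \<partial>Q)"
      by (intro nn_integral_liminf) measurable
    also have "\<dots> \<le> ennreal ((1/2) ^ k)"
    proof -
      have "liminf (\<lambda>j. \<integral>\<^sup>+x. ennreal \<bar>L (n j) x - L (n k) x\<bar> \<partial>Q) \<le> liminf (\<lambda>j. ennreal ((1/2) ^ k))"
        by (intro Liminf_mono eventually_sequentiallyI[of k] L1)
      then show ?thesis by (simp add: Liminf_const)
    qed
    finally show ?thesis .
  qed
  then show ?thesis using that[of Linf n, OF meas _ n conv] by (auto simp: Linf_def)
qed

text \<open>A cylinder involves finitely many coordinates, so its mass under the density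
  \<open>L (n k)\<close> is constant once these are included; convergence in mean passes this value
  to \<open>Linf\<close>.\<close>

lemma density_limit:
  assumes [measurable]: "Linf \<in> borel_measurable Q" and nn: "\<And>x. 0 \<le> Linf x"
    and n: "\<And>k. k \<le> n k"
    and L1: "\<And>k. (\<integral>\<^sup>+x. ennreal \<bar>Linf x - L (n k) x\<bar> \<partial>Q) \<le> ennreal ((1/2) ^ k)"
  shows "density Q (\<lambda>x. ennreal (Linf x)) = PiM UNIV N"
proof (rule eq_PiM_probI[OF prob_N])
  have sets_N: "sets (PiM UNIV N) = sets Q" by (intro sets_PiM_cong) auto
  then show "sets (density Q (\<lambda>x. ennreal (Linf x))) = sets (PiM UNIV N)" by simp
  fix J :: "nat set" and F assume J: "finite J" and F: "\<And>j. j \<in> J \<Longrightarrow> F j \<in> sets (N j)"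
  let ?E = "prod_emb UNIV N J (Pi\<^sub>E J F)"
  have E[measurable]: "?E \<in> sets Q"
    unfolding sets_N[symmetric] using J F by (intro sets_PiM_I) auto
  define c where "c = (\<Prod>j\<in>J. emeasure (N j) (F j))"
  obtain k0 where k0: "\<forall>j\<in>J. j < k0"
    using J by (metis finite_nat_set_iff_bounded)
  have c: "(\<integral>\<^sup>+x. ennreal (L (n k) x) * indicator ?E x \<partial>Q) = c" if "k0 \<le> k" for k
  proof -
    let ?K = "\<lambda>i. if i < n k then N i else M i"
    have less: "j < n k" if "j \<in> J" for j
      using k0 that \<open>k0 \<le> k\<close> n[of k] by fastforce
    interpret K: product_prob_space ?K UNIV
      by (intro product_prob_spaceI prob_mixed)
    have sp: "space (?K i) = space (N i)" for i by auto
    have "?E = prod_emb UNIV ?K J (Pi\<^sub>E J F)"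
      unfolding prod_emb_def sp ..
    then have "emeasure (PiM UNIV ?K) ?E = (\<Prod>j\<in>J. emeasure (?K j) (F j))"
      using J F less by (subst K.emeasure_PiM_emb[symmetric]) auto
    also have "\<dots> = c" unfolding c_def using less by (intro prod.cong) auto
    finally show ?thesis
      unfolding density_L[symmetric] by (subst (asm) emeasure_density) auto
  qed
  define I where "I = (\<integral>\<^sup>+x. ennreal (Linf x) * indicator ?E x \<partial>Q)"
  have "I \<le> c + ennreal ((1/2)^k)" "c \<le> I + ennreal ((1/2)^k)" if k: "k0 \<le> k" for k
  proof -
    have "ennreal (Linf x) \<le> ennreal (L (n k) x) + ennreal \<bar>Linf x - L (n k) x\<bar>"
      "ennreal (L (n k) x) \<le> ennreal (Linf x) + ennreal \<bar>Linf x - L (n k) x\<bar>" for x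
      using nn[of x] L_pos[of "n k" x] by (auto simp flip: ennreal_plus intro!: ennreal_leI)
    then have *: "ennreal (Linf x) * indicator ?E x \<le> ennreal (L (n k) x) * indicator ?E x + ennreal \<bar>Linf x - L (n k) x\<bar>"
      "ennreal (L (n k) x) * indicator ?E x \<le> ennreal (Linf x) * indicator ?E x + ennreal \<bar>Linf x - L (n k) x\<bar>" for x
      by (auto simp: indicator_def)
    have "I \<le> (\<integral>\<^sup>+x. ennreal (L (n k) x) * indicator ?E x + ennreal \<bar>Linf x - L (n k) x\<bar> \<partial>Q)"
      unfolding I_def by (intro nn_integral_mono *)
    also have "\<dots> = c + (\<integral>\<^sup>+x. ennreal \<bar>Linf x - L (n k) x\<bar> \<partial>Q)"
      by (subst nn_integral_add) (auto simp: c[OF k])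
    finally show "I \<le> c + ennreal ((1/2)^k)" using L1[of k] by (meson add_left_mono order_trans)
    have "c \<le> (\<integral>\<^sup>+x. ennreal (Linf x) * indicator ?E x + ennreal \<bar>Linf x - L (n k) x\<bar> \<partial>Q)"
      unfolding c[OF k, symmetric] by (intro nn_integral_mono *)
    also have "\<dots> = I + (\<integral>\<^sup>+x. ennreal \<bar>Linf x - L (n k) x\<bar> \<partial>Q)"
      unfolding I_def by (subst nn_integral_add) auto
    finally show "c \<le> I + ennreal ((1/2)^k)" using L1[of k] by (meson add_left_mono order_trans)
  qed
  moreover have "(\<lambda>k. z + ennreal ((1/2)^k)) \<longlonglongrightarrow> z + ennreal 0" for z
    by (intro tendsto_add tendsto_const tendsto_ennrealI LIMSEQ_realpow_zero) auto
  ultimately have "I \<le> c + ennreal 0" "c \<le> I + ennreal 0"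
    by (meson LIMSEQ_le_const)+
  then have "I = c" by simp
  then show "emeasure (density Q (\<lambda>x. ennreal (Linf x))) ?E = (\<Prod>j\<in>J. emeasure (N j) (F j))"
    unfolding c_def I_def by (subst emeasure_density) auto
qed

text \<open>Chain rule: the log ratio is a sum over coordinates, and under the reweighted measure
  coordinate \<open>i < n\<close> has law \<open>N i\<close>.\<close>

lemma nn_integral_klf_L:
  assumes int: "\<And>i. integrable (N i) (\<lambda>y. ln (r i y))"
  shows "(\<integral>\<^sup>+x. ennreal (klf (L n x) 1) \<partial>Q) = ennreal (\<Sum>i<n. \<integral>y. ln (r i y) \<partial>N i)"
proof -
  let ?K = "\<lambda>i. if i < n then N i else M i"
  have prob_K: "prob_space (?K i)" for i by (rule prob_mixed)
  have lnL: "ln (L n x / 1) = (\<Sum>i<n. ln (r i (x i)))" for x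
    unfolding L_def div_by_1 by (intro ln_prod) (auto simp: less_imp_neq[OF r_pos, symmetric])
  have int': "integrable (PiM UNIV ?K) (\<lambda>x. ln (r i (x i)))" if "i < n" for i
    using int[of i] that by (intro integrable_PiM_component[OF prob_K]) auto
  have "integrable (density Q (L n)) (\<lambda>x. ln (L n x / 1))"
    unfolding lnL density_L using int' by (intro Bochner_Integration.integrable_sum) auto
  then have "(\<integral>\<^sup>+x. ennreal (klf (L n x) 1) \<partial>Q) = ennreal (\<integral>x. ln (L n x / 1) \<partial>density Q (L n))"
    by (intro nn_integral_klf) (auto simp: L_pos nn_integral_L Q.emeasure_space_1)
  also have "(\<integral>x. ln (L n x / 1) \<partial>density Q (L n)) = (\<Sum>i<n. \<integral>x. ln (r i (x i)) \<partial>PiM UNIV ?K)"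
    unfolding lnL density_L using int' by (intro Bochner_Integration.integral_sum) auto
  also have "\<dots> = (\<Sum>i<n. \<integral>y. ln (r i y) \<partial>N i)"
  proof (intro sum.cong refl)
    fix i assume "i \<in> {..<n}"
    then show "(\<integral>x. ln (r i (x i)) \<partial>PiM UNIV ?K) = (\<integral>y. ln (r i y) \<partial>N i)"
      using r_meas[of i] by (subst integral_PiM_component[OF prob_K]) auto
  qed
  finally show ?thesis .
qed

text \<open>Kakutani's criterion gives absolute continuity; Fatou's lemma bounds the divergence.\<close>
theorem kl_loss_PiM_le:
  assumes int: "\<And>i. integrable (N i) (\<lambda>y. ln (r i y))"
    and C: "\<And>n. (\<Sum>i<n. \<integral>y. ln (r i y) \<partial>N i) \<le> C"
  shows "kl_loss (PiM UNIV N) Q \<le> ennreal C"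
proof -
  obtain Linf n where [measurable]: "Linf \<in> borel_measurable Q" and nn: "\<And>x. 0 \<le> Linf x" 
    and n: "\<And>k. k \<le> n k" and conv: "AE x in Q. (\<lambda>k. L (n k) x) \<longlonglongrightarrow> Linf x"
    and L1: "\<And>k. (\<integral>\<^sup>+x. ennreal \<bar>Linf x - L (n k) x\<bar> \<partial>Q) \<le> ennreal ((1/2) ^ k)"
    by (rule ex_limit) (rule that; assumption)
  have dens: "density Q (\<lambda>x. ennreal (Linf x)) = PiM UNIV N"
    by (rule density_limit[OF \<open>Linf \<in> borel_measurable Q\<close> nn n L1])
  have ac: "absolutely_continuous Q (PiM UNIV N)"
    unfolding dens[symmetric] by (intro absolutely_continuousI_density) measurable
  have sets_N: "sets (PiM UNIV N) = sets Q" by (intro sets_PiM_cong) auto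
  have "kl_loss (PiM UNIV N) Q = (\<integral>\<^sup>+y. ennreal (klf (enn2real (RN_deriv Q (PiM UNIV N) y)) 1) \<partial>Q)"
    by (intro kl_loss_eq_klf ac sets_N prob_space_PiM prob_N Q.prob_space_axioms)
  also have "\<dots> = (\<integral>\<^sup>+y. liminf (\<lambda>k. ennreal (klf (L (n k) y) 1)) \<partial>Q)"
  proof (rule nn_integral_cong_AE)
    have "AE y in Q. ennreal (Linf y) = RN_deriv Q (PiM UNIV N) y"
      by (intro Q.RN_deriv_unique dens) measurable
    then show "AE y in Q. ennreal (klf (enn2real (RN_deriv Q (PiM UNIV N) y)) 1)
        = liminf (\<lambda>k. ennreal (klf (L (n k) y) 1))"
      using conv
    proof eventually_elim
      case (elim y)
      have "(\<lambda>k. klf (L (n k) y) 1) \<longlonglongrightarrow> klf (Linf y) 1"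
        by (rule continuous_on_tendsto_compose[OF continuous_on_klf_1 elim(2)])
           (auto simp: nn less_imp_le[OF L_pos])
      then have "(\<lambda>k. ennreal (klf (L (n k) y) 1)) \<longlonglongrightarrow> ennreal (klf (Linf y) 1)"
        by (rule tendsto_ennrealI)
      moreover have "enn2real (RN_deriv Q (PiM UNIV N) y) = Linf y"
        using elim(1) nn[of y] by (metis enn2real_ennreal)
      ultimately show ?case using lim_imp_Liminf[OF sequentially_bot] by metis
    qed
  qed
  also have "\<dots> \<le> liminf (\<lambda>k. \<integral>\<^sup>+y. ennreal (klf (L (n k) y) 1) \<partial>Q)"
    by (intro nn_integral_liminf) measurable
  also have "\<dots> \<le> liminf (\<lambda>k::nat. ennreal C)"
    unfolding nn_integral_klf_L[OF int] by (intro Liminf_mono always_eventually allI ennreal_leI C)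
  also have "\<dots> = ennreal C" by (simp add: Liminf_const)
  finally show ?thesis .
qed

end

section \<open>Lower bounds from conditioned priors\<close>

text \<open>This is \<open>klf q ((b / \<mu>) * q') \<ge> 0\<close> expanded. It moves the reference
  value from \<open>\<mu>\<close> to \<open>b\<close> at the price \<open>klf q q'\<close>, for an
  auxiliary \<open>q'\<close> that is free to be chosen.\<close>

lemma klf_scale_le:
  assumes "0 < q" "0 < \<mu>" "0 < b" "0 < q'"
  shows "klf q \<mu> + b + q' \<le> klf q b + \<mu> + klf q q' + (b / \<mu>) * q'"
proof -
  have "0 \<le> klf q ((b / \<mu>) * q')" using assms by (intro klf_nonneg) auto
  also have "klf q ((b / \<mu>) * q') = klf q b + \<mu> + klf q q' + (b / \<mu>) * q' - (klf q \<mu> + b + q')"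
    using assms by (simp add: klf_def ln_div ln_mult algebra_simps)
  finally show ?thesis by simp
qed

text \<open>The information lost by conditioning the prior on \<open>A\<close>: a pair \<open>(\<xi>, \<xi>')\<close> of posterior draws
  with \<open>\<xi>\<close> in \<open>A\<close> is coupled with an unconditioned draw by keeping \<open>\<xi>\<close> unless \<open>\<xi>'\<close> misses \<open>A\<close>.\<close>
lemma klf_conditioning:
  fixes p q :: "'p \<Rightarrow> real"
  assumes G: "sigma_finite_measure G" and A[measurable]: "A \<in> sets G"
    and p[measurable]: "p \<in> borel_measurable G" and q[measurable]: "q \<in> borel_measurable G"
    and p0: "\<And>\<xi>. 0 < p \<xi>" and q0: "\<And>\<xi>. 0 < q \<xi>"
    and wA: "(\<integral>\<^sup>+\<xi>\<in>A. ennreal (p \<xi>) \<partial>G) = ennreal wA" "0 < wA"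
    and wC: "(\<integral>\<^sup>+\<xi>\<in>-A. ennreal (p \<xi>) \<partial>G) = ennreal wC" "0 \<le> wC"
    and mA: "(\<integral>\<^sup>+\<xi>\<in>A. ennreal (p \<xi> * q \<xi>) \<partial>G) = ennreal mA" "0 < mA"
    and mC: "(\<integral>\<^sup>+\<xi>\<in>-A. ennreal (p \<xi> * q \<xi>) \<partial>G) = ennreal mC" "0 \<le> mC"
    and w: "w = wA + wC" and m: "m = mA + mC"
  shows "(\<integral>\<^sup>+\<xi>\<in>A. ennreal (p \<xi> * klf (q \<xi>) (m / w)) \<partial>G)
    \<le> (\<integral>\<^sup>+\<xi>\<in>A. ennreal (p \<xi> * klf (q \<xi>) (mA / wA)) \<partial>G)
     + (\<integral>\<^sup>+\<xi>\<in>A. (\<integral>\<^sup>+\<xi>'\<in>-A. ennreal (p \<xi> * p \<xi>' / w * klf (q \<xi>) (q \<xi>')) \<partial>G) \<partial>G)"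
proof -
  define \<mu> where "\<mu> = m / w"
  define b where "b = mA / wA"
  define c where "c = b / \<mu>"
  have w0: "0 < w" and m0: "0 < m" using w m wA wC mA mC by auto
  have \<mu>0: "0 < \<mu>" and b0: "0 < b" using w0 m0 wA mA by (auto simp: \<mu>_def b_def)
  have c0: "0 < c" using \<mu>0 b0 by (simp add: c_def)
  have cA[measurable]: "space G - A \<in> sets G" by simp
  have indC: "indicator (-A) \<xi> = (indicator (space G - A) \<xi> :: ennreal)" if "\<xi> \<in> space G" for \<xi>
    using that by (auto simp: indicator_def)
  have Cint: "(\<integral>\<^sup>+\<xi>\<in>-A. f \<xi> \<partial>G) = (\<integral>\<^sup>+\<xi>\<in>space G - A. f \<xi> \<partial>G)" for f
    by (intro nn_integral_cong) (simp add: indC)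
  note wC' = wC(1)[unfolded Cint] and mC' = mC(1)[unfolded Cint]
  define \<Psi> where "\<Psi> \<xi> = (\<integral>\<^sup>+\<xi>'\<in>space G - A. ennreal (p \<xi>' / w * klf (q \<xi>) (q \<xi>')) \<partial>G)" for \<xi>
  have \<Psi>_meas[measurable]: "(\<lambda>\<xi>. ennreal (p \<xi>) * \<Psi> \<xi>) \<in> borel_measurable G"
  proof -
    interpret sigma_finite_measure G by fact
    show ?thesis unfolding \<Psi>_def by measurable
  qed
  \<comment> \<open>The mean of \<open>q\<close> at the coupled draw: \<open>\<xi>\<close> is kept
    with weight \<open>wA / w\<close>, and otherwise a draw outside \<open>A\<close> is used. Its
    integral against \<open>p\<close> over \<open>A\<close> is \<open>wA * m / w\<close>, so the
    coupled draw has the unconditioned predictive density.\<close>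
  define e where "e \<xi> = (wA / w) * q \<xi> + mC / w" for \<xi>
  have key: "ennreal (klf (q \<xi>) \<mu> + b + e \<xi>) \<le> ennreal (klf (q \<xi>) b + \<mu> + c * e \<xi>) + \<Psi> \<xi>"
    if "\<xi> \<in> space G" for \<xi>
  proof -
    let ?l = "klf (q \<xi>) \<mu> + b" and ?r = "klf (q \<xi>) b + \<mu>"
    have l0: "0 \<le> ?l" and r0: "0 \<le> ?r" using klf_nonneg q0[of \<xi>] \<mu>0 b0 by (auto simp: less_imp_le add_nonneg_nonneg)
    have cint: "(\<integral>\<^sup>+\<xi>'\<in>space G - A. ennreal (p \<xi>' / w * (z + y * q \<xi>')) \<partial>G) = ennreal (wC / w * z + y * (mC / w))"
      if "0 \<le> z" "0 \<le> y" for z y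
    proof -
      have "(\<integral>\<^sup>+\<xi>'\<in>space G - A. ennreal (p \<xi>' / w * (z + y * q \<xi>')) \<partial>G)
        = (\<integral>\<^sup>+\<xi>'. ennreal (z / w) * (ennreal (p \<xi>') * indicator (space G - A) \<xi>')
            + ennreal (y / w) * (ennreal (p \<xi>' * q \<xi>') * indicator (space G - A) \<xi>') \<partial>G)"
      proof (intro nn_integral_cong)
        fix \<xi>'
        have "ennreal (p \<xi>' / w * (z + y * q \<xi>')) = ennreal (z / w * p \<xi>' + y / w * (p \<xi>' * q \<xi>'))"
          by (simp add: algebra_simps)
        also have "\<dots> = ennreal (z / w * p \<xi>') + ennreal (y / w * (p \<xi>' * q \<xi>'))"
          using that p0[of \<xi>'] q0[of \<xi>'] w0 by (intro ennreal_plus) auto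
        also have "\<dots> = ennreal (z / w) * ennreal (p \<xi>') + ennreal (y / w) * ennreal (p \<xi>' * q \<xi>')"
          using that p0[of \<xi>'] q0[of \<xi>'] w0 by (intro arg_cong2[where f = "(+)"] ennreal_mult) auto
        finally show "ennreal (p \<xi>' / w * (z + y * q \<xi>')) * indicator (space G - A) \<xi>' =
            ennreal (z / w) * (ennreal (p \<xi>') * indicator (space G - A) \<xi>')
            + ennreal (y / w) * (ennreal (p \<xi>' * q \<xi>') * indicator (space G - A) \<xi>')"
          by (simp add: indicator_def)
      qed
      also have "\<dots> = ennreal (z / w) * ennreal wC + ennreal (y / w) * ennreal mC"
        by (subst nn_integral_add) (auto simp: nn_integral_cmult wC' mC')
      also have "\<dots> = ennreal (wC / w * z + y * (mC / w))"
        using that wC mC w0 by (simp flip: ennreal_mult ennreal_plus add: mult.commute del: ennreal_plus)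
      finally show ?thesis .
    qed
    \<comment> \<open>The replaced draw: \<open>klf_scale_le\<close> with \<open>q'\<close> the
      value at \<open>\<xi>'\<close>, integrated over the complement with weight
      \<open>p \<xi>' / w\<close>.\<close>
    have "ennreal (wC / w * ?l + mC / w) = (\<integral>\<^sup>+\<xi>'\<in>space G - A. ennreal (p \<xi>' / w * (?l + 1 * q \<xi>')) \<partial>G)"
      using l0 by (subst cint) auto
    also have "\<dots> \<le> (\<integral>\<^sup>+\<xi>'. ennreal (p \<xi>' / w * (?r + c * q \<xi>')) * indicator (space G - A) \<xi>'
       + ennreal (p \<xi>' / w * klf (q \<xi>) (q \<xi>')) * indicator (space G - A) \<xi>' \<partial>G)"
    proof (intro nn_integral_mono)
      fix \<xi>'
      have "p \<xi>' / w * (?l + q \<xi>') \<le> p \<xi>' / w * (?r + klf (q \<xi>) (q \<xi>') + c * q \<xi>')"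
        using klf_scale_le[OF q0 \<mu>0 b0 q0, of \<xi> \<xi>'] p0[of \<xi>'] w0 unfolding c_def by (intro mult_left_mono) auto
      then have "ennreal (p \<xi>' / w * (?l + q \<xi>')) \<le> ennreal (p \<xi>' / w * (?r + c * q \<xi>') + p \<xi>' / w * klf (q \<xi>) (q \<xi>'))"
        by (intro ennreal_leI) (simp add: algebra_simps)
      also have "\<dots> = ennreal (p \<xi>' / w * (?r + c * q \<xi>')) + ennreal (p \<xi>' / w * klf (q \<xi>) (q \<xi>'))"
        using p0[of \<xi>'] w0 q0[of \<xi>] q0[of \<xi>'] r0 c0 klf_nonneg[of "q \<xi>" "q \<xi>'"]
        by (intro ennreal_plus mult_nonneg_nonneg divide_nonneg_nonneg add_nonneg_nonneg[OF r0]) auto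
      finally show "ennreal (p \<xi>' / w * (?l + 1 * q \<xi>')) * indicator (space G - A) \<xi>' \<le>
         ennreal (p \<xi>' / w * (?r + c * q \<xi>')) * indicator (space G - A) \<xi>'
         + ennreal (p \<xi>' / w * klf (q \<xi>) (q \<xi>')) * indicator (space G - A) \<xi>'"
        by (simp add: indicator_def)
    qed
    also have "\<dots> = ennreal (wC / w * ?r + c * (mC / w)) + \<Psi> \<xi>"
      unfolding \<Psi>_def using r0 c0 by (subst nn_integral_add, simp, simp, subst cint) auto
    finally have 1: "ennreal (wC / w * ?l + mC / w) \<le> ennreal (wC / w * ?r + c * (mC / w)) + \<Psi> \<xi>" .
    \<comment> \<open>The kept draw: \<open>q'\<close> is the value at \<open>\<xi>\<close> itself,
      so the price is zero.\<close>
    have "?l + q \<xi> \<le> ?r + c * q \<xi>"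
      using klf_scale_le[OF q0 \<mu>0 b0 q0, of \<xi> \<xi>] q0[of \<xi>] by (simp add: klf_def c_def)
    then have "wA / w * (?l + q \<xi>) \<le> wA / w * (?r + c * q \<xi>)"
      using wA w0 by (intro mult_left_mono) auto
    then have 2: "ennreal (wA / w * (?l + q \<xi>)) \<le> ennreal (wA / w * (?r + c * q \<xi>))"
      by (rule ennreal_leI)
    have "wA / w + wC / w = 1" using w0 by (simp add: w add_divide_distrib[symmetric])
    then have split: "z = wA / w * z + wC / w * z" for z
      by (metis distrib_right mult_1)
    have "?l + e \<xi> = wA / w * (?l + q \<xi>) + (wC / w * ?l + mC / w)"
      by (subst split[of ?l]) (simp add: e_def algebra_simps)
    then have "ennreal (?l + e \<xi>) = ennreal (wA / w * (?l + q \<xi>)) + ennreal (wC / w * ?l + mC / w)"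
      using wA wC mC w0 l0 q0[of \<xi>] by simp
    also have "\<dots> \<le> ennreal (wA / w * (?r + c * q \<xi>)) + (ennreal (wC / w * ?r + c * (mC / w)) + \<Psi> \<xi>)"
      by (rule add_mono[OF 2 1])
    also have "\<dots> = ennreal (wA / w * (?r + c * q \<xi>) + (wC / w * ?r + c * (mC / w))) + \<Psi> \<xi>"
    proof -
      have "0 \<le> ?r + c * q \<xi>" using c0 q0[of \<xi>] by (intro add_nonneg_nonneg[OF r0]) auto
      then have "0 \<le> wA / w * (?r + c * q \<xi>)" using wA w0 by (intro mult_nonneg_nonneg) auto
      moreover have "0 \<le> wC / w * ?r + c * (mC / w)"
        using wC mC w0 c0 by (intro add_nonneg_nonneg mult_nonneg_nonneg[OF _ r0]) auto
      ultimately show ?thesis by (simp only: ennreal_plus add.assoc)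
    qed
    also have "wA / w * (?r + c * q \<xi>) + (wC / w * ?r + c * (mC / w)) = ?r + c * e \<xi>"
      by (subst (3) split[of ?r]) (simp add: e_def algebra_simps)
    finally show ?thesis by simp
  qed
  have \<Psi>_eq: "ennreal (p \<xi>) * \<Psi> \<xi> = (\<integral>\<^sup>+\<xi>'\<in>-A. ennreal (p \<xi> * p \<xi>' / w * klf (q \<xi>) (q \<xi>')) \<partial>G)" for \<xi>
    unfolding \<Psi>_def Cint
  proof (subst nn_integral_cmult[symmetric], simp, intro nn_integral_cong)
    fix \<xi>'
    show "ennreal (p \<xi>) * (ennreal (p \<xi>' / w * klf (q \<xi>) (q \<xi>')) * indicator (space G - A) \<xi>')
      = ennreal (p \<xi> * p \<xi>' / w * klf (q \<xi>) (q \<xi>')) * indicator (space G - A) \<xi>'"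
      using ennreal_mult'[OF less_imp_le[OF p0], of \<xi> "p \<xi>' / w * klf (q \<xi>) (q \<xi>')"]
      by (simp add: mult.assoc)
  qed
  define X1 where "X1 = (\<integral>\<^sup>+\<xi>\<in>A. ennreal (p \<xi> * klf (q \<xi>) \<mu>) \<partial>G)"
  define X2 where "X2 = (\<integral>\<^sup>+\<xi>\<in>A. ennreal (p \<xi> * klf (q \<xi>) b) \<partial>G)"
  define Y where "Y = (\<integral>\<^sup>+\<xi>\<in>A. ennreal (p \<xi>) * \<Psi> \<xi> \<partial>G)"
  have eint: "(\<integral>\<^sup>+\<xi>\<in>A. ennreal (p \<xi>) * ennreal (z + y * e \<xi>) \<partial>G) = ennreal (z * wA + y * (wA * m / w))"
    if z: "0 \<le> z" and y: "0 \<le> y" for z y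
  proof -
    have "(\<integral>\<^sup>+\<xi>\<in>A. ennreal (p \<xi>) * ennreal (z + y * e \<xi>) \<partial>G)
      = (\<integral>\<^sup>+\<xi>. ennreal (z + y * (mC / w)) * (ennreal (p \<xi>) * indicator A \<xi>)
          + ennreal (y * (wA / w)) * (ennreal (p \<xi> * q \<xi>) * indicator A \<xi>) \<partial>G)"
    proof (intro nn_integral_cong)
      fix \<xi>
      have "p \<xi> * (z + y * e \<xi>) = (z + y * (mC / w)) * p \<xi> + y * (wA / w) * (p \<xi> * q \<xi>)"
        by (simp add: e_def algebra_simps)
      then have "ennreal (p \<xi> * (z + y * e \<xi>)) = ennreal ((z + y * (mC / w)) * p \<xi>) + ennreal (y * (wA / w) * (p \<xi> * q \<xi>))"
        using z y w0 mC wA p0[of \<xi>] q0[of \<xi>] by simp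
      then have "ennreal (p \<xi>) * ennreal (z + y * e \<xi>) = ennreal (z + y * (mC / w)) * ennreal (p \<xi>) + ennreal (y * (wA / w)) * ennreal (p \<xi> * q \<xi>)"
        using ennreal_mult'[OF less_imp_le[OF p0], of \<xi> "z + y * e \<xi>"]
          ennreal_mult''[OF less_imp_le[OF p0], of "z + y * (mC / w)" \<xi>]
          ennreal_mult''[OF less_imp_le[OF mult_pos_pos[OF p0 q0]], of "y * (wA / w)" \<xi> \<xi>] by (simp only:)
      then show "ennreal (p \<xi>) * ennreal (z + y * e \<xi>) * indicator A \<xi> =
          ennreal (z + y * (mC / w)) * (ennreal (p \<xi>) * indicator A \<xi>)
          + ennreal (y * (wA / w)) * (ennreal (p \<xi> * q \<xi>) * indicator A \<xi>)"
        by (simp add: indicator_def)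
    qed
    also have "\<dots> = ennreal (z + y * (mC / w)) * ennreal wA + ennreal (y * (wA / w)) * ennreal mA"
      by (subst nn_integral_add) (auto simp: nn_integral_cmult wA mA)
    also have "\<dots> = ennreal ((z + y * (mC / w)) * wA + y * (wA / w) * mA)"
    proof -
      have "0 \<le> (z + y * (mC / w)) * wA" "0 \<le> y * (wA / w) * mA"
        using z y w0 mC wA mA by (auto intro!: mult_nonneg_nonneg add_nonneg_nonneg)
      then show ?thesis
        using ennreal_mult''[of wA "z + y * (mC / w)"] ennreal_mult''[of mA "y * (wA / w)"] wA mA
        by (simp only: ennreal_plus less_imp_le)
    qed
    also have "(z + y * (mC / w)) * wA + y * (wA / w) * mA = z * wA + y * (wA * m / w)"
      by (simp add: m algebra_simps add_divide_distrib)
    finally show ?thesis .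
  qed
  have pk: "ennreal (p \<xi>) * ennreal (klf (q \<xi>) z) = ennreal (p \<xi> * klf (q \<xi>) z)" for \<xi> z
    by (simp add: ennreal_mult' p0 less_imp_le)
  have e0: "0 \<le> e \<xi>" for \<xi> using wA w0 mC q0[of \<xi>] by (auto simp: e_def less_imp_le)
  have "X1 + ennreal (b * wA + 1 * (wA * m / w))
      = (\<integral>\<^sup>+\<xi>\<in>A. ennreal (p \<xi>) * ennreal (klf (q \<xi>) \<mu> + b + e \<xi>) \<partial>G)"
  proof -
    have "(\<integral>\<^sup>+\<xi>\<in>A. ennreal (p \<xi>) * ennreal (klf (q \<xi>) \<mu> + b + e \<xi>) \<partial>G)
      = (\<integral>\<^sup>+\<xi>. ennreal (p \<xi> * klf (q \<xi>) \<mu>) * indicator A \<xi> + ennreal (p \<xi>) * ennreal (b + 1 * e \<xi>) * indicator A \<xi> \<partial>G)"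
      using klf_nonneg[OF less_imp_le[OF q0] \<mu>0] b0 e0
      by (intro nn_integral_cong) (simp add: pk[symmetric] add.assoc ring_distribs)
    also have "\<dots> = X1 + (\<integral>\<^sup>+\<xi>\<in>A. ennreal (p \<xi>) * ennreal (b + 1 * e \<xi>) \<partial>G)"
      unfolding X1_def e_def by (subst nn_integral_add) auto
    finally show ?thesis using b0 by (subst eint[symmetric]) auto
  qed
  also have "\<dots> \<le> (\<integral>\<^sup>+\<xi>\<in>A. ennreal (p \<xi>) * (ennreal (klf (q \<xi>) b + \<mu> + c * e \<xi>) + \<Psi> \<xi>) \<partial>G)"
    using key by (intro nn_integral_mono mult_mono) auto
  also have "\<dots> = (X2 + ennreal (\<mu> * wA + c * (wA * m / w))) + Y"
  proof -
    have "(\<integral>\<^sup>+\<xi>\<in>A. ennreal (p \<xi>) * (ennreal (klf (q \<xi>) b + \<mu> + c * e \<xi>) + \<Psi> \<xi>) \<partial>G)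
      = (\<integral>\<^sup>+\<xi>. (ennreal (p \<xi> * klf (q \<xi>) b) * indicator A \<xi> + ennreal (p \<xi>) * ennreal (\<mu> + c * e \<xi>) * indicator A \<xi>)
         + ennreal (p \<xi>) * \<Psi> \<xi> * indicator A \<xi> \<partial>G)"
      using klf_nonneg[OF less_imp_le[OF q0] b0] \<mu>0 c0 e0
      by (intro nn_integral_cong) (simp add: pk[symmetric] add.assoc ring_distribs)
    also have "\<dots> = (X2 + (\<integral>\<^sup>+\<xi>\<in>A. ennreal (p \<xi>) * ennreal (\<mu> + c * e \<xi>) \<partial>G)) + Y"
      unfolding X2_def Y_def e_def by (subst nn_integral_add, simp, simp, subst nn_integral_add) auto
    finally show ?thesis using \<mu>0 c0 by (subst eint[symmetric]) auto
  qed
  \<comment> \<open>Since \<open>c * m / w = b\<close>, the completing terms agree on both sides;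
    being finite, they cancel.\<close>
  also have "\<mu> * wA + c * (wA * m / w) = b * wA + 1 * (wA * m / w)"
    using w0 m0 by (simp add: c_def \<mu>_def)
  finally have "ennreal (b * wA + 1 * (wA * m / w)) + X1 \<le> ennreal (b * wA + 1 * (wA * m / w)) + (X2 + Y)"
    by (simp only: ac_simps)
  then have "X1 \<le> X2 + Y"
    using ennreal_add_left_cancel_le[of "ennreal (b * wA + 1 * (wA * m / w))" X1 "X2 + Y"] by auto
  then show ?thesis
    unfolding X1_def X2_def Y_def \<Psi>_eq \<mu>_def b_def .
qed

text \<open>\<open>w\<close> is the marginal density of the observation and \<open>m\<close> that of
  both observations jointly, so \<open>m x y / w x\<close> is the Bayes predictive density. Taking
  both real-valued builds finiteness into the model.\<close>

locale bayes_model =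
  G: prob_space G + P0: prob_space P0 + Q0: prob_space Q0
  for G :: "'p measure" and P0 :: "'x measure" and Q0 :: "'y measure" +
  fixes p :: "'p \<Rightarrow> 'x \<Rightarrow> real" and q :: "'p \<Rightarrow> 'y \<Rightarrow> real"
    and w :: "'x \<Rightarrow> real" and m :: "'x \<Rightarrow> 'y \<Rightarrow> real"
  assumes space_UNIV [simp]: "space G = UNIV" "space P0 = UNIV" "space Q0 = UNIV"
    and p_meas: "(\<lambda>(\<xi>, x). p \<xi> x) \<in> borel_measurable (G \<Otimes>\<^sub>M P0)"
    and q_meas: "(\<lambda>(\<xi>, y). q \<xi> y) \<in> borel_measurable (G \<Otimes>\<^sub>M Q0)"
    and w_meas [measurable]: "w \<in> borel_measurable P0"
    and m_meas: "(\<lambda>(x, y). m x y) \<in> borel_measurable (P0 \<Otimes>\<^sub>M Q0)"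
    and p_pos: "\<And>\<xi> x. 0 < p \<xi> x" and q_pos: "\<And>\<xi> y. 0 < q \<xi> y"
    and w_pos: "\<And>x. 0 < w x" and m_pos: "\<And>x y. 0 < m x y"
    and p_int: "\<And>\<xi>. (\<integral>\<^sup>+x. ennreal (p \<xi> x) \<partial>P0) = 1"
    and q_int: "\<And>\<xi>. (\<integral>\<^sup>+y. ennreal (q \<xi> y) \<partial>Q0) = 1"
    and w_eq: "\<And>x. (\<integral>\<^sup>+\<xi>. ennreal (p \<xi> x) \<partial>G) = ennreal (w x)"
    and m_eq: "\<And>x y. (\<integral>\<^sup>+\<xi>. ennreal (p \<xi> x * q \<xi> y) \<partial>G) = ennreal (m x y)"
begin

sublocale GP: pair_sigma_finite G P0 ..
sublocale GQ: pair_sigma_finite G Q0 ..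

abbreviation div_pair :: "'p \<Rightarrow> 'p \<Rightarrow> ennreal" where
  "div_pair \<xi> \<xi>' \<equiv> (\<integral>\<^sup>+y. ennreal (klf (q \<xi> y) (q \<xi>' y)) \<partial>Q0)"

abbreviation div_pred :: "'p \<Rightarrow> 'x \<Rightarrow> ennreal" where
  "div_pred \<xi> x \<equiv> (\<integral>\<^sup>+y. ennreal (klf (q \<xi> y) (m x y / w x)) \<partial>Q0)"

abbreviation coupling :: "'p set \<Rightarrow> 'x \<Rightarrow> ennreal" where
  "coupling A x \<equiv>
    (\<integral>\<^sup>+\<xi>\<in>A. (\<integral>\<^sup>+\<xi>'\<in>-A. ennreal (p \<xi> x * p \<xi>' x / w x) * div_pair \<xi> \<xi>' \<partial>G) \<partial>G)"

lemma pqm_meas [measurable (raw)]: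
  "f \<in> N \<rightarrow>\<^sub>M G \<Longrightarrow> g \<in> N \<rightarrow>\<^sub>M P0 \<Longrightarrow> (\<lambda>z. p (f z) (g z)) \<in> borel_measurable N"
  "f \<in> N \<rightarrow>\<^sub>M G \<Longrightarrow> h \<in> N \<rightarrow>\<^sub>M Q0 \<Longrightarrow> (\<lambda>z. q (f z) (h z)) \<in> borel_measurable N"
  "g \<in> N \<rightarrow>\<^sub>M P0 \<Longrightarrow> h \<in> N \<rightarrow>\<^sub>M Q0 \<Longrightarrow> (\<lambda>z. m (g z) (h z)) \<in> borel_measurable N"
  using measurable_compose[OF measurable_Pair p_meas, of f N g]
    measurable_compose[OF measurable_Pair q_meas, of f N h]
    measurable_compose[OF measurable_Pair m_meas, of g N h] by auto

context
  fixes A :: "'p set"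
  assumes A [measurable]: "A \<in> sets G" and A_pos: "emeasure G A \<noteq> 0"
begin

definition wA :: "'x \<Rightarrow> real" where "wA x = enn2real (\<integral>\<^sup>+\<xi>\<in>A. ennreal (p \<xi> x) \<partial>G)"
definition mA :: "'x \<Rightarrow> 'y \<Rightarrow> real" where "mA x y = enn2real (\<integral>\<^sup>+\<xi>\<in>A. ennreal (p \<xi> x * q \<xi> y) \<partial>G)"

lemma wA_meas [measurable]: "wA \<in> borel_measurable P0"
  unfolding wA_def by measurable

lemma mA_meas [measurable (raw)]:
  "g \<in> N \<rightarrow>\<^sub>M P0 \<Longrightarrow> h \<in> N \<rightarrow>\<^sub>M Q0 \<Longrightarrow> (\<lambda>z. mA (g z) (h z)) \<in> borel_measurable N"
proof -
  have "(\<lambda>(x, y). mA x y) \<in> borel_measurable (P0 \<Otimes>\<^sub>M Q0)"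
    unfolding mA_def by measurable
  then show "g \<in> N \<rightarrow>\<^sub>M P0 \<Longrightarrow> h \<in> N \<rightarrow>\<^sub>M Q0 \<Longrightarrow> (\<lambda>z. mA (g z) (h z)) \<in> borel_measurable N"
    using measurable_compose[OF measurable_Pair, of g N P0 h Q0] by auto
qed

text \<open>Positivity over \<open>A\<close> holds because \<open>A\<close> is not null; finiteness
  is inherited from the full integral. The complement may be null, hence the weaker claim
  there.\<close>

lemma set_integral_pos:
  assumes f[measurable]: "f \<in> borel_measurable G" and f0: "\<And>\<xi>. 0 < f \<xi>"
    and fin: "(\<integral>\<^sup>+\<xi>. ennreal (f \<xi>) \<partial>G) = ennreal c"
  shows "\<exists>z>0. (\<integral>\<^sup>+\<xi>\<in>A. ennreal (f \<xi>) \<partial>G) = ennreal z"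
    "\<exists>z\<ge>0. (\<integral>\<^sup>+\<xi>\<in>-A. ennreal (f \<xi>) \<partial>G) = ennreal z"
proof -
  have "(\<integral>\<^sup>+\<xi>\<in>A. ennreal (f \<xi>) \<partial>G) \<noteq> 0"
  proof
    assume "(\<integral>\<^sup>+\<xi>\<in>A. ennreal (f \<xi>) \<partial>G) = 0"
    then have "AE \<xi> in G. ennreal (f \<xi>) * indicator A \<xi> = 0"
      by (subst (asm) nn_integral_0_iff_AE) auto
    then have "AE \<xi> in G. \<xi> \<notin> A"
    proof eventually_elim
      case (elim \<xi>)
      then show ?case using f0[of \<xi>] by (auto simp: indicator_def split: if_splits)
    qed
    then have "emeasure G A = 0"
      by (subst (asm) AE_iff_measurable[where N = A]) auto
    then show False using A_pos by simp
  qed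
  moreover have "(\<integral>\<^sup>+\<xi>\<in>A. ennreal (f \<xi>) \<partial>G) \<le> ennreal c" for A
    unfolding fin[symmetric] by (intro nn_integral_mono) (auto simp: indicator_def)
  then have "(\<integral>\<^sup>+\<xi>\<in>A. ennreal (f \<xi>) \<partial>G) < top" for A
    by (rule order_le_less_trans) simp
  ultimately show "\<exists>z>0. (\<integral>\<^sup>+\<xi>\<in>A. ennreal (f \<xi>) \<partial>G) = ennreal z"
    "\<exists>z\<ge>0. (\<integral>\<^sup>+\<xi>\<in>-A. ennreal (f \<xi>) \<partial>G) = ennreal z"
    by (metis enn2real_positive_iff ennreal_enn2real zero_less_iff_neq_zero, metis ennreal_cases less_irrefl)
qed

lemma wA_eq: "(\<integral>\<^sup>+\<xi>\<in>A. ennreal (p \<xi> x) \<partial>G) = ennreal (wA x)" and wA_pos: "0 < wA x"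
  using set_integral_pos(1)[of "\<lambda>\<xi>. p \<xi> x", OF _ p_pos w_eq] by (auto simp: wA_def)

lemma mA_eq: "(\<integral>\<^sup>+\<xi>\<in>A. ennreal (p \<xi> x * q \<xi> y) \<partial>G) = ennreal (mA x y)" and mA_pos: "0 < mA x y"
  using set_integral_pos(1)[of "\<lambda>\<xi>. p \<xi> x * q \<xi> y", OF _ _ m_eq] p_pos q_pos by (auto simp: mA_def)

abbreviation b :: "'x \<Rightarrow> 'y \<Rightarrow> real" where "b x y \<equiv> mA x y / wA x"

lemma b_pos: "0 < b x y" using wA_pos mA_pos by simp

lemma b_int: "(\<integral>\<^sup>+y. ennreal (b x y) \<partial>Q0) = 1"
proof -
  have "(\<integral>\<^sup>+y. ennreal (mA x y) \<partial>Q0) = (\<integral>\<^sup>+y. (\<integral>\<^sup>+\<xi>\<in>A. ennreal (p \<xi> x * q \<xi> y) \<partial>G) \<partial>Q0)"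
    by (simp add: mA_eq)
  also have "\<dots> = (\<integral>\<^sup>+\<xi>. (\<integral>\<^sup>+y. ennreal (p \<xi> x * q \<xi> y) * indicator A \<xi> \<partial>Q0) \<partial>G)"
    by (rule GQ.Fubini') measurable
  also have "\<dots> = (\<integral>\<^sup>+\<xi>\<in>A. ennreal (p \<xi> x) \<partial>G)"
  proof (intro nn_integral_cong)
    fix \<xi>
    have "(\<integral>\<^sup>+y. ennreal (p \<xi> x * q \<xi> y) * indicator A \<xi> \<partial>Q0)
        = (\<integral>\<^sup>+y. (ennreal (p \<xi> x) * indicator A \<xi>) * ennreal (q \<xi> y) \<partial>Q0)"
      by (intro nn_integral_cong) (simp add: ennreal_mult' p_pos less_imp_le mult.commute mult.left_commute)
    also have "\<dots> = ennreal (p \<xi> x) * indicator A \<xi>"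
      by (subst nn_integral_cmult) (auto simp: q_int)
    finally show "(\<integral>\<^sup>+y. ennreal (p \<xi> x * q \<xi> y) * indicator A \<xi> \<partial>Q0) = ennreal (p \<xi> x) * indicator A \<xi>" .
  qed
  also have "\<dots> = ennreal (wA x)" by (rule wA_eq)
  finally have "(\<integral>\<^sup>+y. ennreal (mA x y) \<partial>Q0) = ennreal (wA x)" .
  then have "(\<integral>\<^sup>+y. ennreal (1 / wA x) * ennreal (mA x y) \<partial>Q0) = ennreal (1 / wA x) * ennreal (wA x)"
    by (subst nn_integral_cmult) auto
  then show ?thesis
    using wA_pos[of x] mA_pos[of x] by (simp add: ennreal_mult[symmetric] less_imp_le)
qed

lemma nn_integral_wA: "(\<integral>\<^sup>+x. ennreal (wA x) \<partial>P0) = emeasure G A"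
proof -
  have "(\<integral>\<^sup>+x. ennreal (wA x) \<partial>P0) = (\<integral>\<^sup>+x. (\<integral>\<^sup>+\<xi>\<in>A. ennreal (p \<xi> x) \<partial>G) \<partial>P0)"
    by (simp add: wA_eq)
  also have "\<dots> = (\<integral>\<^sup>+\<xi>. (\<integral>\<^sup>+x. ennreal (p \<xi> x) * indicator A \<xi> \<partial>P0) \<partial>G)"
    by (rule GP.Fubini') measurable
  also have "\<dots> = (\<integral>\<^sup>+\<xi>. indicator A \<xi> \<partial>G)"
    by (intro nn_integral_cong, subst nn_integral_multc) (auto simp: p_int)
  finally show ?thesis by simp
qed

text \<open>Bayes optimality of the conditioned predictive density \<open>b\<close>: on average over
  the conditioned prior no \<open>Qh\<close> does better. In the variational inequality with test
  density \<open>b\<close> the correction term averages to the mass of \<open>A\<close>, whatever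
  \<open>Qh\<close> is.\<close>

lemma bayes_conditional_le:
  assumes Qh: "Qh \<in> P0 \<rightarrow>\<^sub>M prob_algebra Q0"
    and R: "\<And>\<xi>. \<xi> \<in> A \<Longrightarrow>
      (\<integral>\<^sup>+x. kl_loss (density Q0 (\<lambda>y. ennreal (q \<xi> y))) (Qh x) \<partial>density P0 (\<lambda>x. ennreal (p \<xi> x))) \<le> R"
  shows "(\<integral>\<^sup>+\<xi>\<in>A. (\<integral>\<^sup>+x. ennreal (p \<xi> x) * (\<integral>\<^sup>+y. ennreal (klf (q \<xi> y) (b x y)) \<partial>Q0) \<partial>P0) \<partial>G)
    \<le> R * emeasure G A"
proof -
  define K where "K \<xi> x = (\<integral>\<^sup>+y. ennreal (klf (q \<xi> y) (b x y)) \<partial>Q0)" for \<xi> x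
  define I where "I \<xi> x = (\<integral>\<^sup>+y. ennreal (q \<xi> y / b x y) \<partial>Qh x)" for \<xi> x
  \<comment> \<open>A measurable minorant of the loss. It is set to 0 where the correction
    \<open>I\<close> is infinite, since the variational inequality says nothing there.\<close>
  define H where "H \<xi> x = (if I \<xi> x = top then 0 else K \<xi> x + 1 - I \<xi> x)" for \<xi> x
  have Qh_prob: "prob_space (Qh x)" and Qh_sets: "sets (Qh x) = sets Q0" for x
    using measurable_space[OF Qh, of x] by (auto simp: space_prob_algebra)
  have Qh_sub: "Qh \<in> P0 \<rightarrow>\<^sub>M subprob_algebra Q0" by (rule measurable_prob_algebraD[OF Qh])
  have "(\<lambda>z. \<integral>\<^sup>+y. ennreal (klf (q (fst z) y) (b (snd z) y)) \<partial>Q0) \<in> borel_measurable (G \<Otimes>\<^sub>M P0)"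
    by measurable
  then have K_meas: "(\<lambda>(\<xi>, x). K \<xi> x) \<in> borel_measurable (G \<Otimes>\<^sub>M P0)"
    by (simp add: K_def case_prod_beta')
  have "(\<lambda>z. \<integral>\<^sup>+y. ennreal (q (fst z) y / b (snd z) y) \<partial>Qh (snd z)) \<in> borel_measurable (G \<Otimes>\<^sub>M P0)"
    by (intro nn_integral_measurable_subprob_algebra2[where N = Q0] measurable_compose[OF measurable_snd Qh_sub]) measurable
  then have I_meas: "(\<lambda>(\<xi>, x). I \<xi> x) \<in> borel_measurable (G \<Otimes>\<^sub>M P0)"
    by (simp add: I_def case_prod_beta')
  note [measurable (raw)] = measurable_compose[OF measurable_Pair K_meas, simplified]
    measurable_compose[OF measurable_Pair I_meas, simplified]
  have H_meas: "(\<lambda>(\<xi>, x). H \<xi> x) \<in> borel_measurable (G \<Otimes>\<^sub>M P0)"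
    unfolding H_def by measurable
  note [measurable (raw)] = measurable_compose[OF measurable_Pair H_meas, simplified]
  have H_le: "H \<xi> x \<le> kl_loss (density Q0 (\<lambda>y. ennreal (q \<xi> y))) (Qh x)" for \<xi> x
  proof -
    have "K \<xi> x + 1 \<le> kl_loss (density Q0 (\<lambda>y. ennreal (q \<xi> y))) (Qh x) + I \<xi> x"
      unfolding K_def I_def
      by (intro kl_loss_variational Qh_prob Qh_sets q_pos b_pos q_int b_int) measurable
    then show ?thesis
      by (auto simp: H_def ennreal_minus_le_iff add.commute)
  qed
  have le_H: "K \<xi> x + 1 \<le> H \<xi> x + I \<xi> x" for \<xi> x
  proof (cases "I \<xi> x = top")
    case False
    then show ?thesis
    proof (cases "I \<xi> x \<le> K \<xi> x + 1")
      case True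
      then have "H \<xi> x + I \<xi> x = K \<xi> x + 1"
        using False unfolding H_def by (simp only: if_False diff_add_cancel_ennreal)
      then show ?thesis by simp
    next
      case 2: False
      then have "K \<xi> x + 1 \<le> I \<xi> x" by (simp only: not_le less_imp_le)
      then show ?thesis by (rule order_trans) simp
    qed
  qed (simp add: H_def)
  \<comment> \<open>Integrating over \<open>\<xi>\<close> first replaces \<open>p * q\<close> by
    \<open>mA\<close>, and \<open>mA / b = wA\<close> no longer depends on \<open>y\<close>; then
    \<open>Qh x\<close> enters only through its total mass 1.\<close>
  have swap: "(\<integral>\<^sup>+\<xi>\<in>A. (\<integral>\<^sup>+x. ennreal (p \<xi> x) * I \<xi> x \<partial>P0) \<partial>G) = emeasure G A"
  proof -
    have "(\<integral>\<^sup>+\<xi>\<in>A. (\<integral>\<^sup>+x. ennreal (p \<xi> x) * I \<xi> x \<partial>P0) \<partial>G)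
        = (\<integral>\<^sup>+\<xi>. (\<integral>\<^sup>+x. ennreal (p \<xi> x) * I \<xi> x * indicator A \<xi> \<partial>P0) \<partial>G)"
      by (intro nn_integral_cong nn_integral_multc[symmetric]) measurable
    also have "\<dots> = (\<integral>\<^sup>+x. (\<integral>\<^sup>+\<xi>. ennreal (p \<xi> x) * I \<xi> x * indicator A \<xi> \<partial>G) \<partial>P0)"
      by (rule GP.Fubini'[symmetric]) measurable
    also have "\<dots> = (\<integral>\<^sup>+x. ennreal (wA x) \<partial>P0)"
    proof (intro nn_integral_cong)
      fix x
      interpret Qx: prob_space "Qh x" by (rule Qh_prob)
      note [measurable_cong] = Qh_sets[of x]
      have "(\<integral>\<^sup>+\<xi>. ennreal (p \<xi> x) * I \<xi> x * indicator A \<xi> \<partial>G)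
        = (\<integral>\<^sup>+\<xi>. (\<integral>\<^sup>+y. ennreal (p \<xi> x * q \<xi> y) * indicator A \<xi> * ennreal (1 / b x y) \<partial>Qh x) \<partial>G)"
      proof (intro nn_integral_cong)
        fix \<xi>
        have "ennreal (p \<xi> x) * I \<xi> x * indicator A \<xi> = (\<integral>\<^sup>+y. (ennreal (p \<xi> x) * indicator A \<xi>) * ennreal (q \<xi> y / b x y) \<partial>Qh x)"
          unfolding I_def by (subst nn_integral_cmult) (auto simp: ac_simps)
        also have "\<dots> = (\<integral>\<^sup>+y. ennreal (p \<xi> x * q \<xi> y) * indicator A \<xi> * ennreal (1 / b x y) \<partial>Qh x)"
        proof (intro nn_integral_cong)
          fix y
          have "ennreal (p \<xi> x) * ennreal (q \<xi> y / b x y) = ennreal (p \<xi> x * (q \<xi> y / b x y))"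
            by (intro ennreal_mult'[symmetric] less_imp_le p_pos)
          also have "p \<xi> x * (q \<xi> y / b x y) = p \<xi> x * q \<xi> y * (1 / b x y)" by simp
          also have "ennreal \<dots> = ennreal (p \<xi> x * q \<xi> y) * ennreal (1 / b x y)"
            by (intro ennreal_mult' mult_nonneg_nonneg less_imp_le p_pos q_pos)
          finally show "ennreal (p \<xi> x) * indicator A \<xi> * ennreal (q \<xi> y / b x y)
              = ennreal (p \<xi> x * q \<xi> y) * indicator A \<xi> * ennreal (1 / b x y)"
            by (simp only: ac_simps)
        qed
        finally show "ennreal (p \<xi> x) * I \<xi> x * indicator A \<xi>
           = (\<integral>\<^sup>+y. ennreal (p \<xi> x * q \<xi> y) * indicator A \<xi> * ennreal (1 / b x y) \<partial>Qh x)" .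
      qed
      also have "\<dots> = (\<integral>\<^sup>+y. (\<integral>\<^sup>+\<xi>. ennreal (p \<xi> x * q \<xi> y) * indicator A \<xi> * ennreal (1 / b x y) \<partial>G) \<partial>Qh x)"
        by (intro pair_sigma_finite.Fubini') (auto intro!: pair_sigma_finite.intro G.sigma_finite_measure Qx.sigma_finite_measure)
      also have "\<dots> = (\<integral>\<^sup>+y. ennreal (wA x) \<partial>Qh x)"
      proof (intro nn_integral_cong)
        fix y
        have "(\<integral>\<^sup>+\<xi>. ennreal (p \<xi> x * q \<xi> y) * indicator A \<xi> * ennreal (1 / b x y) \<partial>G) = ennreal (mA x y) * ennreal (1 / b x y)"
          by (subst nn_integral_multc) (auto simp: mA_eq)
        also have "\<dots> = ennreal (wA x)"
          using mA_pos[of x y] wA_pos[of x] by (simp add: less_imp_le flip: ennreal_mult)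
        finally show "(\<integral>\<^sup>+\<xi>. ennreal (p \<xi> x * q \<xi> y) * indicator A \<xi> * ennreal (1 / b x y) \<partial>G) = ennreal (wA x)" .
      qed
      also have "\<dots> = ennreal (wA x)" using Qx.emeasure_space_1 by simp
      finally show "(\<integral>\<^sup>+\<xi>. ennreal (p \<xi> x) * I \<xi> x * indicator A \<xi> \<partial>G) = ennreal (wA x)" .
    qed
    finally show ?thesis by (simp add: nn_integral_wA)
  qed
  have "(\<integral>\<^sup>+\<xi>\<in>A. (\<integral>\<^sup>+x. ennreal (p \<xi> x) * H \<xi> x \<partial>P0) \<partial>G) \<le> (\<integral>\<^sup>+\<xi>. R * indicator A \<xi> \<partial>G)"
  proof (intro nn_integral_mono)
    fix \<xi>
    have "(\<integral>\<^sup>+x. ennreal (p \<xi> x) * H \<xi> x \<partial>P0) \<le> R" if "\<xi> \<in> A"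
    proof -
      have "(\<integral>\<^sup>+x. ennreal (p \<xi> x) * H \<xi> x \<partial>P0) = (\<integral>\<^sup>+x. H \<xi> x \<partial>density P0 (\<lambda>x. ennreal (p \<xi> x)))"
        by (subst nn_integral_density) auto
      also have "\<dots> \<le> (\<integral>\<^sup>+x. kl_loss (density Q0 (\<lambda>y. ennreal (q \<xi> y))) (Qh x) \<partial>density P0 (\<lambda>x. ennreal (p \<xi> x)))"
        by (intro nn_integral_mono H_le)
      also have "\<dots> \<le> R" by (rule R[OF that])
      finally show ?thesis .
    qed
    then show "(\<integral>\<^sup>+x. ennreal (p \<xi> x) * H \<xi> x \<partial>P0) * indicator A \<xi> \<le> R * indicator A \<xi>"
      by (auto simp: indicator_def)
  qed
  also have "\<dots> = R * emeasure G A" by (simp add: nn_integral_cmult)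
  finally have HR: "(\<integral>\<^sup>+\<xi>\<in>A. (\<integral>\<^sup>+x. ennreal (p \<xi> x) * H \<xi> x \<partial>P0) \<partial>G) \<le> R * emeasure G A" .
  have "(\<integral>\<^sup>+\<xi>\<in>A. (\<integral>\<^sup>+x. ennreal (p \<xi> x) * K \<xi> x \<partial>P0) \<partial>G) + emeasure G A
      = (\<integral>\<^sup>+\<xi>. (\<integral>\<^sup>+x. ennreal (p \<xi> x) * K \<xi> x \<partial>P0) * indicator A \<xi> + indicator A \<xi> \<partial>G)"
    by (subst nn_integral_add) auto
  also have "\<dots> = (\<integral>\<^sup>+\<xi>\<in>A. (\<integral>\<^sup>+x. ennreal (p \<xi> x) * (K \<xi> x + 1) \<partial>P0) \<partial>G)"
    by (intro nn_integral_cong) (simp add: ring_distribs nn_integral_add p_int)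
  also have "\<dots> \<le> (\<integral>\<^sup>+\<xi>\<in>A. (\<integral>\<^sup>+x. ennreal (p \<xi> x) * (H \<xi> x + I \<xi> x) \<partial>P0) \<partial>G)"
    by (intro nn_integral_mono mult_mono le_H) auto
  also have "\<dots> = (\<integral>\<^sup>+\<xi>\<in>A. (\<integral>\<^sup>+x. ennreal (p \<xi> x) * H \<xi> x \<partial>P0) \<partial>G) + emeasure G A"
    unfolding swap[symmetric]
    by (subst nn_integral_add[symmetric], simp, simp, intro nn_integral_cong)
       (simp add: ring_distribs nn_integral_add)
  also have "\<dots> \<le> R * emeasure G A + emeasure G A"
    by (rule add_right_mono[OF HR])
  finally have "emeasure G A + (\<integral>\<^sup>+\<xi>\<in>A. (\<integral>\<^sup>+x. ennreal (p \<xi> x) * K \<xi> x \<partial>P0) \<partial>G) \<le> emeasure G A + R * emeasure G A"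
    by (simp only: add.commute)
  then show ?thesis
    unfolding K_def using G.emeasure_finite[of A]
      ennreal_add_left_cancel_le[of "emeasure G A", unfolded infinity_ennreal_def] by blast
qed

end

text \<open>\<open>klf_conditioning\<close> is applied for each fixed pair of \<open>x\<close> and
  \<open>y\<close> and then integrated. Bayes optimality bounds the conditioned divergence; the
  coupling term stays abstract until the prior is Gaussian.\<close>

theorem bayes_lower_bound:
  assumes A [measurable]: "A \<in> sets G" and Qh: "Qh \<in> P0 \<rightarrow>\<^sub>M prob_algebra Q0"
    and R: "\<And>\<xi>. \<xi> \<in> A \<Longrightarrow>
      (\<integral>\<^sup>+x. kl_loss (density Q0 (\<lambda>y. ennreal (q \<xi> y))) (Qh x) \<partial>density P0 (\<lambda>x. ennreal (p \<xi> x))) \<le> R"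
  shows "(\<integral>\<^sup>+\<xi>\<in>A. (\<integral>\<^sup>+x. ennreal (p \<xi> x) * div_pred \<xi> x \<partial>P0) \<partial>G)
    \<le> R * emeasure G A + (\<integral>\<^sup>+x. coupling A x \<partial>P0)"
proof (cases "emeasure G A = 0")
  case True
  then have "AE \<xi> in G. \<xi> \<notin> A" by (intro AE_I[of _ _ A]) auto
  then have "(\<integral>\<^sup>+\<xi>\<in>A. (\<integral>\<^sup>+x. ennreal (p \<xi> x) * div_pred \<xi> x \<partial>P0) \<partial>G) = (\<integral>\<^sup>+\<xi>. 0 \<partial>G)"
    by (intro nn_integral_cong_AE) (auto elim!: eventually_mono simp: indicator_def)
  then show ?thesis by simp
next
  case False
  \<comment> \<open>Fubini brings the integral over \<open>\<xi>\<close> to the inside, where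
    \<open>klf_conditioning\<close> operates. It is used with \<open>g\<close> the predictive
    density of the full and of the conditioned prior.\<close>
  have to_xy: "(\<integral>\<^sup>+\<xi>\<in>A. (\<integral>\<^sup>+x. ennreal (p \<xi> x) * (\<integral>\<^sup>+y. ennreal (klf (q \<xi> y) (g x y)) \<partial>Q0) \<partial>P0) \<partial>G)
     = (\<integral>\<^sup>+x. (\<integral>\<^sup>+y. (\<integral>\<^sup>+\<xi>\<in>A. ennreal (p \<xi> x * klf (q \<xi> y) (g x y)) \<partial>G) \<partial>Q0) \<partial>P0)"
    if g: "(\<lambda>(x, y). g x y) \<in> borel_measurable (P0 \<Otimes>\<^sub>M Q0)" for g
  proof -
    note [measurable (raw)] = measurable_compose[OF measurable_Pair g, simplified]
    have "(\<integral>\<^sup>+\<xi>\<in>A. (\<integral>\<^sup>+x. ennreal (p \<xi> x) * (\<integral>\<^sup>+y. ennreal (klf (q \<xi> y) (g x y)) \<partial>Q0) \<partial>P0) \<partial>G)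
      = (\<integral>\<^sup>+\<xi>. (\<integral>\<^sup>+x. (\<integral>\<^sup>+y. ennreal (p \<xi> x * klf (q \<xi> y) (g x y)) * indicator A \<xi> \<partial>Q0) \<partial>P0) \<partial>G)"
      by (intro nn_integral_cong, subst nn_integral_multc[symmetric], simp, intro nn_integral_cong, subst nn_integral_multc, simp, subst nn_integral_cmult[symmetric])
         (auto simp: ennreal_mult' p_pos less_imp_le)
    also have "\<dots> = (\<integral>\<^sup>+x. (\<integral>\<^sup>+\<xi>. (\<integral>\<^sup>+y. ennreal (p \<xi> x * klf (q \<xi> y) (g x y)) * indicator A \<xi> \<partial>Q0) \<partial>G) \<partial>P0)"
      by (rule GP.Fubini'[symmetric]) measurable
    also have "\<dots> = (\<integral>\<^sup>+x. (\<integral>\<^sup>+y. (\<integral>\<^sup>+\<xi>. ennreal (p \<xi> x * klf (q \<xi> y) (g x y)) * indicator A \<xi> \<partial>G) \<partial>Q0) \<partial>P0)"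
      by (intro nn_integral_cong GQ.Fubini'[symmetric]) measurable
    finally show ?thesis .
  qed
  let ?X2 = "\<lambda>x y. \<integral>\<^sup>+\<xi>\<in>A. ennreal (p \<xi> x * klf (q \<xi> y) (mA A x y / wA A x)) \<partial>G"
  let ?E = "\<lambda>x y. \<integral>\<^sup>+\<xi>\<in>A. (\<integral>\<^sup>+\<xi>'\<in>-A. ennreal (p \<xi> x * p \<xi>' x / w x * klf (q \<xi> y) (q \<xi>' y)) \<partial>G) \<partial>G"
  have indC: "indicator (-A) = (indicator (space G - A) :: 'p \<Rightarrow> ennreal)"
    by (simp add: Compl_eq_Diff_UNIV)
  note [measurable (raw)] = mA_meas[OF A False] and [measurable] = wA_meas[OF A False]
  have fib: "(\<integral>\<^sup>+\<xi>\<in>A. ennreal (p \<xi> x * klf (q \<xi> y) (m x y / w x)) \<partial>G) \<le> ?X2 x y + ?E x y" for x y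
  proof -
    obtain wC where wC: "0 \<le> wC" "(\<integral>\<^sup>+\<xi>\<in>-A. ennreal (p \<xi> x) \<partial>G) = ennreal wC"
      using set_integral_pos(2)[OF A False _ p_pos w_eq, of x] by auto
    obtain mC where mC: "0 \<le> mC" "(\<integral>\<^sup>+\<xi>\<in>-A. ennreal (p \<xi> x * q \<xi> y) \<partial>G) = ennreal mC"
      using set_integral_pos(2)[OF A False _ _ m_eq, of x y] p_pos q_pos by auto
    have sum: "(\<integral>\<^sup>+\<xi>. f \<xi> \<partial>G) = (\<integral>\<^sup>+\<xi>\<in>A. f \<xi> \<partial>G) + (\<integral>\<^sup>+\<xi>\<in>-A. f \<xi> \<partial>G)" if "f \<in> borel_measurable G" for f
      unfolding indC using that by (subst nn_integral_add[symmetric]) (auto intro!: nn_integral_cong simp: indicator_def)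
    have w: "w x = wA A x + wC"
      using sum[of "\<lambda>\<xi>. ennreal (p \<xi> x)"] wC w_pos[of x] wA_pos[OF A False, of x]
      by (simp add: w_eq wA_eq[OF A False] flip: ennreal_plus)
    have m: "m x y = mA A x y + mC"
      using sum[of "\<lambda>\<xi>. ennreal (p \<xi> x * q \<xi> y)"] mC m_pos[of x y] mA_pos[OF A False, of x y]
      by (simp add: m_eq mA_eq[OF A False] flip: ennreal_plus)
    show ?thesis
      by (rule klf_conditioning[OF G.sigma_finite_measure A _ _ p_pos q_pos wA_eq[OF A False] wA_pos[OF A False] wC(2,1)
          mA_eq[OF A False] mA_pos[OF A False] mC(2,1) w m]) measurable
  qed
  have "(\<integral>\<^sup>+\<xi>\<in>A. (\<integral>\<^sup>+x. ennreal (p \<xi> x) * div_pred \<xi> x \<partial>P0) \<partial>G)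
      \<le> (\<integral>\<^sup>+x. (\<integral>\<^sup>+y. ?X2 x y + ?E x y \<partial>Q0) \<partial>P0)"
  proof -
    have "(\<integral>\<^sup>+\<xi>\<in>A. (\<integral>\<^sup>+x. ennreal (p \<xi> x) * div_pred \<xi> x \<partial>P0) \<partial>G)
      = (\<integral>\<^sup>+x. (\<integral>\<^sup>+y. (\<integral>\<^sup>+\<xi>\<in>A. ennreal (p \<xi> x * klf (q \<xi> y) (m x y / w x)) \<partial>G) \<partial>Q0) \<partial>P0)"
      by (rule to_xy) measurable
    also have "\<dots> \<le> (\<integral>\<^sup>+x. (\<integral>\<^sup>+y. ?X2 x y + ?E x y \<partial>Q0) \<partial>P0)"
      by (intro nn_integral_mono fib)
    finally show ?thesis .
  qed
  also have "\<dots> = (\<integral>\<^sup>+x. (\<integral>\<^sup>+y. ?X2 x y \<partial>Q0) \<partial>P0) + (\<integral>\<^sup>+x. (\<integral>\<^sup>+y. ?E x y \<partial>Q0) \<partial>P0)"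
    unfolding indC by (simp add: nn_integral_add)
  also have "(\<integral>\<^sup>+x. (\<integral>\<^sup>+y. ?X2 x y \<partial>Q0) \<partial>P0) \<le> R * emeasure G A"
  proof -
    have "(\<integral>\<^sup>+\<xi>\<in>A. (\<integral>\<^sup>+x. ennreal (p \<xi> x) * (\<integral>\<^sup>+y. ennreal (klf (q \<xi> y) (mA A x y / wA A x)) \<partial>Q0) \<partial>P0) \<partial>G)
      = (\<integral>\<^sup>+x. (\<integral>\<^sup>+y. ?X2 x y \<partial>Q0) \<partial>P0)"
      by (rule to_xy) measurable
    then show ?thesis using bayes_conditional_le[OF A False Qh R] by simp
  qed
  also have "(\<integral>\<^sup>+x. (\<integral>\<^sup>+y. ?E x y \<partial>Q0) \<partial>P0) = (\<integral>\<^sup>+x. coupling A x \<partial>P0)"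
  proof (intro nn_integral_cong)
    fix x
    have "(\<integral>\<^sup>+y. ?E x y \<partial>Q0) = (\<integral>\<^sup>+y. (\<integral>\<^sup>+\<xi>. (\<integral>\<^sup>+\<xi>'\<in>space G - A. ennreal (p \<xi> x * p \<xi>' x / w x * klf (q \<xi> y) (q \<xi>' y)) * indicator A \<xi> \<partial>G) \<partial>G) \<partial>Q0)"
      unfolding indC by (intro nn_integral_cong, subst nn_integral_multc[symmetric]) (auto intro!: nn_integral_cong simp: ac_simps)
    also have "\<dots> = (\<integral>\<^sup>+\<xi>. (\<integral>\<^sup>+y. (\<integral>\<^sup>+\<xi>'\<in>space G - A. ennreal (p \<xi> x * p \<xi>' x / w x * klf (q \<xi> y) (q \<xi>' y)) * indicator A \<xi> \<partial>G) \<partial>Q0) \<partial>G)"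
      by (rule GQ.Fubini') measurable
    also have "\<dots> = (\<integral>\<^sup>+\<xi>. (\<integral>\<^sup>+\<xi>'. (\<integral>\<^sup>+y. ennreal (p \<xi> x * p \<xi>' x / w x * klf (q \<xi> y) (q \<xi>' y)) * indicator A \<xi> * indicator (space G - A) \<xi>' \<partial>Q0) \<partial>G) \<partial>G)"
      by (intro nn_integral_cong GQ.Fubini') measurable
    also have "\<dots> = coupling A x"
      unfolding indC
    proof (intro nn_integral_cong, subst nn_integral_multc[symmetric], simp, intro nn_integral_cong)
      fix \<xi> \<xi>'
      have "0 \<le> p \<xi> x * p \<xi>' x / w x" using p_pos w_pos by (simp add: less_imp_le)
      then have "(\<integral>\<^sup>+y. ennreal (p \<xi> x * p \<xi>' x / w x * klf (q \<xi> y) (q \<xi>' y)) * indicator A \<xi> * indicator (space G - A) \<xi>' \<partial>Q0)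
        = (\<integral>\<^sup>+y. ennreal (p \<xi> x * p \<xi>' x / w x) * indicator A \<xi> * indicator (space G - A) \<xi>' * ennreal (klf (q \<xi> y) (q \<xi>' y)) \<partial>Q0)"
        by (intro nn_integral_cong, subst ennreal_mult') (auto simp only: ac_simps)
      also have "\<dots> = ennreal (p \<xi> x * p \<xi>' x / w x) * indicator A \<xi> * indicator (space G - A) \<xi>' * div_pair \<xi> \<xi>'"
        by (intro nn_integral_cmult) measurable
      finally show "(\<integral>\<^sup>+y. ennreal (p \<xi> x * p \<xi>' x / w x * klf (q \<xi> y) (q \<xi>' y)) * indicator A \<xi> * indicator (space G - A) \<xi>' \<partial>Q0)
        = ennreal (p \<xi> x * p \<xi>' x / w x) * div_pair \<xi> \<xi>' * indicator (space G - A) \<xi>' * indicator A \<xi>"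
        by (simp only: ac_simps)
    qed
    finally show "(\<integral>\<^sup>+y. ?E x y \<partial>Q0) = coupling A x" .
  qed
  finally show ?thesis by (simp add: add_right_mono)
qed

end

section \<open>Gaussian measures\<close>

lemma gauss_second_moment:
  assumes "0 < s"
  shows "integrable (gauss a s) (\<lambda>y. (y - b)\<^sup>2)" "(\<integral>y. (y - b)\<^sup>2 \<partial>gauss a s) = s\<^sup>2 + (a - b)\<^sup>2"
proof -
  have e: "(y - b)\<^sup>2 = (y - a) ^ 2 + (2 * (a - b)) * (y - a) ^ 1 + (a - b)\<^sup>2" for y
    by (simp add: power2_eq_square algebra_simps)
  have i: "integrable (gauss a s) (\<lambda>y. (y - a) ^ k)" for k
    using integrable_normal_moment[OF assms, of a k] by (subst integrable_density) auto
  have m1: "(\<integral>y. (y - a) ^ 1 \<partial>gauss a s) = 0"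
    using integral_normal_moment_odd[OF assms, of a 0] by (subst integral_density) auto
  have m2: "(\<integral>y. (y - a) ^ 2 \<partial>gauss a s) = s\<^sup>2"
    using integral_normal_moment_even[OF assms, of a 1] by (subst integral_density) (auto simp: fact_numeral)
  interpret prob_space "gauss a s" by (rule prob_space_gauss[OF assms])
  have i1: "integrable (gauss a s) (\<lambda>y. 2 * (a - b) * (y - a) ^ 1)" by (intro integrable_mult_right i)
  have i0: "integrable (gauss a s) (\<lambda>y. (a - b)\<^sup>2)" by simp
  show "integrable (gauss a s) (\<lambda>y. (y - b)\<^sup>2)"
    by (subst e) (intro Bochner_Integration.integrable_add i i1 i0)
  have "(\<integral>y. (y - b)\<^sup>2 \<partial>gauss a s) = (\<integral>y. (y - a) ^ 2 + (2 * (a - b)) * (y - a) ^ 1 \<partial>gauss a s) + (\<integral>y. (a - b)\<^sup>2 \<partial>gauss a s)"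
    by (subst e) (intro Bochner_Integration.integral_add Bochner_Integration.integrable_add i i1 i0)
  also have "(\<integral>y. (y - a) ^ 2 + (2 * (a - b)) * (y - a) ^ 1 \<partial>gauss a s)
      = (\<integral>y. (y - a) ^ 2 \<partial>gauss a s) + (\<integral>y. (2 * (a - b)) * (y - a) ^ 1 \<partial>gauss a s)"
    by (intro Bochner_Integration.integral_add i i1)
  also have "(\<integral>y. (2 * (a - b)) * (y - a) ^ 1 \<partial>gauss a s) = (2 * (a - b)) * (\<integral>y. (y - a) ^ 1 \<partial>gauss a s)"
    by (rule integral_mult_right_zero)
  finally show "(\<integral>y. (y - b)\<^sup>2 \<partial>gauss a s) = s\<^sup>2 + (a - b)\<^sup>2"
    unfolding m1 m2 using prob_space by simp
qed

lemma gauss_fourth_moment: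
  assumes "0 < s"
  shows "integrable (gauss a s) (\<lambda>y. (y - a) ^ 4)" "(\<integral>y. (y - a) ^ 4 \<partial>gauss a s) = 3 * s ^ 4"
proof -
  show "integrable (gauss a s) (\<lambda>y. (y - a) ^ 4)"
    using integrable_normal_moment[OF assms, of a 4] by (subst integrable_density) auto
  have "(\<integral>y. (y - a) ^ 4 \<partial>gauss a s) = fact 4 / ((2 / s\<^sup>2) ^ 2 * fact 2)"
    using integral_normal_moment_even[OF assms, of a 2] by (subst integral_density) auto
  also have "\<dots> = 3 * s ^ 4"
    using assms by (simp add: fact_numeral field_simps power2_eq_square eval_nat_numeral)
  finally show "(\<integral>y. (y - a) ^ 4 \<partial>gauss a s) = 3 * s ^ 4" .
qed

lemma nratio_eq:
  assumes "0 < s" "0 < s'"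
  shows "nratio a s b s' y = (s' / s) * exp ((y - b)\<^sup>2 / (2 * s'\<^sup>2) - (y - a)\<^sup>2 / (2 * s\<^sup>2))"
proof -
  have "exp ((y - b)\<^sup>2 / (2 * s'\<^sup>2) - (y - a)\<^sup>2 / (2 * s\<^sup>2))
      = exp (- (y - a)\<^sup>2 / (2 * s\<^sup>2)) / exp (- (y - b)\<^sup>2 / (2 * s'\<^sup>2))"
    by (simp add: exp_diff[symmetric])
  moreover have "sqrt (2 * pi * s'\<^sup>2) / sqrt (2 * pi * s\<^sup>2) = s' / s"
    using assms by (simp add: real_sqrt_mult)
  moreover have "nratio a s b s' y = (sqrt (2 * pi * s'\<^sup>2) / sqrt (2 * pi * s\<^sup>2))
      * (exp (- (y - a)\<^sup>2 / (2 * s\<^sup>2)) / exp (- (y - b)\<^sup>2 / (2 * s'\<^sup>2)))"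
    by (simp add: nratio_def normal_density_def)
  ultimately show ?thesis by (simp only:)
qed

lemma ln_nratio:
  assumes "0 < s" "0 < s'"
  shows "ln (nratio a s b s' y) = ln (s' / s) - (y - a)\<^sup>2 / (2 * s\<^sup>2) + (y - b)\<^sup>2 / (2 * s'\<^sup>2)"
  unfolding nratio_eq[OF assms] using assms by (subst ln_mult) auto

definition kl_gauss :: "real \<Rightarrow> real \<Rightarrow> real \<Rightarrow> real \<Rightarrow> real" where
  "kl_gauss a s b s' = ln (s' / s) - 1/2 + (s\<^sup>2 + (a - b)\<^sup>2) / (2 * s'\<^sup>2)"

lemma integral_ln_nratio:
  assumes "0 < s" "0 < s'"
  shows "integrable (gauss a s) (\<lambda>y. ln (nratio a s b s' y))"
    "(\<integral>y. ln (nratio a s b s' y) \<partial>gauss a s) = kl_gauss a s b s'"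
proof -
  interpret prob_space "gauss a s" by (rule prob_space_gauss[OF assms(1)])
  note i = gauss_second_moment[OF assms(1), of a]
  show "integrable (gauss a s) (\<lambda>y. ln (nratio a s b s' y))"
    unfolding ln_nratio[OF assms] using i by auto
  show "(\<integral>y. ln (nratio a s b s' y) \<partial>gauss a s) = kl_gauss a s b s'"
    unfolding ln_nratio[OF assms] using i assms prob_space by (simp add: kl_gauss_def)
qed

text \<open>Completing the square: the squared ratio times the reference density is a multiple of
  the normal density with mean \<open>2 * a - b\<close> and the same variance.\<close>

lemma nn_integral_nratio_sq:
  assumes "0 < s"
  shows "(\<integral>\<^sup>+y. ennreal ((nratio a s b s y)\<^sup>2) \<partial>gauss b s) = ennreal (exp ((a - b)\<^sup>2 / s\<^sup>2))"
proof -
  have eq: "normal_density b s y * (nratio a s b s y)\<^sup>2 = exp ((a - b)\<^sup>2 / s\<^sup>2) * normal_density (2 * a - b) s y" for y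
  proof -
    have "- (y - b)\<^sup>2 / (2 * s\<^sup>2) + 2 * ((y - b)\<^sup>2 / (2 * s\<^sup>2) - (y - a)\<^sup>2 / (2 * s\<^sup>2))
        = (a - b)\<^sup>2 / s\<^sup>2 + - (y - (2 * a - b))\<^sup>2 / (2 * s\<^sup>2)"
      using assms by (simp add: field_simps power2_eq_square)
    then have "exp (- (y - b)\<^sup>2 / (2 * s\<^sup>2)) * (exp ((y - b)\<^sup>2 / (2 * s\<^sup>2) - (y - a)\<^sup>2 / (2 * s\<^sup>2)))\<^sup>2
        = exp ((a - b)\<^sup>2 / s\<^sup>2) * exp (- (y - (2 * a - b))\<^sup>2 / (2 * s\<^sup>2))"
      by (simp only: exp_double[symmetric] exp_add[symmetric])
    then show ?thesis
      using assms by (simp add: nratio_eq normal_density_def)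
  qed
  have "(\<integral>\<^sup>+y. ennreal ((nratio a s b s y)\<^sup>2) \<partial>gauss b s)
    = (\<integral>\<^sup>+y. ennreal (exp ((a - b)\<^sup>2 / s\<^sup>2)) * ennreal (normal_density (2 * a - b) s y) \<partial>lborel)"
    by (subst nn_integral_density) (auto simp flip: ennreal_mult simp: eq)
  also have "\<dots> = ennreal (exp ((a - b)\<^sup>2 / s\<^sup>2)) * (\<integral>\<^sup>+y. ennreal (normal_density (2 * a - b) s y) \<partial>lborel)"
    by (intro nn_integral_cmult) auto
  also have "(\<integral>\<^sup>+y. ennreal (normal_density (2 * a - b) s y) \<partial>lborel) = 1"
    using assms by (simp add: nn_integral_eq_integral)
  finally show ?thesis by simp
qed

text \<open>Bayes' rule for one coordinate: prior times likelihood is marginal times posterior, by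
  completing the square. The factor \<open>\<sigma>\<close> permits a standardised prior even for
  coordinates of prior variance 0.\<close>

lemma normal_density_bayes:
  fixes \<sigma> a b e :: real
  assumes b: "0 < b" and e: "0 < e"
  shows "normal_density a b \<xi> * normal_density (\<sigma> * \<xi>) e x
    = normal_density (\<sigma> * a) (sqrt (\<sigma>\<^sup>2 * b\<^sup>2 + e\<^sup>2)) x
      * normal_density ((a * e\<^sup>2 + \<sigma> * b\<^sup>2 * x) / (\<sigma>\<^sup>2 * b\<^sup>2 + e\<^sup>2)) (b * e / sqrt (\<sigma>\<^sup>2 * b\<^sup>2 + e\<^sup>2)) \<xi>"
proof -
  define S where "S = \<sigma>\<^sup>2 * b\<^sup>2 + e\<^sup>2"
  have S: "0 < S" using e unfolding S_def by (intro add_nonneg_pos) auto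
  define r where "r = sqrt S"
  have r: "0 < r" "r\<^sup>2 = S" using S by (auto simp: r_def)
  have norm: "(sqrt (2 * pi * b\<^sup>2)) * (sqrt (2 * pi * e\<^sup>2)) = sqrt (2 * pi * r\<^sup>2) * sqrt (2 * pi * (b * e / r)\<^sup>2)"
    using b e r(1) by (simp add: real_sqrt_mult)
  have "(\<xi> - a)\<^sup>2 / (2 * b\<^sup>2) + (x - \<sigma> * \<xi>)\<^sup>2 / (2 * e\<^sup>2)
     = (x - \<sigma> * a)\<^sup>2 / (2 * S) + (\<xi> - (a * e\<^sup>2 + \<sigma> * b\<^sup>2 * x) / S)\<^sup>2 * S / (2 * (b\<^sup>2 * e\<^sup>2))"
  proof -
    have "(\<xi> - (a * e\<^sup>2 + \<sigma> * b\<^sup>2 * x) / S)\<^sup>2 * S = (\<xi> * S - (a * e\<^sup>2 + \<sigma> * b\<^sup>2 * x))\<^sup>2 / S"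
      using S by (simp add: field_simps power2_eq_square)
    moreover have "((\<xi> - a)\<^sup>2 * e\<^sup>2 + (x - \<sigma> * \<xi>)\<^sup>2 * b\<^sup>2) * S
        = (x - \<sigma> * a)\<^sup>2 * (b\<^sup>2 * e\<^sup>2) + (\<xi> * S - (a * e\<^sup>2 + \<sigma> * b\<^sup>2 * x))\<^sup>2"
      unfolding S_def by (simp add: power2_eq_square algebra_simps)
    then have "(\<xi> - a)\<^sup>2 * e\<^sup>2 + (x - \<sigma> * \<xi>)\<^sup>2 * b\<^sup>2
        = (x - \<sigma> * a)\<^sup>2 * (b\<^sup>2 * e\<^sup>2) / S + (\<xi> * S - (a * e\<^sup>2 + \<sigma> * b\<^sup>2 * x))\<^sup>2 / S"
      using S by (simp add: field_simps)
    moreover have "(\<xi> - a)\<^sup>2 / (2 * b\<^sup>2) + (x - \<sigma> * \<xi>)\<^sup>2 / (2 * e\<^sup>2)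
        = ((\<xi> - a)\<^sup>2 * e\<^sup>2 + (x - \<sigma> * \<xi>)\<^sup>2 * b\<^sup>2) / (2 * (b\<^sup>2 * e\<^sup>2))"
      using b e by (simp add: field_simps)
    ultimately show ?thesis
      using b e by (simp add: add_divide_distrib)
  qed
  moreover have "(\<xi> - (a * e\<^sup>2 + \<sigma> * b\<^sup>2 * x) / S)\<^sup>2 * S / (2 * (b\<^sup>2 * e\<^sup>2))
      = (\<xi> - (a * e\<^sup>2 + \<sigma> * b\<^sup>2 * x) / S)\<^sup>2 / (2 * (b * e / r)\<^sup>2)"
    using r by (simp add: power_divide power_mult_distrib)
  ultimately have ex: "exp (- (\<xi> - a)\<^sup>2 / (2 * b\<^sup>2)) * exp (- (x - \<sigma> * \<xi>)\<^sup>2 / (2 * e\<^sup>2))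
     = exp (- (x - \<sigma> * a)\<^sup>2 / (2 * r\<^sup>2)) * exp (- (\<xi> - (a * e\<^sup>2 + \<sigma> * b\<^sup>2 * x) / S)\<^sup>2 / (2 * (b * e / r)\<^sup>2))"
    by (simp add: exp_add[symmetric] r)
  have "normal_density a b \<xi> * normal_density (\<sigma> * \<xi>) e x
     = (exp (- (\<xi> - a)\<^sup>2 / (2 * b\<^sup>2)) * exp (- (x - \<sigma> * \<xi>)\<^sup>2 / (2 * e\<^sup>2))) / (sqrt (2 * pi * b\<^sup>2) * sqrt (2 * pi * e\<^sup>2))"
    by (simp add: normal_density_def)
  also have "\<dots> = normal_density (\<sigma> * a) r x * normal_density ((a * e\<^sup>2 + \<sigma> * b\<^sup>2 * x) / S) (b * e / r) \<xi>"
    unfolding ex norm by (simp add: normal_density_def)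
  finally show ?thesis unfolding r_def S_def .
qed

text \<open>From \<open>T\<close> on the factors differ only by a shift of the mean at common
  variance \<open>e^2\<close>, so Kakutani's condition becomes square summability of
  \<open>\<theta>\<close>.\<close>

lemma kl_loss_gauss_prod_le:
  assumes e: "0 < e" and s: "\<And>i. 0 < s i"
    and tail: "\<And>i. T \<le> i \<Longrightarrow> m i = 0" "\<And>i. T \<le> i \<Longrightarrow> s i = e"
    and \<theta>: "summable (\<lambda>i. (\<theta> i)\<^sup>2)"
    and C: "\<And>n. (\<Sum>i<n. kl_gauss (\<theta> i) e (m i) (s i)) \<le> C"
  shows "kl_loss (gauss_prod \<theta> (\<lambda>_. e)) (gauss_prod m s) \<le> ennreal C"
proof -
  define r where "r i = nratio (\<theta> i) e (m i) (s i)" for i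
  interpret product_ratio "\<lambda>i. gauss (m i) (s i)" r "\<lambda>i. (\<theta> i)\<^sup>2 / e\<^sup>2" T
  proof (rule product_ratio.intro)
    show "prob_space (gauss (m i) (s i))" for i by (rule prob_space_gauss[OF s])
    show "r i \<in> borel_measurable (gauss (m i) (s i))" for i unfolding r_def by measurable
    show "0 < r i y" for i y unfolding r_def by (rule nratio_pos[OF e s])
    show "(\<integral>\<^sup>+y. ennreal (r i y) \<partial>gauss (m i) (s i)) = 1" for i
      unfolding r_def by (rule nn_integral_nratio[OF e s])
    show "(\<integral>\<^sup>+y. ennreal ((r i y)\<^sup>2) \<partial>gauss (m i) (s i)) \<le> ennreal (exp ((\<theta> i)\<^sup>2 / e\<^sup>2))" if "T \<le> i" for i
      unfolding r_def tail[OF that] using nn_integral_nratio_sq[OF e, where a = "\<theta> i" and b = 0] by simp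
    show "summable (\<lambda>i. (\<theta> i)\<^sup>2 / e\<^sup>2)" using \<theta> by (rule summable_divide)
  qed
  have N: "density (gauss (m i) (s i)) (\<lambda>y. ennreal (r i y)) = gauss (\<theta> i) e" for i
    unfolding r_def by (rule gauss_eq_density[OF e s, symmetric])
  have "kl_loss (PiM UNIV (\<lambda>i. density (gauss (m i) (s i)) (\<lambda>y. ennreal (r i y)))) (PiM UNIV (\<lambda>i. gauss (m i) (s i))) \<le> ennreal C"
  proof (rule kl_loss_PiM_le)
    show "integrable (density (gauss (m i) (s i)) (\<lambda>y. ennreal (r i y))) (\<lambda>y. ln (r i y))" for i
      unfolding N unfolding r_def by (rule integral_ln_nratio(1)[OF e s])
    show "(\<Sum>i<n. \<integral>y. ln (r i y) \<partial>density (gauss (m i) (s i)) (\<lambda>y. ennreal (r i y))) \<le> C" for n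
      unfolding N unfolding r_def integral_ln_nratio(2)[OF e s] by (rule C)
  qed
  then show ?thesis unfolding N gauss_prod_def .
qed

section \<open>The optimal Gaussian prior\<close>

text \<open>For prior variance \<open>t\<close>, the mutual information of one coordinate and the
  future observation given the past one: the information in both observations minus that in the past
  one. It is also the Bayes risk of the coordinate.\<close>

definition gain :: "real \<Rightarrow> real \<Rightarrow> real \<Rightarrow> real" where
  "gain u v t = 1/2 * ln ((1 + t / v) / (1 + t / u))"

text \<open>The derivative of \<open>gain u v\<close> at \<open>t\<close>, half the difference of
  \<open>1 / (v + t)\<close> and \<open>1 / (u + t)\<close>.\<close>

definition gain' :: "real \<Rightarrow> real \<Rightarrow> real \<Rightarrow> real" where
  "gain' u v t = (u - v) / (2 * ((u + t) * (v + t)))"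

lemma v2_joint_eq:
  assumes "0 < e" "0 < s"
  shows "v2_joint e s = e\<^sup>2 * s\<^sup>2 / (e\<^sup>2 + s\<^sup>2)"
  using assms by (simp add: v2_joint_def field_simps)

lemma v2_facts:
  assumes "0 < e" "0 < s"
  shows "0 < v2_joint e s" "v2_joint e s < v2_obs e" "0 < v2_obs e"
    "v2_obs e - v2_joint e s = v2_obs e * v2_joint e s / s\<^sup>2"
proof -
  have p: "0 < e\<^sup>2 + s\<^sup>2" using assms by (intro add_pos_pos) auto
  then show "0 < v2_joint e s" using assms by (simp add: v2_joint_eq)
  show u: "0 < v2_obs e" using assms by (simp add: v2_obs_def)
  show eq: "v2_obs e - v2_joint e s = v2_obs e * v2_joint e s / s\<^sup>2"
  proof -
    have "e\<^sup>2 - e\<^sup>2 * s\<^sup>2 / (e\<^sup>2 + s\<^sup>2) = e\<^sup>2 * e\<^sup>2 / (e\<^sup>2 + s\<^sup>2)"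
    proof -
      have "e\<^sup>2 * e\<^sup>2 / (e\<^sup>2 + s\<^sup>2) + e\<^sup>2 * s\<^sup>2 / (e\<^sup>2 + s\<^sup>2) = e\<^sup>2 * (e\<^sup>2 + s\<^sup>2) / (e\<^sup>2 + s\<^sup>2)"
        by (simp only: add_divide_distrib distrib_left)
      also have "\<dots> = e\<^sup>2" using p by simp
      finally show ?thesis by simp
    qed
    then show ?thesis using assms by (simp add: v2_joint_eq v2_obs_def)
  qed
  have "0 < v2_obs e * v2_joint e s / s\<^sup>2" using u \<open>0 < v2_joint e s\<close> assms by simp
  then show "v2_joint e s < v2_obs e" using eq by simp
qed

section \<open>The information gain of one coordinate as a function of its prior variance\<close>

context
  fixes u v :: real
  assumes v: "0 < v" and vu: "v < u"
begin

lemma gain'_pos: "0 \<le> t \<Longrightarrow> 0 < gain' u v t"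
  using v vu by (simp add: gain'_def)

lemma gain'_antimono: "0 \<le> s \<Longrightarrow> s \<le> t \<Longrightarrow> gain' u v t \<le> gain' u v s"
  unfolding gain'_def using v vu by (intro divide_left_mono mult_left_mono mult_mono mult_pos_pos) auto

text \<open>In this form monotonicity and concavity of the gain are visible, as
  \<open>t / (u + t)\<close> has both properties.\<close>

lemma gain_ratio: "0 \<le> t \<Longrightarrow> (1 + t / v) / (1 + t / u) = 1 + (u - v) / v * (t / (u + t))"
proof -
  assume t: "0 \<le> t"
  then have "0 < u + t" "0 < 1 + t / u" using v vu by (auto intro!: add_pos_nonneg)
  then have "(1 + t / v) / (1 + t / u) = (u * (v + t)) / (v * (u + t))"
    using v vu by (simp add: field_simps)
  also have "\<dots> = (v * (u + t) + (u - v) * t) / (v * (u + t))"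
    by (simp add: algebra_simps)
  also have "\<dots> = 1 + (u - v) / v * (t / (u + t))"
    using v \<open>0 < u + t\<close> by (simp add: add_divide_distrib)
  finally show ?thesis .
qed

text \<open>Concavity together with \<open>gain u v 0 = 0\<close>, obtained directly from
  \<open>1 - 1 / z \<le> ln z\<close>.\<close>

lemma gain_ge: "0 \<le> t \<Longrightarrow> t * gain' u v t \<le> gain u v t"
proof -
  assume t: "0 \<le> t"
  define z where "z = (1 + t / v) / (1 + t / u)"
  have z: "0 < z" using t v vu by (auto simp: z_def intro!: divide_pos_pos add_pos_nonneg)
  have "ln (1 / z) \<le> 1 / z - 1" using z by (intro ln_le_minus_one) simp
  then have "1 - 1 / z \<le> ln z" using z by (simp add: ln_div)
  moreover have "1 - 1 / z = t * (u - v) / (u * (v + t))"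
  proof -
    have p: "0 < u * (v + t)" "0 < 1 + t / v" "0 < v + t" using t v vu by (auto intro!: add_pos_nonneg)
    have "1 / z = (v * (u + t)) / (u * (v + t))"
      using v vu p by (simp add: z_def field_simps)
    also have "1 - \<dots> = (u * (v + t) - v * (u + t)) / (u * (v + t))"
      by (metis diff_divide_distrib divide_self less_irrefl p(1))
    also have "u * (v + t) - v * (u + t) = t * (u - v)" by (simp add: algebra_simps)
    finally show ?thesis .
  qed
  moreover have "t * (u - v) / ((u + t) * (v + t)) \<le> t * (u - v) / (u * (v + t))"
    using t v vu by (intro divide_left_mono mult_right_mono) auto
  ultimately have "t * (u - v) / ((u + t) * (v + t)) \<le> ln z" by simp
  then show ?thesis by (simp add: gain_def gain'_def z_def)
qed

lemma gain_nonneg: "0 \<le> t \<Longrightarrow> 0 \<le> gain u v t"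
  using gain_ge[of t] mult_nonneg_nonneg[of t "gain' u v t"] gain'_pos[of t] by linarith

lemma gain_pos: "0 < t \<Longrightarrow> 0 < gain u v t"
  using gain_ge[of t] mult_pos_pos[of t "gain' u v t"] gain'_pos[of t] by linarith

lemma gain_mono: "0 \<le> s \<Longrightarrow> s \<le> t \<Longrightarrow> gain u v s \<le> gain u v t"
proof -
  assume st: "0 \<le> s" "s \<le> t"
  have "s / (u + s) \<le> t / (u + t)" using st v vu by (simp add: field_simps)
  then have "1 + (u - v) / v * (s / (u + s)) \<le> 1 + (u - v) / v * (t / (u + t))"
    using v vu by (intro add_left_mono mult_left_mono) auto
  moreover have "0 < 1 + (u - v) / v * (s / (u + s))"
    using st v vu by (intro add_pos_nonneg mult_nonneg_nonneg) auto
  ultimately show ?thesis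
    unfolding gain_def using st by (subst (1 2) gain_ratio) auto
qed

lemma ln_one_plus_scale_ge:
  fixes y :: real
  assumes "0 \<le> r" "r \<le> 1" "0 \<le> y"
  shows "r * ln (1 + y) \<le> ln (1 + r * y)"
proof -
  have "concave_on {0<..} (ln :: real \<Rightarrow> real)"
    using ln_concave by simp
  then have "(1 - r) * ln 1 + r * ln (1 + y) \<le> ln ((1 - r) *\<^sub>R 1 + r *\<^sub>R (1 + y))"
    using assms by (intro concave_onD) auto
  then show ?thesis by (simp add: algebra_simps)
qed

text \<open>Concavity with value 0 at 0. It bounds from below the Bayes risk of the prior whose
  variances are shrunk by the factor \<open>r\<close>.\<close>

lemma gain_scale:
  assumes r: "0 \<le> r" "r \<le> 1" and t: "0 \<le> t"
  shows "r * gain u v t \<le> gain u v (r * t)"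
proof -
  let ?c = "(u - v) / v"
  have c: "0 \<le> ?c" using v vu by simp
  have "r * (t / (u + t)) \<le> r * t / (u + r * t)"
    using assms v vu mult_left_le_one_le[of t r] by (auto intro!: divide_left_mono mult_pos_pos add_pos_nonneg)
  then have le: "1 + r * (?c * (t / (u + t))) \<le> 1 + ?c * (r * t / (u + r * t))"
  proof -
    assume "r * (t / (u + t)) \<le> r * t / (u + r * t)"
    then have "?c * (r * (t / (u + t))) \<le> ?c * (r * t / (u + r * t))" by (rule mult_left_mono[OF _ c])
    then show ?thesis by (simp only: mult.left_commute add_left_mono)
  qed
  have y0: "0 \<le> ?c * (t / (u + t))" using c t v vu by (intro mult_nonneg_nonneg) auto
  have "r * ln (1 + ?c * (t / (u + t))) \<le> ln (1 + r * (?c * (t / (u + t))))"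
    using r y0 by (intro ln_one_plus_scale_ge)
  also have "\<dots> \<le> ln (1 + ?c * (r * t / (u + r * t)))"
  proof -
    have "0 < 1 + r * (?c * (t / (u + t)))" by (intro add_pos_nonneg mult_nonneg_nonneg[OF r(1) y0]) simp
    then show ?thesis using le by simp
  qed
  finally have "1/2 * (r * ln (1 + ?c * (t / (u + t)))) \<le> 1/2 * ln (1 + ?c * (r * t / (u + r * t)))"
    by (rule mult_left_mono) simp
  moreover have "gain u v t = 1/2 * ln (1 + ?c * (t / (u + t)))"
    unfolding gain_def gain_ratio[OF t] ..
  moreover have "gain u v (r * t) = 1/2 * ln (1 + ?c * (r * t / (u + r * t)))"
    unfolding gain_def using gain_ratio[of "r * t"] r t by simp
  ultimately show ?thesis by (simp only: mult.left_commute)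
qed

text \<open>The left side will be the normalised posterior variance
  \<open>(\<sigma> i)^2 / s^2 * (\<beta> i)^2\<close>. For \<open>y\<close> at most \<open>C\<close>
  one has \<open>y \<le> (1 + C) * ln (1 + y)\<close>; the 2 undoes the factor 1/2 in
  \<open>gain\<close>.\<close>

lemma shrink_le_gain:
  assumes t: "0 \<le> t" and C: "(u - v) / v \<le> C"
  shows "(u - v) / v * (t / (u + t)) \<le> 2 * (1 + C) * gain u v t"
proof -
  define y where "y = (u - v) / v * (t / (u + t))"
  have y: "0 \<le> y" unfolding y_def using t v vu by (intro mult_nonneg_nonneg) auto
  have "t / (u + t) \<le> 1" using t v vu by simp
  then have "y \<le> (u - v) / v * 1" unfolding y_def using v vu by (intro mult_left_mono) auto
  then have yC: "y \<le> C" using C by simp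
  have "ln (1 / (1 + y)) \<le> 1 / (1 + y) - 1" using y by (intro ln_le_minus_one) simp
  then have "y / (1 + y) \<le> ln (1 + y)" using y by (simp add: ln_div field_simps)
  then have "y \<le> (1 + y) * ln (1 + y)" using y by (simp add: field_simps)
  also have "\<dots> \<le> (1 + C) * ln (1 + y)" using yC y by (intro mult_right_mono) auto
  also have "\<dots> = 2 * (1 + C) * gain u v t"
    unfolding gain_def y_def using t by (subst gain_ratio) auto
  finally show ?thesis by (simp add: y_def)
qed

text \<open>The larger root \<open>t\<close> of \<open>gain' u v t = x\<close>, a quadratic
  equation, cut off at 0: the water-filling solution at price \<open>x\<close>.\<close>

definition fill :: "real \<Rightarrow> real" where
  "fill x = max 0 ((u - v) * sqrt (1 + 4 / (2 * x * (u - v))) - (u + v)) / 2"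

lemma fill_nonneg: "0 \<le> fill x" by (simp add: fill_def)

text \<open>The Karush-Kuhn-Tucker conditions at price \<open>x\<close>. The root \<open>z\<close>
  before the cut satisfies \<open>gain' u v z = x\<close> whatever its sign.\<close>

lemma fill_cases:
  assumes x: "0 < x"
  shows "fill x > 0 \<Longrightarrow> gain' u v (fill x) = x" "fill x = 0 \<Longrightarrow> gain' u v 0 \<le> x" "gain' u v (fill x) \<le> x"
proof -
  define h where "h = sqrt (1 + 4 / (2 * x * (u - v)))"
  have pos: "0 < 4 / (2 * x * (u - v))" using x vu by simp
  have h: "1 < h" "h\<^sup>2 = 1 + 2 / (x * (u - v))"
  proof -
    show "1 < h" unfolding h_def using pos by simp
    have "h\<^sup>2 = 1 + 4 / (2 * x * (u - v))" unfolding h_def using pos by (intro real_sqrt_pow2) simp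
    then show "h\<^sup>2 = 1 + 2 / (x * (u - v))" by simp
  qed
  define z where "z = ((u - v) * h - (u + v)) / 2"
  have fz: "fill x = max 0 z" by (simp add: fill_def z_def h_def max_def)
  have "(u + z) * (v + z) = (u - v)\<^sup>2 * (h\<^sup>2 - 1) / 4"
    by (simp add: z_def field_simps power2_eq_square)
  also have "\<dots> = (u - v) / (2 * x)"
    unfolding h(2) using x vu by (simp add: field_simps power2_eq_square)
  finally have prod: "(u + z) * (v + z) = (u - v) / (2 * x)" .
  have *: "gain' u v z = x"
  proof -
    have "k / (2 * (k / (2 * x))) = x" if "k \<noteq> 0" for k using that x by simp
    from this[of "u - v"] show ?thesis unfolding gain'_def prod using vu by linarith
  qed
  show "fill x > 0 \<Longrightarrow> gain' u v (fill x) = x" using * fz by (auto simp: max_def split: if_splits)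
  show 0: "gain' u v 0 \<le> x" if "fill x = 0"
  proof -
    have z: "z \<le> 0" using that fz by (auto simp: max_def split: if_splits)
    \<comment> \<open>Although \<open>z\<close> is not positive here, both factors stay positive, so
      their product is at most \<open>u * v\<close>.\<close>
    have "u + z = (u - v) * (h + 1) / 2" "v + z = (u - v) * (h - 1) / 2"
      by (simp_all add: z_def field_simps)
    moreover have "0 < (u - v) * (h + 1)" "0 < (u - v) * (h - 1)" using vu h(1) by auto
    ultimately have "0 < u + z" "0 < v + z" by simp_all
    then have "(u + z) * (v + z) \<le> u * v" using z v vu by (intro mult_mono) auto
    then have "(u - v) / (2 * x) \<le> u * v" using prod by simp
    then show ?thesis using x v vu by (simp add: gain'_def field_simps)
  qed
  show "gain' u v (fill x) \<le> x"
    using 0 \<open>fill x > 0 \<Longrightarrow> gain' u v (fill x) = x\<close> fill_nonneg[of x] by (cases "fill x = 0") auto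
qed

lemma gain'_le_imp: "0 \<le> s \<Longrightarrow> 0 \<le> t \<Longrightarrow> gain' u v t \<le> gain' u v s \<Longrightarrow> s \<le> t"
  and gain'_less_imp: "0 \<le> s \<Longrightarrow> 0 \<le> t \<Longrightarrow> gain' u v t < gain' u v s \<Longrightarrow> s < t"
proof -
  have strict: "gain' u v t < gain' u v s" if "0 \<le> s" "s < t" for s t
    unfolding gain'_def using v vu that by (intro divide_strict_left_mono mult_strict_left_mono mult_strict_mono mult_pos_pos) auto
  show "0 \<le> s \<Longrightarrow> 0 \<le> t \<Longrightarrow> gain' u v t \<le> gain' u v s \<Longrightarrow> s \<le> t"
    using strict[of t s] by (meson not_le)
  show "0 \<le> s \<Longrightarrow> 0 \<le> t \<Longrightarrow> gain' u v t < gain' u v s \<Longrightarrow> s < t"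
    using gain'_antimono[of t s] by (meson not_le)
qed

lemma fill_antimono: assumes "0 < x" "x \<le> y" shows "fill y \<le> fill x"
proof (cases "fill y = 0")
  case False
  then have y: "0 < fill y" using fill_nonneg[of y] by simp
  have "gain' u v (fill x) \<le> gain' u v (fill y)"
    using fill_cases(1)[of y] fill_cases(3)[of x] y assms by simp
  then show ?thesis by (rule gain'_le_imp[OF fill_nonneg fill_nonneg])
qed (simp add: fill_nonneg)

lemma fill_strict: assumes "0 < x" "x < y" "0 < fill y" shows "fill y < fill x"
proof -
  have "gain' u v (fill x) < gain' u v (fill y)"
    using fill_cases(1)[of y] fill_cases(3)[of x] assms by simp
  then show ?thesis by (rule gain'_less_imp[OF fill_nonneg fill_nonneg])
qed

lemma fill_eq_0: assumes "gain' u v 0 \<le> x" shows "fill x = 0"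
proof (rule ccontr)
  assume "fill x \<noteq> 0"
  then have "0 < fill x" using fill_nonneg[of x] by simp
  moreover have "0 < x" using assms gain'_pos[of 0] by simp
  ultimately have "gain' u v 0 \<le> gain' u v (fill x)" using fill_cases(1)[of x] assms by simp
  then show False using gain'_le_imp[of "fill x" 0] \<open>0 < fill x\<close> by simp
qed

text \<open>Supplies the lower end of the bracket for the multiplier in
  \<open>ex_lam\<close>.\<close>

lemma fill_gain': assumes "0 \<le> t" shows "t \<le> fill (gain' u v t)"
  by (rule gain'_le_imp[OF assms fill_nonneg fill_cases(3)[OF gain'_pos[OF assms]]])

lemma continuous_on_fill: "continuous_on {0<..} fill"
  unfolding fill_def using vu by (auto intro!: continuous_intros)

end

section \<open>The Lagrange multiplier and the optimal variances at fixed noise levels\<close>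

locale ellipsoid =
  fixes a :: "nat \<Rightarrow> real" and B e s :: real
  assumes a0: "0 < a 0" and a_mono: "mono a" and a_inf: "filterlim a at_top sequentially"
    and B: "0 < B" and e: "0 < e" and s: "0 < s"
begin

abbreviation u :: real where "u \<equiv> v2_obs e"
abbreviation v :: real where "v \<equiv> v2_joint e s"
abbreviation fl :: "real \<Rightarrow> real" where "fl \<equiv> fill u v"

lemmas v_pos = v2_facts(1)[OF e s] and vu = v2_facts(2)[OF e s] and u_pos = v2_facts(3)[OF e s]
  and uv_diff = v2_facts(4)[OF e s]

lemma a_pos: "0 < a i" using monoD[OF a_mono, of 0 i] a0 by simp

lemma a_sq_mono: "i \<le> j \<Longrightarrow> (a i)\<^sup>2 \<le> (a j)\<^sup>2"
  using monoD[OF a_mono, of i j] a_pos[of i] by (intro power_mono) auto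

lemma a_sq_pos: "0 < (a i)\<^sup>2" using a_pos[of i] by simp

lemma a_sq_unbounded: "\<exists>N. \<forall>i\<ge>N. c \<le> (a i)\<^sup>2"
proof -
  have "eventually (\<lambda>i. max 1 c \<le> a i) sequentially"
    using a_inf unfolding filterlim_at_top by (rule spec)
  then obtain N where N: "\<And>i. N \<le> i \<Longrightarrow> max 1 c \<le> a i" by (auto simp: eventually_sequentially)
  have "c \<le> (a i)\<^sup>2" if "N \<le> i" for i
  proof -
    have "c \<le> a i * 1" using N[OF that] by simp
    also have "\<dots> \<le> a i * a i" using N[OF that] by (intro mult_left_mono) auto
    finally show ?thesis by (simp add: power2_eq_square)
  qed
  then show ?thesis by blast
qed

lemma tau_sq_eq: "tau_sq a e s lam i = fl (lam * (a i)\<^sup>2)"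
  unfolding fill_def[OF v_pos vu] tau_sq_def by (simp add: mult.assoc)

lemma fl_eventually_0:
  assumes "0 < lam"
  shows "\<exists>N. \<forall>i\<ge>N. \<forall>l\<ge>lam. fl (l * (a i)\<^sup>2) = 0"
proof -
  obtain N where N: "\<forall>i\<ge>N. gain' u v 0 / lam \<le> (a i)\<^sup>2" using a_sq_unbounded by blast
  have "fl (l * (a i)\<^sup>2) = 0" if "N \<le> i" "lam \<le> l" for i l
  proof (rule fill_eq_0[OF v_pos vu])
    have "gain' u v 0 \<le> lam * (a i)\<^sup>2" using N that assms by (simp add: pos_divide_le_eq mult.commute)
    also have "\<dots> \<le> l * (a i)\<^sup>2" using that by (intro mult_right_mono) auto
    finally show "gain' u v 0 \<le> l * (a i)\<^sup>2" .
  qed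
  then show ?thesis by blast
qed

text \<open>Intermediate value theorem. At \<open>l1\<close> every variance vanishes; at
  \<open>l0\<close> the first coordinate alone uses up \<open>B\<close>. Above \<open>l0\<close> the
  active coordinates lie below a common \<open>N\<close>, because \<open>a\<close> tends to
  infinity, so the total is a finite sum of continuous functions.\<close>

lemma ex_lam: "\<exists>lam>0. (\<lambda>i. (a i)\<^sup>2 * fl (lam * (a i)\<^sup>2)) sums B"
proof -
  define l0 where "l0 = gain' u v (B / (a 0)\<^sup>2) / (a 0)\<^sup>2"
  define l1 where "l1 = gain' u v 0 / (a 0)\<^sup>2"
  have Bq: "0 < B / (a 0)\<^sup>2" using B a0 by simp
  have l0: "0 < l0" unfolding l0_def using gain'_pos[OF v_pos vu, of "B / (a 0)\<^sup>2"] Bq a_sq_pos[of 0] by simp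
  have l01: "l0 \<le> l1" unfolding l0_def l1_def using gain'_antimono[OF v_pos vu, of 0 "B / (a 0)\<^sup>2"] Bq a_sq_pos[of 0]
    by (intro divide_right_mono) auto
  obtain N where N: "\<And>i l. N \<le> i \<Longrightarrow> l0 \<le> l \<Longrightarrow> fl (l * (a i)\<^sup>2) = 0"
    using fl_eventually_0[OF l0] by blast
  define S where "S l = (\<Sum>i<N. (a i)\<^sup>2 * fl (l * (a i)\<^sup>2))" for l
  have S1: "S l1 = 0"
  proof -
    have "fl (l1 * (a i)\<^sup>2) = 0" for i
    proof (rule fill_eq_0[OF v_pos vu])
      have "0 \<le> l1" using l0 l01 by simp
      then have "l1 * (a 0)\<^sup>2 \<le> l1 * (a i)\<^sup>2" using a_sq_mono[of 0 i] by (intro mult_left_mono) auto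
      then show "gain' u v 0 \<le> l1 * (a i)\<^sup>2" using a_sq_pos[of 0] by (simp add: l1_def)
    qed
    then show ?thesis by (simp add: S_def)
  qed
  have S0: "B \<le> S l0"
  proof -
    have *: "B / (a 0)\<^sup>2 \<le> fl (l0 * (a 0)\<^sup>2)"
      using fill_gain'[OF v_pos vu, of "B / (a 0)\<^sup>2"] Bq a_sq_pos[of 0] by (simp add: l0_def)
    have "0 < N" using N[of 0 l0] * Bq by (cases "N = 0") auto
    have "B \<le> (a 0)\<^sup>2 * fl (l0 * (a 0)\<^sup>2)" using * a_sq_pos[of 0] by (simp add: pos_divide_le_eq mult.commute)
    also have "\<dots> \<le> S l0"
      unfolding S_def using \<open>0 < N\<close> fill_nonneg[OF v_pos vu] by (intro member_le_sum) auto
    finally show ?thesis .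
  qed
  have cont: "continuous_on {l0..l1} S"
    unfolding S_def
  proof (intro continuous_intros)
    fix i assume "i \<in> {..<N}"
    show "continuous_on {l0..l1} (\<lambda>l. fl (l * (a i)\<^sup>2))"
      using l0 a_sq_pos[of i]
      by (intro continuous_on_compose2[OF continuous_on_fill[OF v_pos vu]] continuous_intros) auto
  qed
  obtain l where l: "l0 \<le> l" "l \<le> l1" "S l = B"
    using IVT2'[OF _ S0 l01 cont] S1 B by auto
  have "(\<lambda>i. (a i)\<^sup>2 * fl (l * (a i)\<^sup>2)) sums S l"
    unfolding S_def using N l by (intro sums_finite) auto
  then have "(\<lambda>i. (a i)\<^sup>2 * fl (l * (a i)\<^sup>2)) sums B" unfolding l(3) .
  moreover have "0 < l" using l(1) l0 by simp
  ultimately show ?thesis by blast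
qed

text \<open>Lowering the multiplier lowers no variance, so equal totals force equal variances.
  Positive variances would change strictly, hence all of them vanish, contrary to
  \<open>B > 0\<close>. Exchanging the roles gives uniqueness.\<close>

lemma lam_unique:
  assumes "0 < l" "0 < l'" and S: "(\<lambda>i. (a i)\<^sup>2 * fl (l * (a i)\<^sup>2)) sums B"
    and S': "(\<lambda>i. (a i)\<^sup>2 * fl (l' * (a i)\<^sup>2)) sums B"
  shows "l' \<le> l"
proof (rule ccontr)
  assume "\<not> l' \<le> l"
  then have ll: "l < l'" by simp
  have le: "fl (l' * (a i)\<^sup>2) \<le> fl (l * (a i)\<^sup>2)" for i
    using ll assms(1) a_sq_pos[of i] by (intro fill_antimono[OF v_pos vu]) auto
  have "(\<lambda>i. (a i)\<^sup>2 * fl (l * (a i)\<^sup>2) - (a i)\<^sup>2 * fl (l' * (a i)\<^sup>2)) sums (B - B)"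
    by (intro sums_diff S S')
  then have "(\<lambda>i. (a i)\<^sup>2 * (fl (l * (a i)\<^sup>2) - fl (l' * (a i)\<^sup>2))) sums 0"
    by (simp add: algebra_simps)
  then have "\<forall>i. (a i)\<^sup>2 * (fl (l * (a i)\<^sup>2) - fl (l' * (a i)\<^sup>2)) = 0"
    using le by (subst suminf_eq_zero_iff[symmetric]) (auto dest: sums_summable sums_unique)
  then have "(a i)\<^sup>2 * (fl (l * (a i)\<^sup>2) - fl (l' * (a i)\<^sup>2)) = 0" for i
    by blast
  then have eq: "fl (l' * (a i)\<^sup>2) = fl (l * (a i)\<^sup>2)" for i
    using a_sq_pos[of i] by (metis diff_eq_eq add_0 mult_eq_0_iff less_irrefl)
  have "fl (l' * (a i)\<^sup>2) = 0" for i
  proof (rule ccontr)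
    assume "fl (l' * (a i)\<^sup>2) \<noteq> 0"
    then have "0 < fl (l' * (a i)\<^sup>2)" using fill_nonneg[OF v_pos vu, of "l' * (a i)\<^sup>2"] by simp
    then have "fl (l' * (a i)\<^sup>2) < fl (l * (a i)\<^sup>2)"
      using ll assms(1) a_sq_pos[of i] by (intro fill_strict[OF v_pos vu]) auto
    then show False using eq[of i] by simp
  qed
  then have "(\<lambda>i::nat. 0) sums B" using S' by simp
  then show False using B sums_unique2[OF _ sums_zero] by auto
qed

definition lam :: real where "lam = lam_star a B e s"
definition t :: "nat \<Rightarrow> real" where "t i = fl (lam * (a i)\<^sup>2)"
definition T :: nat where "T = T_star a B e s"

lemma lam: "0 < lam" "(\<lambda>i. (a i)\<^sup>2 * t i) sums B"
proof -
  have "\<exists>!l. 0 < l \<and> (\<lambda>i. (a i)\<^sup>2 * fl (l * (a i)\<^sup>2)) sums B"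
    using ex_lam lam_unique by (meson antisym)
  then have "0 < lam \<and> (\<lambda>i. (a i)\<^sup>2 * fl (lam * (a i)\<^sup>2)) sums B"
    unfolding lam_def lam_star_def tau_sq_eq by (rule theI')
  then show "0 < lam" "(\<lambda>i. (a i)\<^sup>2 * t i) sums B" by (auto simp: t_def)
qed

lemma t_nonneg: "0 \<le> t i"
  unfolding t_def by (rule fill_nonneg[OF v_pos vu])

lemma tau_star_eq: "tau_star a B e s i = sqrt (t i)"
  by (simp add: tau_star_def tau_sq_eq t_def lam_def)

lemma tau_star_sq: "(tau_star a B e s i)\<^sup>2 = t i"
  by (simp add: tau_star_eq t_nonneg)

lemma gain'_t_le: "gain' u v (t i) \<le> lam * (a i)\<^sup>2"
  and gain'_t_eq: "0 < t i \<Longrightarrow> gain' u v (t i) = lam * (a i)\<^sup>2"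
  using fill_cases[OF v_pos vu, of "lam * (a i)\<^sup>2"] lam(1) a_sq_pos[of i] by (auto simp: t_def)

lemma t_antimono: "i \<le> j \<Longrightarrow> t j \<le> t i"
  unfolding t_def using lam(1) a_sq_pos[of i] a_sq_mono[of i j]
  by (intro fill_antimono[OF v_pos vu]) auto

text \<open>The supremum defining \<open>T\<close> is over a finite set, because \<open>a\<close>
  tends to infinity; only then does it bound its elements. The shift by \<open>Suc\<close> makes
  \<open>i < T\<close> the range up to the last active coordinate.\<close>

lemma t_zero: "T \<le> i \<Longrightarrow> t i = 0"
proof (rule ccontr)
  assume i: "T \<le> i" "t i \<noteq> 0"
  obtain N where N: "\<And>j. N \<le> j \<Longrightarrow> t j = 0"
    using fl_eventually_0[OF lam(1)] unfolding t_def by blast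
  have "{Suc j | j. tau_star a B e s j \<noteq> 0} \<subseteq> {..N}"
    using N by (auto simp: tau_star_eq) (metis not_less_eq_eq)
  then have "finite {Suc j | j. tau_star a B e s j \<noteq> 0}" by (rule finite_subset) simp
  then have "Suc i \<le> T"
    unfolding T_def T_star_def using i by (intro cSup_upper bdd_above_finite) (auto simp: tau_star_eq)
  then show False using i by simp
qed

lemma sum_t: "(\<Sum>i<T. (a i)\<^sup>2 * t i) = B"
proof -
  have "(\<lambda>i. (a i)\<^sup>2 * t i) sums (\<Sum>i<T. (a i)\<^sup>2 * t i)"
    using t_zero by (intro sums_finite) auto
  then show ?thesis using lam(2) by (rule sums_unique2)
qed

definition D :: real where "D = (\<Sum>i<T. gain u v (t i))"

lemma D_pos: "0 < D"
proof -
  have "\<exists>i\<in>{..<T}. t i \<noteq> 0"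
  proof (rule ccontr)
    assume "\<not> ?thesis"
    then have "(\<Sum>i<T. (a i)\<^sup>2 * t i) = 0" by simp
    then show False using sum_t B by simp
  qed
  then obtain i where i: "i < T" "0 < t i" using t_nonneg by (force simp: less_le)
  then have "0 < gain u v (t i)" using gain_pos[OF v_pos vu] by simp
  also have "\<dots> \<le> D"
    unfolding D_def using i gain_nonneg[OF v_pos vu] t_nonneg by (intro member_le_sum) auto
  finally show ?thesis .
qed

lemma D_eq: "D = (\<Sum>i<T_star a B e s. 1/2 * ln ((1 + (tau_star a B e s i)\<^sup>2 / v2_joint e s)
     / (1 + (tau_star a B e s i)\<^sup>2 / v2_obs e)))"
  unfolding D_def tau_star_sq by (simp add: gain_def T_def)

end

section \<open>The Bayes predictive distribution\<close>

lemma kl_gauss_nonneg: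
  assumes "0 < s" "0 < s'"
  shows "0 \<le> kl_gauss a s b s'"
proof -
  have "ln ((s / s')\<^sup>2) \<le> (s / s')\<^sup>2 - 1" using assms by (intro ln_le_minus_one) auto
  moreover have "ln ((s / s')\<^sup>2) = 2 * ln (s / s')" using assms by (subst ln_realpow) auto
  ultimately have "2 * ln (s / s') \<le> s\<^sup>2 / s'\<^sup>2 - 1" by (simp add: power_divide)
  then have "0 \<le> ln (s' / s) - 1/2 + s\<^sup>2 / (2 * s'\<^sup>2)"
    using assms by (simp add: ln_div)
  also have "\<dots> \<le> kl_gauss a s b s'"
    unfolding kl_gauss_def by (intro add_left_mono divide_right_mono) auto
  finally show ?thesis .
qed

text \<open>Risk of one coordinate at the true value \<open>\<theta>\<close> under prior variance
  \<open>t\<close>. The slope in \<open>\<theta>^2\<close> is the derivative of \<open>gain\<close>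
  in \<open>t\<close>; therefore the stationarity conditions for the least favourable variances also
  control the risk over the ellipsoid.\<close>

definition coord_risk :: "real \<Rightarrow> real \<Rightarrow> real \<Rightarrow> real \<Rightarrow> real" where
  "coord_risk u v t \<theta> = gain u v t + gain' u v t * (\<theta>\<^sup>2 - t)"

abbreviation pred_mean :: "real \<Rightarrow> real \<Rightarrow> real" where
  "pred_mean e t \<equiv> t / (t + e\<^sup>2)"

abbreviation pred_sd :: "real \<Rightarrow> real \<Rightarrow> real \<Rightarrow> real" where
  "pred_sd e s t \<equiv> sqrt (t * e\<^sup>2 / (t + e\<^sup>2) + s\<^sup>2)"

lemma pred_sd_pos: "0 < s \<Longrightarrow> 0 \<le> t \<Longrightarrow> 0 < pred_sd e s t"
  by (intro real_sqrt_gt_zero add_nonneg_pos) auto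

text \<open>Bias-variance decomposition of the shrinkage estimate \<open>c * x\<close>, divided by
  twice the predictive variance \<open>S^2 = c * u + s^2\<close>.\<close>

lemma integral_kl_gauss:
  assumes e: "0 < e" and s: "0 < s" and t: "0 \<le> t"
  shows "integrable (gauss \<theta> e) (\<lambda>x. kl_gauss \<theta> s (pred_mean e t * x) (pred_sd e s t))"
    "(\<integral>x. kl_gauss \<theta> s (pred_mean e t * x) (pred_sd e s t) \<partial>gauss \<theta> e) = coord_risk (v2_obs e) (v2_joint e s) t \<theta>"
proof -
  define u where "u = v2_obs e"
  define v where "v = v2_joint e s"
  define c where "c = pred_mean e t"
  define S where "S = pred_sd e s t"
  have u: "u = e\<^sup>2" by (simp add: u_def v2_obs_def)
  note uv = v2_facts[OF e s, folded u_def v_def]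
  have te: "0 < t + e\<^sup>2" using t e by (intro add_nonneg_pos) auto
  have S0: "0 < S" unfolding S_def by (rule pred_sd_pos[OF s t])
  have S2: "S\<^sup>2 = c * u + s\<^sup>2"
    unfolding S_def c_def u using t te by (subst real_sqrt_pow2) auto
  have c1: "1 - c = u / (u + t)" using te by (simp add: c_def u field_simps)
  interpret prob_space "gauss \<theta> e" by (rule prob_space_gauss[OF e])
  have [simp]: "prob UNIV = 1" using prob_space by simp
  note mom = gauss_second_moment[OF e]
  have kl: "kl_gauss \<theta> s (c * x) S = (ln (S / s) - 1/2 + s\<^sup>2 / (2 * S\<^sup>2)) + (\<theta> - c * x)\<^sup>2 / (2 * S\<^sup>2)" for x
    by (simp add: kl_gauss_def add_divide_distrib)
  have sq: "(\<theta> - c * x)\<^sup>2 = c\<^sup>2 * (x - \<theta>)\<^sup>2 - (2 * c * (1 - c) * \<theta>) * (x - \<theta>) + (1 - c)\<^sup>2 * \<theta>\<^sup>2" for x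
    by (simp add: power2_eq_square algebra_simps)
  \<comment> \<open>The first moment is read off from two second moments about different
    centres.\<close>
  have lin: "(x - \<theta>) = ((x - (\<theta> - 1))\<^sup>2 - (x - \<theta>)\<^sup>2 - 1) / 2" for x
    by (simp add: power2_eq_square algebra_simps)
  have i1: "integrable (gauss \<theta> e) (\<lambda>x. x - \<theta>)"
    by (subst lin) (intro integrable_divide Bochner_Integration.integrable_diff mom, simp)
  have m1: "(\<integral>x. x - \<theta> \<partial>gauss \<theta> e) = 0"
    by (subst lin) (simp add: mom prob_space)
  have i: "integrable (gauss \<theta> e) (\<lambda>x. (\<theta> - c * x)\<^sup>2)"
    unfolding sq by (intro Bochner_Integration.integrable_add Bochner_Integration.integrable_diff integrable_mult_right mom i1) simp
  have m: "(\<integral>x. (\<theta> - c * x)\<^sup>2 \<partial>gauss \<theta> e) = c\<^sup>2 * u + (1 - c)\<^sup>2 * \<theta>\<^sup>2"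
    unfolding sq using mom(1)[of \<theta> \<theta>] mom(2)[of \<theta> \<theta>] i1 m1 prob_space by (simp add: u)
  show "integrable (gauss \<theta> e) (\<lambda>x. kl_gauss \<theta> s (pred_mean e t * x) (pred_sd e s t))"
    unfolding c_def[symmetric] S_def[symmetric] kl using i by (intro Bochner_Integration.integrable_add integrable_divide) auto
  have "(\<integral>x. kl_gauss \<theta> s (c * x) S \<partial>gauss \<theta> e) = (ln (S / s) - 1/2 + s\<^sup>2 / (2 * S\<^sup>2)) + (c\<^sup>2 * u + (1 - c)\<^sup>2 * \<theta>\<^sup>2) / (2 * S\<^sup>2)"
    unfolding kl m[symmetric] using i prob_space by simp
  also have "\<dots> = ln (S / s) + (c\<^sup>2 * u + (1 - c)\<^sup>2 * \<theta>\<^sup>2 + s\<^sup>2 - S\<^sup>2) / (2 * S\<^sup>2)"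
    using S0 by (simp add: field_simps)
  also have "c\<^sup>2 * u + (1 - c)\<^sup>2 * \<theta>\<^sup>2 + s\<^sup>2 - S\<^sup>2 = (1 - c)\<^sup>2 * (\<theta>\<^sup>2 - t)"
  proof -
    \<comment> \<open>Both sides are the posterior variance; their equality produces the factor
      \<open>\<theta>^2 - t\<close>.\<close>
    have "c * u = (1 - c) * t" unfolding c1 using te by (simp add: c_def u field_simps)
    then have "c * u * (1 - c) = (1 - c)\<^sup>2 * t" by (simp add: power2_eq_square)
    then show ?thesis unfolding S2 by (simp add: power2_eq_square algebra_simps)
  qed
  also have "ln (S / s) = gain u v t"
  proof -
    have "(S / s)\<^sup>2 = 1 + u / s\<^sup>2 * c" using s by (simp add: power_divide S2 field_simps)
    also have "u / s\<^sup>2 = (u - v) / v" using uv by simp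
    also have "1 + (u - v) / v * c = (1 + t / v) / (1 + t / u)"
      using gain_ratio[OF uv(1,2) t] by (simp add: c_def u add.commute)
    finally have "gain u v t = 1/2 * ln ((S / s)\<^sup>2)" by (simp add: gain_def)
    then show ?thesis using S0 s by (simp add: ln_realpow)
  qed
  also have "(1 - c)\<^sup>2 * (\<theta>\<^sup>2 - t) / (2 * S\<^sup>2) = gain' u v t * (\<theta>\<^sup>2 - t)"
  proof -
    have p: "0 < u + t" "0 < v + t" using uv t by auto
    have "S\<^sup>2 = s\<^sup>2 * (u * (v + t) / (v * (u + t)))"
    proof -
      have "S\<^sup>2 = s\<^sup>2 * (1 + u / s\<^sup>2 * c)" using s by (simp add: S2 field_simps)
      also have "u / s\<^sup>2 = (u - v) / v" using uv by simp
      also have "1 + (u - v) / v * c = (u * (v + t)) / (v * (u + t))"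
      proof -
        have "0 < 1 + t / u" using uv t by (intro add_pos_nonneg) auto
        then have "(1 + t / v) / (1 + t / u) = (u * (v + t)) / (v * (u + t))"
          using p uv by (simp add: field_simps)
        then show ?thesis
          using gain_ratio[OF uv(1,2) t] by (simp only: c_def u add.commute[of t])
      qed
      finally show ?thesis .
    qed
    have "gain' u v t = (u * v / s\<^sup>2) / (2 * ((u + t) * (v + t)))"
      unfolding gain'_def using uv by simp
    have "(1 - c)\<^sup>2 / (2 * S\<^sup>2) = gain' u v t"
    proof -
      have "(u / X)\<^sup>2 / (2 * (s\<^sup>2 * (u * Y / (v * X)))) = (u * v / s\<^sup>2) / (2 * (X * Y))"
        if "0 < X" "0 < Y" for X Y
        using that uv(1,3) s by (simp add: field_simps power2_eq_square)
      from this[OF p] show ?thesis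
        unfolding c1 \<open>S\<^sup>2 = s\<^sup>2 * (u * (v + t) / (v * (u + t)))\<close>
          \<open>gain' u v t = (u * v / s\<^sup>2) / (2 * ((u + t) * (v + t)))\<close> .
    qed
    then show ?thesis by (metis times_divide_eq_left)
  qed
  finally show "(\<integral>x. kl_gauss \<theta> s (pred_mean e t * x) (pred_sd e s t) \<partial>gauss \<theta> e) = coord_risk (v2_obs e) (v2_joint e s) t \<theta>"
    by (simp add: coord_risk_def u_def v_def c_def S_def)
qed

context
  fixes e s :: real and \<tau> :: "nat \<Rightarrow> real" and T :: nat
  assumes e: "0 < e" and s: "0 < s" and tail: "\<And>i. T \<le> i \<Longrightarrow> \<tau> i = 0"
begin

lemma bayes_pred_eq: "bayes_pred e s \<tau> x =
    gauss_prod (\<lambda>i. pred_mean e ((\<tau> i)\<^sup>2) * x i) (\<lambda>i. pred_sd e s ((\<tau> i)\<^sup>2))"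
  by (simp add: bayes_pred_def)

lemma bayes_pred_eq_density: "bayes_pred e s \<tau> x =
    density (gauss_prod (\<lambda>_. 0) (\<lambda>i. pred_sd e s ((\<tau> i)\<^sup>2)))
      (\<lambda>y. ennreal (\<Prod>i<T. nratio (pred_mean e ((\<tau> i)\<^sup>2) * x i) (pred_sd e s ((\<tau> i)\<^sup>2)) 0 (pred_sd e s ((\<tau> i)\<^sup>2)) (y i)))"
  unfolding bayes_pred_eq using s tail by (intro gauss_prod_eq_density pred_sd_pos) auto

text \<open>Relative to a measure free of \<open>x\<close> the kernel has a density that is a finite
  product, jointly measurable in \<open>x\<close> and \<open>y\<close>; measurability of the kernel
  then follows by integrating out \<open>y\<close>.\<close>

lemma bayes_pred_in_pred_dists: "bayes_pred e s \<tau> \<in> pred_dists"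
  unfolding pred_dists_def
proof (rule CollectI, rule measurable_prob_algebraI)
  show prob: "prob_space (bayes_pred e s \<tau> x)" for x
    unfolding bayes_pred_eq by (intro prob_space_gauss_prod pred_sd_pos s) simp
  let ?M = "gauss_prod (\<lambda>_. 0) (\<lambda>i. pred_sd e s ((\<tau> i)\<^sup>2))"
  interpret M: prob_space ?M by (intro prob_space_gauss_prod pred_sd_pos s) simp
  show "bayes_pred e s \<tau> \<in> Rinf \<rightarrow>\<^sub>M subprob_algebra Rinf"
  proof (rule measurable_subprob_algebra)
    show "subprob_space (bayes_pred e s \<tau> x)" for x by (rule prob_space_imp_subprob_space[OF prob])
    show "sets (bayes_pred e s \<tau> x) = sets Rinf" for x unfolding bayes_pred_eq by (rule sets_gauss_prod)
    fix A assume A[measurable]: "A \<in> sets Rinf"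
    have [measurable]: "A \<in> sets ?M" using A by (simp add: sets_gauss_prod)
    have [measurable]: "(\<lambda>z. fst z i) \<in> borel_measurable (Rinf \<Otimes>\<^sub>M ?M)" for i
      by (rule measurable_compose[OF measurable_fst measurable_Rinf_component])
    have c[measurable]: "(\<lambda>y. y i) \<in> borel_measurable ?M" for i
      using measurable_Rinf_component by (simp add: measurable_cong_sets[OF sets_gauss_prod refl])
    have [measurable]: "(\<lambda>z. snd z i) \<in> borel_measurable (Rinf \<Otimes>\<^sub>M ?M)" for i
      by (rule measurable_compose[OF measurable_snd c])
    define g where "g x y = (\<Prod>i<T. nratio (pred_mean e ((\<tau> i)\<^sup>2) * x i) (pred_sd e s ((\<tau> i)\<^sup>2)) 0 (pred_sd e s ((\<tau> i)\<^sup>2)) (y i))" for x y :: "nat \<Rightarrow> real"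
    have g: "(\<lambda>z. g (fst z) (snd z)) \<in> borel_measurable (Rinf \<Otimes>\<^sub>M ?M)"
      unfolding g_def by (intro borel_measurable_prod nratio_measurable borel_measurable_times) auto
    have gx: "g x \<in> borel_measurable ?M" for x
      unfolding g_def by (intro borel_measurable_prod nratio_measurable c) auto
    have "(\<lambda>x. \<integral>\<^sup>+y. ennreal (g x y) * indicator A y \<partial>?M) \<in> borel_measurable Rinf"
      using g by (intro M.borel_measurable_nn_integral) (simp add: case_prod_beta')
    moreover have "emeasure (bayes_pred e s \<tau> x) A = (\<integral>\<^sup>+y. ennreal (g x y) * indicator A y \<partial>?M)" for x
      unfolding bayes_pred_eq_density using gx[of x] by (subst emeasure_density) (auto simp: g_def)
    ultimately show "(\<lambda>x. emeasure (bayes_pred e s \<tau> x) A) \<in> borel_measurable Rinf" by simp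
  qed
qed

text \<open>From \<open>T\<close> on the prediction is centred with variance \<open>s^2\<close>, so
  such a coordinate loses \<open>(\<theta> i)^2 / (2 * s^2)\<close> whatever is observed. The result
  is an inequality because the divergence of infinite products was bounded from above only.\<close>

lemma risk_bayes_pred_le:
  assumes \<theta>: "summable (\<lambda>i. (\<theta> i)\<^sup>2)"
  shows "risk e s \<theta> (bayes_pred e s \<tau>) \<le>
    ennreal ((\<Sum>i<T. coord_risk (v2_obs e) (v2_joint e s) ((\<tau> i)\<^sup>2) (\<theta> i)) + (\<Sum>i. (\<theta> (i + T))\<^sup>2) / (2 * s\<^sup>2))"
proof -
  define k where "k i x = kl_gauss (\<theta> i) s (pred_mean e ((\<tau> i)\<^sup>2) * x) (pred_sd e s ((\<tau> i)\<^sup>2))" for i x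
  define R where "R = (\<Sum>i. (\<theta> (i + T))\<^sup>2) / (2 * s\<^sup>2)"
  have k0: "0 \<le> k i x" for i x unfolding k_def using s by (intro kl_gauss_nonneg pred_sd_pos) auto
  have ktail: "k i x = (\<theta> i)\<^sup>2 / (2 * s\<^sup>2)" if "T \<le> i" for i x
    using s tail[OF that] by (simp add: k_def kl_gauss_def add_divide_distrib)
  have sumT: "summable (\<lambda>i. (\<theta> (i + T))\<^sup>2)" using \<theta> by (rule summable_ignore_initial_segment)
  have R0: "0 \<le> R" unfolding R_def using sumT by (intro divide_nonneg_nonneg suminf_nonneg) auto
  have kl: "kl_loss (Q_fut s \<theta>) (bayes_pred e s \<tau> x) \<le> ennreal ((\<Sum>i<T. k i (x i)) + R)" for x
    unfolding Q_fut_def bayes_pred_eq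
  proof (rule kl_loss_gauss_prod_le[OF s])
    show "0 < pred_sd e s ((\<tau> i)\<^sup>2)" for i by (intro pred_sd_pos s) simp
    show "pred_mean e ((\<tau> i)\<^sup>2) * x i = 0" "pred_sd e s ((\<tau> i)\<^sup>2) = s" if "T \<le> i" for i
      using tail[OF that] s by simp_all
    show "summable (\<lambda>i. (\<theta> i)\<^sup>2)" by (rule \<theta>)
    fix n
    have "(\<Sum>i<n. k i (x i)) \<le> (\<Sum>i<T + n. k i (x i))"
      using k0 by (intro sum_mono2) auto
    also have "\<dots> = (\<Sum>i<T. k i (x i)) + (\<Sum>i<n. k (i + T) (x (i + T)))"
      by (simp add: sum.nat_group[symmetric] sum_up_index_split lessThan_atLeast0 sum.atLeastLessThan_concat[symmetric, of 0 T "T + n"] sum.shift_bounds_nat_ivl[symmetric] add.commute sum.atLeastLessThan_shift_0[of _ T])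
    also have "(\<Sum>i<n. k (i + T) (x (i + T))) = (\<Sum>i<n. (\<theta> (i + T))\<^sup>2) / (2 * s\<^sup>2)"
      by (simp add: ktail sum_divide_distrib)
    also have "\<dots> \<le> R"
      unfolding R_def using sumT by (intro divide_right_mono sum_le_suminf) auto
    finally show "(\<Sum>i<n. kl_gauss (\<theta> i) s (pred_mean e ((\<tau> i)\<^sup>2) * x i) (pred_sd e s ((\<tau> i)\<^sup>2))) \<le> (\<Sum>i<T. k i (x i)) + R"
      unfolding k_def by simp
  qed
  interpret P: prob_space "P_obs e \<theta>" unfolding P_obs_def by (intro prob_space_gauss_prod e)
  note ik = integral_kl_gauss[OF e s, of "(\<tau> i)\<^sup>2" "\<theta> i" for i, folded k_def]
  have ik1: "integrable (P_obs e \<theta>) (\<lambda>x. k i (x i))" for i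
    unfolding P_obs_def gauss_prod_def
    by (rule integrable_PiM_component[where M = "\<lambda>i. gauss (\<theta> i) e"]) (use ik e in \<open>auto intro: prob_space_gauss\<close>)
  have ik2: "(\<integral>x. k i (x i) \<partial>P_obs e \<theta>) = coord_risk (v2_obs e) (v2_joint e s) ((\<tau> i)\<^sup>2) (\<theta> i)" for i
    unfolding P_obs_def gauss_prod_def
    by (subst integral_PiM_component[where M = "\<lambda>i. gauss (\<theta> i) e"])
       (use ik e in \<open>auto intro: prob_space_gauss dest: borel_measurable_integrable\<close>)
  have "risk e s \<theta> (bayes_pred e s \<tau>) \<le> (\<integral>\<^sup>+x. ennreal ((\<Sum>i<T. k i (x i)) + R) \<partial>P_obs e \<theta>)"
    unfolding risk_def by (intro nn_integral_mono kl)
  also have "\<dots> = ennreal (\<integral>x. (\<Sum>i<T. k i (x i)) + R \<partial>P_obs e \<theta>)"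
    using ik1 k0 R0 by (intro nn_integral_eq_integral) (auto intro!: sum_nonneg add_nonneg_nonneg)
  also have "(\<integral>x. (\<Sum>i<T. k i (x i)) + R \<partial>P_obs e \<theta>) = (\<Sum>i<T. coord_risk (v2_obs e) (v2_joint e s) ((\<tau> i)\<^sup>2) (\<theta> i)) + R"
    using ik1 P.prob_space by (simp add: ik2)
  finally show ?thesis by (simp add: R_def)
qed

end

section \<open>The maximal risk of the optimal Gaussian prior\<close>

context ellipsoid
begin

theorem sup_risk_bayes_pred_le:
  "(SUP \<theta>\<in>Theta a B. risk e s \<theta> (bayes_pred e s (tau_star a B e s))) \<le> ennreal D"
proof (rule SUP_least)
  fix \<theta> assume "\<theta> \<in> Theta a B"
  then have th: "summable (\<lambda>i. (\<theta> i)\<^sup>2)" "summable (\<lambda>i. (a i)\<^sup>2 * (\<theta> i)\<^sup>2)" "(\<Sum>i. (a i)\<^sup>2 * (\<theta> i)\<^sup>2) \<le> B"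
    by (auto simp: Theta_def)
  \<comment> \<open>The slope of an inactive coordinate is \<open>gain'\<close> at variance 0, so
    the same optimality condition covers the coordinates beyond \<open>T\<close>.\<close>
  have g0: "1 / (2 * s\<^sup>2) = gain' u v 0"
    using uv_diff u_pos v_pos s by (simp add: gain'_def)
  have zero: "T \<le> i \<Longrightarrow> tau_star a B e s i = 0" for i by (simp add: tau_star_eq t_zero)
  have coord: "coord_risk u v (t i) (\<theta> i) \<le> gain u v (t i) + lam * ((a i)\<^sup>2 * (\<theta> i)\<^sup>2 - (a i)\<^sup>2 * t i)" for i
  proof (cases "t i = 0")
    case True
    then show ?thesis using mult_right_mono[OF gain'_t_le[of i], of "(\<theta> i)\<^sup>2"] by (simp add: coord_risk_def mult.assoc)
  next
    case False
    then show ?thesis using gain'_t_eq[of i] t_nonneg[of i] by (simp add: coord_risk_def algebra_simps)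
  qed
  have tail: "(\<Sum>i. (\<theta> (i + T))\<^sup>2) / (2 * s\<^sup>2) \<le> lam * (\<Sum>i. (a (i + T))\<^sup>2 * (\<theta> (i + T))\<^sup>2)"
  proof -
    have s1: "summable (\<lambda>i. (\<theta> (i + T))\<^sup>2)" and s2: "summable (\<lambda>i. (a (i + T))\<^sup>2 * (\<theta> (i + T))\<^sup>2)"
      using summable_ignore_initial_segment[OF th(1)] summable_ignore_initial_segment[OF th(2)] by auto
    have "(\<Sum>i. (\<theta> (i + T))\<^sup>2) / (2 * s\<^sup>2) = (\<Sum>i. gain' u v 0 * (\<theta> (i + T))\<^sup>2)"
      using suminf_mult[OF s1, of "gain' u v 0"] by (simp add: g0[symmetric])
    also have "\<dots> \<le> (\<Sum>i. lam * ((a (i + T))\<^sup>2 * (\<theta> (i + T))\<^sup>2))"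
    proof (intro suminf_le summable_mult s1 s2)
      fix i
      show "gain' u v 0 * (\<theta> (i + T))\<^sup>2 \<le> lam * ((a (i + T))\<^sup>2 * (\<theta> (i + T))\<^sup>2)"
        using mult_right_mono[OF gain'_t_le[of "i + T"], of "(\<theta> (i + T))\<^sup>2"] t_zero[of "i + T"] by (simp add: mult.assoc)
    qed
    also have "\<dots> = lam * (\<Sum>i. (a (i + T))\<^sup>2 * (\<theta> (i + T))\<^sup>2)" by (rule suminf_mult[OF s2])
    finally show ?thesis .
  qed
  have "risk e s \<theta> (bayes_pred e s (tau_star a B e s)) \<le>
    ennreal ((\<Sum>i<T. coord_risk u v ((tau_star a B e s i)\<^sup>2) (\<theta> i)) + (\<Sum>i. (\<theta> (i + T))\<^sup>2) / (2 * s\<^sup>2))"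
    by (rule risk_bayes_pred_le[OF e s zero th(1)])
  also have "\<dots> \<le> ennreal D"
  proof (rule ennreal_leI)
    have "(\<Sum>i<T. coord_risk u v ((tau_star a B e s i)\<^sup>2) (\<theta> i)) + (\<Sum>i. (\<theta> (i + T))\<^sup>2) / (2 * s\<^sup>2)
      \<le> (\<Sum>i<T. gain u v (t i) + lam * ((a i)\<^sup>2 * (\<theta> i)\<^sup>2 - (a i)\<^sup>2 * t i)) + lam * (\<Sum>i. (a (i + T))\<^sup>2 * (\<theta> (i + T))\<^sup>2)"
      unfolding tau_star_sq by (intro add_mono sum_mono coord tail)
    also have "\<dots> = D + lam * (((\<Sum>i<T. (a i)\<^sup>2 * (\<theta> i)\<^sup>2) + (\<Sum>i. (a (i + T))\<^sup>2 * (\<theta> (i + T))\<^sup>2)) - (\<Sum>i<T. (a i)\<^sup>2 * t i))"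
      by (simp add: D_def sum.distrib sum_subtractf sum_distrib_left[symmetric] algebra_simps)
    also have "(\<Sum>i<T. (a i)\<^sup>2 * (\<theta> i)\<^sup>2) + (\<Sum>i. (a (i + T))\<^sup>2 * (\<theta> (i + T))\<^sup>2) = (\<Sum>i. (a i)\<^sup>2 * (\<theta> i)\<^sup>2)"
      using suminf_split_initial_segment[OF th(2), of T] by simp
    also have "D + lam * ((\<Sum>i. (a i)\<^sup>2 * (\<theta> i)\<^sup>2) - (\<Sum>i<T. (a i)\<^sup>2 * t i)) \<le> D"
      unfolding sum_t using th(3) lam(1) by (simp add: mult_nonneg_nonpos)
    finally show "(\<Sum>i<T. coord_risk u v ((tau_star a B e s i)\<^sup>2) (\<theta> i)) + (\<Sum>i. (\<theta> (i + T))\<^sup>2) / (2 * s\<^sup>2) \<le> D" .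
  qed
  finally show "risk e s \<theta> (bayes_pred e s (tau_star a B e s)) \<le> ennreal D" .
qed

lemma minimax_risk_le: "minimax_risk a B e s \<le> (SUP \<theta>\<in>Theta a B. risk e s \<theta> (bayes_pred e s (tau_star a B e s)))"
  unfolding minimax_risk_def
  by (intro INF_lower bayes_pred_in_pred_dists[OF e s, where T = T]) (simp add: tau_star_eq t_zero)

end

section \<open>Divergences and moments of Gaussian products\<close>

lemma gauss_prod_component: "(\<lambda>x. x i) \<in> borel_measurable (gauss_prod m s)"
  using measurable_Rinf_component by (simp add: measurable_cong_sets[OF sets_gauss_prod refl])

lemma gauss_prod_component' [measurable (raw)]:
  "f \<in> N \<rightarrow>\<^sub>M gauss_prod m s \<Longrightarrow> (\<lambda>z. f z i) \<in> borel_measurable N"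
  by (rule measurable_compose[OF _ gauss_prod_component])

lemma nratio_divide:
  assumes "0 < s0" "0 < s2"
  shows "nratio m1 s1 m0 s0 y / nratio m2 s2 m0 s0 y = nratio m1 s1 m2 s2 y"
  using normal_density_pos[OF assms(1), of m0 y] normal_density_pos[OF assms(2), of m2 y]
  by (simp add: nratio_def)

lemma nn_integral_gauss_prod_component:
  assumes "\<And>i. 0 < s i" "f \<in> borel_measurable borel"
  shows "(\<integral>\<^sup>+x. f (x i) \<partial>gauss_prod m s) = (\<integral>\<^sup>+y. f y \<partial>gauss (m i) (s i))"
  unfolding gauss_prod_def
  using assms by (intro nn_integral_PiM_component[where M = "\<lambda>i. gauss (m i) (s i)"] prob_space_gauss) auto

lemma integral_gauss_prod_component:
  fixes f :: "real \<Rightarrow> real"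
  assumes s: "\<And>i. 0 < s i" and f: "integrable (gauss (m i) (s i)) f"
  shows "integrable (gauss_prod m s) (\<lambda>x. f (x i))"
    "(\<integral>x. f (x i) \<partial>gauss_prod m s) = (\<integral>y. f y \<partial>gauss (m i) (s i))"
  unfolding gauss_prod_def
  using integrable_PiM_component[where M = "\<lambda>i. gauss (m i) (s i)", OF prob_space_gauss[OF s] f]
    integral_PiM_component[where M = "\<lambda>i. gauss (m i) (s i)", OF prob_space_gauss[OF s] borel_measurable_integrable[OF f]]
  by auto

lemma nn_integral_gauss_moments:
  assumes "0 < s"
  shows "(\<integral>\<^sup>+y. ennreal ((y - m)\<^sup>2) \<partial>gauss m s) = ennreal (s\<^sup>2)"
    "(\<integral>\<^sup>+y. ennreal ((y - m) ^ 4) \<partial>gauss m s) = ennreal (3 * s ^ 4)"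
  using gauss_second_moment[OF assms, of m m] gauss_fourth_moment[OF assms, of m]
  by (subst nn_integral_eq_integral; simp)+

lemma nn_integral_prod_nratio:
  assumes "\<And>i. 0 < s0 i" "\<And>i. 0 < s1 i"
  shows "(\<integral>\<^sup>+y. ennreal (\<Prod>i<n. nratio (m1 i) (s1 i) (m0 i) (s0 i) (y i)) \<partial>gauss_prod m0 s0) = 1"
proof -
  have "(\<integral>\<^sup>+y. ennreal (\<Prod>i<n. nratio (m1 i) (s1 i) (m0 i) (s0 i) (y i)) \<partial>gauss_prod m0 s0)
      = (\<integral>\<^sup>+y. (\<Prod>i<n. ennreal (nratio (m1 i) (s1 i) (m0 i) (s0 i) (y i))) \<partial>gauss_prod m0 s0)"
    using assms by (intro nn_integral_cong prod_ennreal[symmetric] less_imp_le nratio_pos)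
  also have "\<dots> = (\<Prod>i<n. \<integral>\<^sup>+y. ennreal (nratio (m1 i) (s1 i) (m0 i) (s0 i) y) \<partial>gauss (m0 i) (s0 i))"
    unfolding gauss_prod_def using assms
    by (intro nn_integral_PiM_prod[where M = "\<lambda>i. gauss (m0 i) (s0 i)"] prob_space_gauss) auto
  also have "\<dots> = 1" using assms by (simp add: nn_integral_nratio)
  finally show ?thesis .
qed

lemma nn_integral_klf_gauss_prod:
  assumes s: "\<And>i. 0 < s0 i" "\<And>i. 0 < s1 i" "\<And>i. 0 < s2 i"
  shows "(\<integral>\<^sup>+y. ennreal (klf (\<Prod>i<n. nratio (m1 i) (s1 i) (m0 i) (s0 i) (y i)) (\<Prod>i<n. nratio (m2 i) (s2 i) (m0 i) (s0 i) (y i)))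
      \<partial>gauss_prod m0 s0) = ennreal (\<Sum>i<n. kl_gauss (m1 i) (s1 i) (m2 i) (s2 i))"
proof -
  define g1 where "g1 y = (\<Prod>i<n. nratio (m1 i) (s1 i) (m0 i) (s0 i) (y i))" for y
  define g2 where "g2 y = (\<Prod>i<n. nratio (m2 i) (s2 i) (m0 i) (s0 i) (y i))" for y
  \<comment> \<open>Beyond \<open>n\<close> the parameters are those of the reference measure, so
    that \<open>g1\<close> becomes the density of the product \<open>gauss_prod M S\<close>.\<close>
  define M where "M i = (if i < n then m1 i else m0 i)" for i
  define S where "S i = (if i < n then s1 i else s0 i)" for i
  have S0: "0 < S i" for i using s by (simp add: S_def)
  have "gauss_prod M S = density (gauss_prod m0 s0) (\<lambda>y. ennreal (\<Prod>i<n. nratio (M i) (S i) (m0 i) (s0 i) (y i)))"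
    using S0 s by (intro gauss_prod_eq_density) (auto simp: M_def S_def)
  also have "(\<lambda>y. ennreal (\<Prod>i<n. nratio (M i) (S i) (m0 i) (s0 i) (y i))) = (\<lambda>y. ennreal (g1 y))"
    by (intro ext arg_cong[where f = ennreal]) (simp add: g1_def M_def S_def)
  finally have dens: "density (gauss_prod m0 s0) (\<lambda>y. ennreal (g1 y)) = gauss_prod M S" ..
  have meas: "g1 \<in> borel_measurable (gauss_prod m0 s0)" "g2 \<in> borel_measurable (gauss_prod m0 s0)"
    unfolding g1_def[abs_def] g2_def[abs_def] by measurable
  have pos: "0 < g1 y" "0 < g2 y" for y
    unfolding g1_def g2_def using s by (auto intro!: prod_pos nratio_pos)
  have ln: "ln (g1 y / g2 y) = (\<Sum>i<n. ln (nratio (m1 i) (s1 i) (m2 i) (s2 i) (y i)))" for y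
    unfolding g1_def g2_def prod_dividef[symmetric] nratio_divide[OF s(1) s(3)]
    using s by (intro ln_prod) (auto simp: less_imp_neq[OF nratio_pos, symmetric])
  have i: "integrable (gauss_prod M S) (\<lambda>y. ln (nratio (m1 i) (s1 i) (m2 i) (s2 i) (y i)))"
      "(\<integral>y. ln (nratio (m1 i) (s1 i) (m2 i) (s2 i) (y i)) \<partial>gauss_prod M S) = kl_gauss (m1 i) (s1 i) (m2 i) (s2 i)" if "i < n" for i
  proof -
    have *: "gauss (M i) (S i) = gauss (m1 i) (s1 i)" using that by (simp add: M_def S_def)
    note int = integral_ln_nratio[OF s(2) s(3), of "m1 i" i "m2 i" i]
    show "integrable (gauss_prod M S) (\<lambda>y. ln (nratio (m1 i) (s1 i) (m2 i) (s2 i) (y i)))"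
      by (rule integral_gauss_prod_component(1)[OF S0]) (unfold *, rule int)
    show "(\<integral>y. ln (nratio (m1 i) (s1 i) (m2 i) (s2 i) (y i)) \<partial>gauss_prod M S) = kl_gauss (m1 i) (s1 i) (m2 i) (s2 i)"
      unfolding int(2)[symmetric] *[symmetric]
      by (rule integral_gauss_prod_component(2)[OF S0]) (unfold *, rule int)
  qed
  have "(\<integral>\<^sup>+y. ennreal (klf (g1 y) (g2 y)) \<partial>gauss_prod m0 s0) = ennreal (\<integral>y. ln (g1 y / g2 y) \<partial>density (gauss_prod m0 s0) g1)"
  proof (rule nn_integral_klf(1)[OF meas pos])
    show "(\<integral>\<^sup>+y. ennreal (g1 y) \<partial>gauss_prod m0 s0) = 1" "(\<integral>\<^sup>+y. ennreal (g2 y) \<partial>gauss_prod m0 s0) = 1"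
      unfolding g1_def g2_def using s by (auto intro!: nn_integral_prod_nratio)
    show "integrable (density (gauss_prod m0 s0) (\<lambda>y. ennreal (g1 y))) (\<lambda>y. ln (g1 y / g2 y))"
      unfolding dens ln using i by (intro Bochner_Integration.integrable_sum) auto
  qed
  also have "(\<integral>y. ln (g1 y / g2 y) \<partial>density (gauss_prod m0 s0) g1) = (\<Sum>i<n. kl_gauss (m1 i) (s1 i) (m2 i) (s2 i))"
    unfolding dens ln using i by (subst Bochner_Integration.integral_sum) auto
  finally show ?thesis by (simp add: g1_def g2_def)
qed

lemma nn_integral_nratio_gauss:
  assumes b: "0 < b" and s: "0 < s"
  shows "(\<integral>\<^sup>+\<xi>. ennreal (nratio (\<sigma> * \<xi>) s 0 s y) \<partial>gauss a b) = ennreal (nratio (\<sigma> * a) (sqrt (\<sigma>\<^sup>2 * b\<^sup>2 + s\<^sup>2)) 0 s y)"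
proof -
  define S where "S = sqrt (\<sigma>\<^sup>2 * b\<^sup>2 + s\<^sup>2)"
  have S: "0 < S" unfolding S_def using s by (intro real_sqrt_gt_zero add_nonneg_pos) auto
  define M where "M = (a * s\<^sup>2 + \<sigma> * b\<^sup>2 * y) / (\<sigma>\<^sup>2 * b\<^sup>2 + s\<^sup>2)"
  have "normal_density a b \<xi> * nratio (\<sigma> * \<xi>) s 0 s y = nratio (\<sigma> * a) S 0 s y * normal_density M (b * s / S) \<xi>" for \<xi>
    using normal_density_bayes[OF b s, of a \<xi> \<sigma> y] by (simp add: nratio_def S_def M_def)
  then have "(\<integral>\<^sup>+\<xi>. ennreal (nratio (\<sigma> * \<xi>) s 0 s y) \<partial>gauss a b)
      = (\<integral>\<^sup>+\<xi>. ennreal (nratio (\<sigma> * a) S 0 s y) * ennreal (normal_density M (b * s / S) \<xi>) \<partial>lborel)"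
    using nratio_pos[OF s s] nratio_pos[OF S s]
    by (subst nn_integral_density) (auto intro!: nn_integral_cong simp: ennreal_mult[symmetric] less_imp_le)
  also have "\<dots> = ennreal (nratio (\<sigma> * a) S 0 s y) * (\<integral>\<^sup>+\<xi>. ennreal (normal_density M (b * s / S) \<xi>) \<partial>lborel)"
    by (intro nn_integral_cmult) auto
  also have "(\<integral>\<^sup>+\<xi>. ennreal (normal_density M (b * s / S) \<xi>) \<partial>lborel) = 1"
    using b s S by (simp add: nn_integral_eq_integral)
  finally show ?thesis by (simp add: S_def)
qed

text \<open>Truncated second moments are controlled by fourth moments through
  \<open>2 z\<^sup>2 \<le> \<mu> z\<^sup>4 + 1 / \<mu>\<close>.\<close>
lemma gauss_prod_truncated_moment:
  assumes s: "\<And>i. 0 < s i" and E: "E \<in> sets (gauss_prod m s)" and c: "\<And>i. 0 \<le> c i" and \<mu>: "0 < \<mu>"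
  shows "(\<integral>\<^sup>+\<xi>\<in>E. ennreal (\<Sum>i<n. c i * (\<xi> i - m i)\<^sup>2) \<partial>gauss_prod m s)
    \<le> ennreal (\<Sum>i<n. c i * (s i)\<^sup>2) * (ennreal (3 * \<mu> / 2) + ennreal (1 / (2 * \<mu>)) * emeasure (gauss_prod m s) E)"
proof -
  note [measurable] = E
  let ?C = "\<Sum>i<n. c i * (s i)\<^sup>2"
  have C0: "0 \<le> ?C" using c by (intro sum_nonneg) auto
  have pt: "(\<Sum>i<n. c i * z i ^ 2) \<le> (\<Sum>i<n. (c i * \<mu> / (2 * (s i)\<^sup>2)) * z i ^ 4) + ?C / (2 * \<mu>)" for z :: "nat \<Rightarrow> real"
  proof -
    have "c i * z i ^ 2 \<le> (c i * \<mu> / (2 * (s i)\<^sup>2)) * z i ^ 4 + c i * (s i)\<^sup>2 / (2 * \<mu>)" for i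
    proof -
      \<comment> \<open>The truncation inequality applied to \<open>z i / s i\<close> and multiplied
        by \<open>c i * (s i)^2 / 2\<close>; with this scaling each coordinate contributes in
        proportion to its share of \<open>?C\<close>.\<close>
      have "0 \<le> c i / (2 * \<mu> * (s i)\<^sup>2) * (\<mu> * z i ^ 2 - (s i)\<^sup>2)\<^sup>2"
        using c \<mu> by (intro mult_nonneg_nonneg) auto
      also have "\<dots> = (c i * \<mu> / (2 * (s i)\<^sup>2)) * z i ^ 4 + c i * (s i)\<^sup>2 / (2 * \<mu>) - c i * z i ^ 2"
        using \<mu> s[of i] by (simp add: field_simps eval_nat_numeral)
      finally show ?thesis by simp
    qed
    then have "(\<Sum>i<n. c i * z i ^ 2) \<le> (\<Sum>i<n. (c i * \<mu> / (2 * (s i)\<^sup>2)) * z i ^ 4 + c i * (s i)\<^sup>2 / (2 * \<mu>))"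
      by (rule sum_mono)
    then show ?thesis by (simp add: sum.distrib sum_divide_distrib)
  qed
  have "(\<integral>\<^sup>+\<xi>\<in>E. ennreal (\<Sum>i<n. c i * (\<xi> i - m i)\<^sup>2) \<partial>gauss_prod m s)
      \<le> (\<integral>\<^sup>+\<xi>. (\<Sum>i<n. ennreal (c i * \<mu> / (2 * (s i)\<^sup>2)) * ennreal ((\<xi> i - m i) ^ 4)) + ennreal (?C / (2 * \<mu>)) * indicator E \<xi> \<partial>gauss_prod m s)"
  proof (rule nn_integral_mono)
    fix \<xi>
    have nn: "0 \<le> c i * \<mu> / (2 * (s i)\<^sup>2) * (\<xi> i - m i) ^ 4" for i using c \<mu> by simp
    have "ennreal (\<Sum>i<n. c i * (\<xi> i - m i)\<^sup>2) \<le> ennreal ((\<Sum>i<n. (c i * \<mu> / (2 * (s i)\<^sup>2)) * (\<xi> i - m i) ^ 4) + ?C / (2 * \<mu>))"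
      by (rule ennreal_leI[OF pt])
    also have "\<dots> = (\<Sum>i<n. ennreal (c i * \<mu> / (2 * (s i)\<^sup>2)) * ennreal ((\<xi> i - m i) ^ 4)) + ennreal (?C / (2 * \<mu>))"
    proof -
      have "ennreal ((\<Sum>i<n. (c i * \<mu> / (2 * (s i)\<^sup>2)) * (\<xi> i - m i) ^ 4) + ?C / (2 * \<mu>))
         = ennreal (\<Sum>i<n. (c i * \<mu> / (2 * (s i)\<^sup>2)) * (\<xi> i - m i) ^ 4) + ennreal (?C / (2 * \<mu>))"
      proof (rule ennreal_plus)
        show "0 \<le> ?C / (2 * \<mu>)" using C0 \<mu> by simp
      qed (intro sum_nonneg nn)
      also have "ennreal (\<Sum>i<n. (c i * \<mu> / (2 * (s i)\<^sup>2)) * (\<xi> i - m i) ^ 4) = (\<Sum>i<n. ennreal ((c i * \<mu> / (2 * (s i)\<^sup>2)) * (\<xi> i - m i) ^ 4))"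
        using nn by (intro sum_ennreal[symmetric])
      also have "\<dots> = (\<Sum>i<n. ennreal (c i * \<mu> / (2 * (s i)\<^sup>2)) * ennreal ((\<xi> i - m i) ^ 4))"
        using c \<mu> by (intro sum.cong refl ennreal_mult) auto
      finally show ?thesis .
    qed
    finally show "ennreal (\<Sum>i<n. c i * (\<xi> i - m i)\<^sup>2) * indicator E \<xi>
       \<le> (\<Sum>i<n. ennreal (c i * \<mu> / (2 * (s i)\<^sup>2)) * ennreal ((\<xi> i - m i) ^ 4)) + ennreal (?C / (2 * \<mu>)) * indicator E \<xi>"
      by (auto simp: indicator_def)
  qed
  also have "\<dots> = (\<Sum>i<n. ennreal (c i * \<mu> / (2 * (s i)\<^sup>2)) * (\<integral>\<^sup>+\<xi>. ennreal ((\<xi> i - m i) ^ 4) \<partial>gauss_prod m s))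
       + ennreal (?C / (2 * \<mu>)) * emeasure (gauss_prod m s) E"
    by (subst nn_integral_add) (auto simp: nn_integral_sum nn_integral_cmult)
  also have "(\<Sum>i<n. ennreal (c i * \<mu> / (2 * (s i)\<^sup>2)) * (\<integral>\<^sup>+\<xi>. ennreal ((\<xi> i - m i) ^ 4) \<partial>gauss_prod m s))
      = (\<Sum>i<n. ennreal (c i * (s i)\<^sup>2 * (3 * \<mu> / 2)))"
  proof (intro sum.cong refl)
    fix i
    have "(\<integral>\<^sup>+\<xi>. ennreal ((\<xi> i - m i) ^ 4) \<partial>gauss_prod m s) = ennreal (3 * s i ^ 4)"
      using s by (subst nn_integral_gauss_prod_component[where f = "\<lambda>y. ennreal ((y - m i) ^ 4)"]) (auto simp: nn_integral_gauss_moments)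
    then have "ennreal (c i * \<mu> / (2 * (s i)\<^sup>2)) * (\<integral>\<^sup>+\<xi>. ennreal ((\<xi> i - m i) ^ 4) \<partial>gauss_prod m s)
       = ennreal (c i * \<mu> / (2 * (s i)\<^sup>2)) * ennreal (3 * s i ^ 4)"
      by (simp only:)
    also have "\<dots> = ennreal (c i * \<mu> / (2 * (s i)\<^sup>2) * (3 * s i ^ 4))"
      using c \<mu> by (intro ennreal_mult[symmetric]) auto
    also have "c i * \<mu> / (2 * (s i)\<^sup>2) * (3 * s i ^ 4) = c i * (s i)\<^sup>2 * (3 * \<mu> / 2)"
      using s[of i] by (simp add: field_simps eval_nat_numeral)
    finally show "ennreal (c i * \<mu> / (2 * (s i)\<^sup>2)) * (\<integral>\<^sup>+\<xi>. ennreal ((\<xi> i - m i) ^ 4) \<partial>gauss_prod m s)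
       = ennreal (c i * (s i)\<^sup>2 * (3 * \<mu> / 2))" .
  qed
  also have "\<dots> = ennreal (?C * (3 * \<mu> / 2))"
  proof -
    have "(\<Sum>i<n. ennreal (c i * (s i)\<^sup>2 * (3 * \<mu> / 2))) = ennreal (\<Sum>i<n. c i * (s i)\<^sup>2 * (3 * \<mu> / 2))"
      using c \<mu> by (intro sum_ennreal) auto
    then show ?thesis by (simp only: sum_distrib_right)
  qed
  also have "\<dots> = ennreal ?C * ennreal (3 * \<mu> / 2)"
    using C0 \<mu> by (intro ennreal_mult) auto
  also have "ennreal (?C / (2 * \<mu>)) = ennreal ?C * ennreal (1 / (2 * \<mu>))"
    using C0 \<mu> by (subst ennreal_mult[symmetric]) auto
  finally show ?thesis by (simp only: distrib_left mult.assoc)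
qed

section \<open>Gaussian priors restricted to a set\<close>

text \<open>The prior is the law of \<open>\<theta> \<xi>\<close> for standard normal
  \<open>\<xi>\<close>. Standardising keeps \<open>G\<close> nondegenerate although the prior
  variance \<open>(\<sigma> i)^2\<close> is zero from \<open>T\<close> on, and that tail makes
  \<open>p\<close> and \<open>q\<close> finite products.\<close>

locale gaussian_prior =
  fixes e s :: real and \<sigma> :: "nat \<Rightarrow> real" and T :: nat
  assumes e: "0 < e" and s: "0 < s" and \<sigma>_tail: "\<And>i. T \<le> i \<Longrightarrow> \<sigma> i = 0"
begin

abbreviation G :: "(nat \<Rightarrow> real) measure" where "G \<equiv> gauss_prod (\<lambda>_. 0) (\<lambda>_. 1)"
abbreviation P0 :: "(nat \<Rightarrow> real) measure" where "P0 \<equiv> gauss_prod (\<lambda>_. 0) (\<lambda>_. e)"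
abbreviation Q0 :: "(nat \<Rightarrow> real) measure" where "Q0 \<equiv> gauss_prod (\<lambda>_. 0) (\<lambda>_. s)"

definition \<theta> :: "(nat \<Rightarrow> real) \<Rightarrow> nat \<Rightarrow> real" where "\<theta> \<xi> i = \<sigma> i * \<xi> i"
text \<open>Given \<open>x\<close>, the posterior of \<open>\<xi> i\<close> is normal with mean
  \<open>\<alpha> i * x i\<close> and standard deviation \<open>\<beta> i\<close>;
  \<open>r i\<close> is the marginal standard deviation of \<open>x i\<close>.\<close>

definition \<alpha> :: "nat \<Rightarrow> real" where "\<alpha> i = \<sigma> i / ((\<sigma> i)\<^sup>2 + e\<^sup>2)"
definition r :: "nat \<Rightarrow> real" where "r i = sqrt ((\<sigma> i)\<^sup>2 + e\<^sup>2)"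
definition \<beta> :: "nat \<Rightarrow> real" where "\<beta> i = e / r i"
abbreviation S :: "nat \<Rightarrow> real" where "S i \<equiv> pred_sd e s ((\<sigma> i)\<^sup>2)"
abbreviation c :: "nat \<Rightarrow> real" where "c i \<equiv> pred_mean e ((\<sigma> i)\<^sup>2)"
abbreviation post :: "(nat \<Rightarrow> real) \<Rightarrow> (nat \<Rightarrow> real) measure" where
  "post x \<equiv> gauss_prod (\<lambda>i. \<alpha> i * x i) \<beta>"

text \<open>Densities relative to centred Gaussian products: \<open>p\<close> and \<open>q\<close>
  for the two observations given \<open>\<xi>\<close>, \<open>w\<close> for the marginal of
  \<open>x\<close>, \<open>l x\<close> for the posterior, \<open>M x\<close> for the predictive
  distribution.\<close>

definition p :: "(nat \<Rightarrow> real) \<Rightarrow> (nat \<Rightarrow> real) \<Rightarrow> real" where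
  "p \<xi> x = (\<Prod>i<T. nratio (\<sigma> i * \<xi> i) e 0 e (x i))"
definition q :: "(nat \<Rightarrow> real) \<Rightarrow> (nat \<Rightarrow> real) \<Rightarrow> real" where
  "q \<xi> y = (\<Prod>i<T. nratio (\<sigma> i * \<xi> i) s 0 s (y i))"
definition w :: "(nat \<Rightarrow> real) \<Rightarrow> real" where
  "w x = (\<Prod>i<T. nratio 0 (r i) 0 e (x i))"
definition l :: "(nat \<Rightarrow> real) \<Rightarrow> (nat \<Rightarrow> real) \<Rightarrow> real" where
  "l x \<xi> = (\<Prod>i<T. nratio (\<alpha> i * x i) (\<beta> i) 0 1 (\<xi> i))"
definition M :: "(nat \<Rightarrow> real) \<Rightarrow> (nat \<Rightarrow> real) \<Rightarrow> real" where
  "M x y = (\<Prod>i<T. nratio (c i * x i) (S i) 0 s (y i))"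

lemma r_pos: "0 < r i" unfolding r_def using e by (intro real_sqrt_gt_zero add_nonneg_pos) auto
lemma r_sq: "(r i)\<^sup>2 = (\<sigma> i)\<^sup>2 + e\<^sup>2" unfolding r_def by simp
lemma \<beta>_pos: "0 < \<beta> i" unfolding \<beta>_def using e r_pos by simp
lemma S_pos: "0 < S i" by (intro pred_sd_pos s) simp

lemma pos: "0 < p \<xi> x" "0 < q \<xi> y" "0 < w x" "0 < l x \<xi>" "0 < M x y"
  unfolding p_def q_def w_def l_def M_def
  by (intro prod_pos nratio_pos e s r_pos \<beta>_pos S_pos; simp)+

lemma meas [measurable (raw)]:
  assumes [measurable]: "f \<in> N \<rightarrow>\<^sub>M gauss_prod m1 s1" "g \<in> N \<rightarrow>\<^sub>M gauss_prod m2 s2"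
  shows "(\<lambda>z. p (f z) (g z)) \<in> borel_measurable N" "(\<lambda>z. q (f z) (g z)) \<in> borel_measurable N"
    "(\<lambda>z. w (f z)) \<in> borel_measurable N" "(\<lambda>z. l (f z) (g z)) \<in> borel_measurable N"
    "(\<lambda>z. M (f z) (g z)) \<in> borel_measurable N"
  unfolding p_def q_def w_def l_def M_def by measurable

lemma l_meas [measurable]: "l x \<in> borel_measurable (gauss_prod m1 s1)"
  unfolding l_def[abs_def] by measurable

lemma P_obs_eq: "P_obs e (\<theta> \<xi>) = density P0 (\<lambda>x. ennreal (p \<xi> x))"
  unfolding P_obs_def p_def \<theta>_def[abs_def] using e \<sigma>_tail by (intro gauss_prod_eq_density) auto

lemma Q_fut_eq: "Q_fut s (\<theta> \<xi>) = density Q0 (\<lambda>y. ennreal (q \<xi> y))"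
  unfolding Q_fut_def q_def \<theta>_def[abs_def] using s \<sigma>_tail by (intro gauss_prod_eq_density) auto

lemma post_eq: "post x = density G (\<lambda>\<xi>. ennreal (l x \<xi>))"
  unfolding l_def using e \<sigma>_tail \<beta>_pos
  by (intro gauss_prod_eq_density) (auto simp: \<alpha>_def \<beta>_def r_def)

lemma p_eq: "p \<xi> x = w x * l x \<xi>"
proof -
  have "nratio (\<sigma> i * \<xi> i) e 0 e (x i) = nratio 0 (r i) 0 e (x i) * nratio (\<alpha> i * x i) (\<beta> i) 0 1 (\<xi> i)" for i
  proof -
    have "normal_density 0 1 (\<xi> i) * normal_density (\<sigma> i * \<xi> i) e (x i)
        = normal_density 0 (r i) (x i) * normal_density (\<alpha> i * x i) (\<beta> i) (\<xi> i)"
      using normal_density_bayes[of 1 e 0 "\<xi> i" "\<sigma> i" "x i"] e by (simp add: r_def \<alpha>_def \<beta>_def)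
    then show ?thesis
      using normal_density_pos[of 1 0 "\<xi> i"] normal_density_pos[OF e, of 0 "x i"]
      by (simp add: nratio_def field_simps)
  qed
  then show ?thesis unfolding p_def w_def l_def by (simp add: prod.distrib)
qed

text \<open>Turns prior averages weighted by the likelihood into averages over the explicit Gaussian
  posterior.\<close>

lemma nn_integral_p:
  assumes F [measurable]: "F \<in> borel_measurable G"
  shows "(\<integral>\<^sup>+\<xi>. ennreal (p \<xi> x) * F \<xi> \<partial>G) = ennreal (w x) * (\<integral>\<^sup>+\<xi>. F \<xi> \<partial>post x)"
proof -
  have "(\<integral>\<^sup>+\<xi>. ennreal (p \<xi> x) * F \<xi> \<partial>G) = (\<integral>\<^sup>+\<xi>. ennreal (w x) * (ennreal (l x \<xi>) * F \<xi>) \<partial>G)"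
    by (intro nn_integral_cong) (simp add: p_eq ennreal_mult' pos less_imp_le mult.assoc)
  also have "\<dots> = ennreal (w x) * (\<integral>\<^sup>+\<xi>. ennreal (l x \<xi>) * F \<xi> \<partial>G)"
    by (intro nn_integral_cmult) measurable
  also have "(\<integral>\<^sup>+\<xi>. ennreal (l x \<xi>) * F \<xi> \<partial>G) = (\<integral>\<^sup>+\<xi>. F \<xi> \<partial>post x)"
    unfolding post_eq by (subst nn_integral_density) auto
  finally show ?thesis .
qed

lemma prob_post: "prob_space (post x)"
  by (intro prob_space_gauss_prod \<beta>_pos)

lemma nn_integral_q_post: "(\<integral>\<^sup>+\<xi>. ennreal (q \<xi> y) \<partial>post x) = ennreal (M x y)"
proof -
  have "(\<integral>\<^sup>+\<xi>. ennreal (q \<xi> y) \<partial>post x) = (\<integral>\<^sup>+\<xi>. (\<Prod>i<T. ennreal (nratio (\<sigma> i * \<xi> i) s 0 s (y i))) \<partial>post x)"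
    unfolding q_def using s by (intro nn_integral_cong prod_ennreal[symmetric] less_imp_le nratio_pos)
  also have "\<dots> = (\<Prod>i<T. \<integral>\<^sup>+z. ennreal (nratio (\<sigma> i * z) s 0 s (y i)) \<partial>gauss (\<alpha> i * x i) (\<beta> i))"
    unfolding gauss_prod_def
    by (intro nn_integral_PiM_prod[where M = "\<lambda>i. gauss (\<alpha> i * x i) (\<beta> i)" and f = "\<lambda>i z. ennreal (nratio (\<sigma> i * z) s 0 s (y i))"]
        prob_space_gauss \<beta>_pos) auto
  also have "\<dots> = (\<Prod>i<T. ennreal (nratio (c i * x i) (S i) 0 s (y i)))"
  proof (intro prod.cong refl)
    fix i
    have "sqrt ((\<sigma> i)\<^sup>2 * (\<beta> i)\<^sup>2 + s\<^sup>2) = S i"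
      by (simp add: \<beta>_def power_divide r_sq)
    moreover have "\<sigma> i * (\<alpha> i * x i) = c i * x i"
      by (simp add: \<alpha>_def power2_eq_square)
    ultimately show "(\<integral>\<^sup>+z. ennreal (nratio (\<sigma> i * z) s 0 s (y i)) \<partial>gauss (\<alpha> i * x i) (\<beta> i)) = ennreal (nratio (c i * x i) (S i) 0 s (y i))"
      using nn_integral_nratio_gauss[OF \<beta>_pos[of i] s, where \<sigma> = "\<sigma> i" and y = "y i" and a = "\<alpha> i * x i"] by simp
  qed
  also have "\<dots> = ennreal (M x y)"
    unfolding M_def by (intro prod_ennreal less_imp_le nratio_pos S_pos s)
  finally show ?thesis .
qed

sublocale bayes_model G P0 Q0 p q w "\<lambda>x y. w x * M x y"
proof -
  have 1: "(\<lambda>\<xi>. 1) \<in> borel_measurable G" by simp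
  interpret G: prob_space G by (intro prob_space_gauss_prod) simp
  interpret P0: prob_space P0 by (intro prob_space_gauss_prod e)
  interpret Q0: prob_space Q0 by (intro prob_space_gauss_prod s)
  show "bayes_model G P0 Q0 p q w (\<lambda>x y. w x * M x y)"
  proof
    show "(\<lambda>(\<xi>, x). p \<xi> x) \<in> borel_measurable (G \<Otimes>\<^sub>M P0)" "(\<lambda>(\<xi>, y). q \<xi> y) \<in> borel_measurable (G \<Otimes>\<^sub>M Q0)"
      "w \<in> borel_measurable P0" "(\<lambda>(x, y). w x * M x y) \<in> borel_measurable (P0 \<Otimes>\<^sub>M Q0)"
      by (simp_all add: case_prod_beta', measurable)
    show "(\<integral>\<^sup>+x. ennreal (p \<xi> x) \<partial>P0) = 1" "(\<integral>\<^sup>+y. ennreal (q \<xi> y) \<partial>Q0) = 1" for \<xi>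
      unfolding p_def q_def using e s by (auto intro!: nn_integral_prod_nratio)
    show "(\<integral>\<^sup>+\<xi>. ennreal (p \<xi> x) \<partial>G) = ennreal (w x)" for x
      using nn_integral_p[OF 1, of x] prob_space.emeasure_space_1[OF prob_post, of x] by simp
    show "(\<integral>\<^sup>+\<xi>. ennreal (p \<xi> x * q \<xi> y) \<partial>G) = ennreal (w x * M x y)" for x y
    proof -
      have "(\<integral>\<^sup>+\<xi>. ennreal (p \<xi> x * q \<xi> y) \<partial>G) = (\<integral>\<^sup>+\<xi>. ennreal (p \<xi> x) * ennreal (q \<xi> y) \<partial>G)"
        by (intro nn_integral_cong ennreal_mult' less_imp_le pos)
      also have "\<dots> = ennreal (w x) * ennreal (M x y)"
        by (subst nn_integral_p) (auto simp: nn_integral_q_post)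
      finally show ?thesis by (simp add: ennreal_mult' less_imp_le pos)
    qed
  qed (simp_all add: pos)
qed

abbreviation klsum :: "(nat \<Rightarrow> real) \<Rightarrow> (nat \<Rightarrow> real) \<Rightarrow> real" where
  "klsum \<xi> x \<equiv> (\<Sum>i<T. kl_gauss (\<sigma> i * \<xi> i) s (c i * x i) (S i))"

lemma divergence_to_predictive:
  "(\<integral>\<^sup>+y. ennreal (klf (q \<xi> y) (w x * M x y / w x)) \<partial>Q0) = ennreal (klsum \<xi> x)"
proof -
  have "w x * M x y / w x = M x y" for y using pos(3)[of x] by simp
  then show ?thesis
    unfolding q_def M_def using nn_integral_klf_gauss_prod[where n = T and ?s0.0 = "\<lambda>_. s" and ?s1.0 = "\<lambda>_. s" and ?s2.0 = S
        and ?m0.0 = "\<lambda>_. 0" and ?m1.0 = "\<lambda>i. \<sigma> i * \<xi> i" and ?m2.0 = "\<lambda>i. c i * x i"] s S_pos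
    by simp
qed

text \<open>Normals of common variance diverge by a multiple of the squared distance of their means.
  Inserting the posterior mean, for any \<open>x\<close>, separates the two draws into centred
  squares.\<close>

lemma divergence_le:
  "div_pair \<xi> \<xi>'
    \<le> ennreal (\<Sum>i<T. (\<sigma> i)\<^sup>2 / s\<^sup>2 * (\<xi> i - \<alpha> i * x i)\<^sup>2) + ennreal (\<Sum>i<T. (\<sigma> i)\<^sup>2 / s\<^sup>2 * (\<xi>' i - \<alpha> i * x i)\<^sup>2)"
proof -
  have "div_pair \<xi> \<xi>' = ennreal (\<Sum>i<T. kl_gauss (\<sigma> i * \<xi> i) s (\<sigma> i * \<xi>' i) s)"
    unfolding q_def using nn_integral_klf_gauss_prod[where n = T and ?s0.0 = "\<lambda>_. s" and ?s1.0 = "\<lambda>_. s" and ?s2.0 = "\<lambda>_. s"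
        and ?m0.0 = "\<lambda>_. 0" and ?m1.0 = "\<lambda>i. \<sigma> i * \<xi> i" and ?m2.0 = "\<lambda>i. \<sigma> i * \<xi>' i"] s by simp
  also have "\<dots> \<le> ennreal ((\<Sum>i<T. (\<sigma> i)\<^sup>2 / s\<^sup>2 * (\<xi> i - \<alpha> i * x i)\<^sup>2) + (\<Sum>i<T. (\<sigma> i)\<^sup>2 / s\<^sup>2 * (\<xi>' i - \<alpha> i * x i)\<^sup>2))"
    unfolding sum.distrib[symmetric]
  proof (intro ennreal_leI sum_mono)
    fix i
    have "0 \<le> ((\<xi> i - \<alpha> i * x i) + (\<xi>' i - \<alpha> i * x i))\<^sup>2" by simp
    then have "(\<xi> i - \<xi>' i)\<^sup>2 \<le> 2 * ((\<xi> i - \<alpha> i * x i)\<^sup>2 + (\<xi>' i - \<alpha> i * x i)\<^sup>2)"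
      by (simp add: power2_eq_square algebra_simps)
    then have "(\<sigma> i)\<^sup>2 / (2 * s\<^sup>2) * (\<xi> i - \<xi>' i)\<^sup>2 \<le> (\<sigma> i)\<^sup>2 / (2 * s\<^sup>2) * (2 * ((\<xi> i - \<alpha> i * x i)\<^sup>2 + (\<xi>' i - \<alpha> i * x i)\<^sup>2))"
      by (rule mult_left_mono) simp
    also have "\<dots> = (\<sigma> i)\<^sup>2 / s\<^sup>2 * (\<xi> i - \<alpha> i * x i)\<^sup>2 + (\<sigma> i)\<^sup>2 / s\<^sup>2 * (\<xi>' i - \<alpha> i * x i)\<^sup>2"
      by (simp add: distrib_left)
    also have "(\<sigma> i)\<^sup>2 / (2 * s\<^sup>2) * (\<xi> i - \<xi>' i)\<^sup>2 = kl_gauss (\<sigma> i * \<xi> i) s (\<sigma> i * \<xi>' i) s"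
      using s by (simp add: kl_gauss_def add_divide_distrib right_diff_distrib[symmetric] power_mult_distrib)
    finally show "kl_gauss (\<sigma> i * \<xi> i) s (\<sigma> i * \<xi>' i) s \<le> (\<sigma> i)\<^sup>2 / s\<^sup>2 * (\<xi> i - \<alpha> i * x i)\<^sup>2 + (\<sigma> i)\<^sup>2 / s\<^sup>2 * (\<xi>' i - \<alpha> i * x i)\<^sup>2" .
  qed
  also have "\<dots> = ennreal (\<Sum>i<T. (\<sigma> i)\<^sup>2 / s\<^sup>2 * (\<xi> i - \<alpha> i * x i)\<^sup>2) + ennreal (\<Sum>i<T. (\<sigma> i)\<^sup>2 / s\<^sup>2 * (\<xi>' i - \<alpha> i * x i)\<^sup>2)"
    by (intro ennreal_plus sum_nonneg) auto
  finally show ?thesis .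
qed

abbreviation Vs :: real where "Vs \<equiv> \<Sum>i<T. (\<sigma> i)\<^sup>2 / s\<^sup>2 * (\<beta> i)\<^sup>2"

lemma nn_integral_w: "(\<integral>\<^sup>+x. ennreal (w x) \<partial>P0) = 1"
  unfolding w_def using e r_pos by (intro nn_integral_prod_nratio)

text \<open>By \<open>divergence_le\<close> the first draw contributes at most its full spread
  \<open>Vs\<close> times the posterior mass of \<open>-A\<close>, and the second a second moment
  truncated to \<open>-A\<close>. Averaging over \<open>x\<close> turns posterior mass into prior
  mass.\<close>

lemma coupling_error_le:
  assumes A [measurable]: "A \<in> sets G" and \<mu>: "0 < \<mu>"
  shows "(\<integral>\<^sup>+x. coupling A x \<partial>P0)
    \<le> ennreal Vs * (emeasure G (-A) + (ennreal (3 * \<mu> / 2) + ennreal (1 / (2 * \<mu>)) * emeasure G (-A)))"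
proof -
  have cA [measurable]: "-A \<in> sets G" using sets.compl_sets[OF A] by (simp add: Compl_eq_Diff_UNIV)
  define Z where "Z x \<xi> = ennreal (\<Sum>i<T. (\<sigma> i)\<^sup>2 / s\<^sup>2 * (\<xi> i - \<alpha> i * x i)\<^sup>2)" for x \<xi>
  have Z_meas [measurable]: "Z x \<in> borel_measurable (gauss_prod m1 s1)" for x m1 s1
    unfolding Z_def[abs_def] by measurable
  define \<Phi> where "\<Phi> x = (\<integral>\<^sup>+\<xi>. ennreal (p \<xi> x) * indicator (-A) \<xi> \<partial>G)" for x
  have \<Phi>_meas [measurable]: "\<Phi> \<in> borel_measurable P0" unfolding \<Phi>_def[abs_def] by measurable
  have post_A [measurable]: "A \<in> sets (post x)" "-A \<in> sets (post x)" for x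
    using A cA by (simp_all add: sets_gauss_prod)
  have Zint: "(\<integral>\<^sup>+\<xi>. Z x \<xi> \<partial>post x) = ennreal Vs" for x
  proof -
    have "(\<integral>\<^sup>+\<xi>. Z x \<xi> \<partial>post x) = (\<integral>\<^sup>+\<xi>. (\<Sum>i<T. ennreal ((\<sigma> i)\<^sup>2 / s\<^sup>2) * ennreal ((\<xi> i - \<alpha> i * x i)\<^sup>2)) \<partial>post x)"
    proof (intro nn_integral_cong)
      fix \<xi>
      have "Z x \<xi> = (\<Sum>i<T. ennreal ((\<sigma> i)\<^sup>2 / s\<^sup>2 * (\<xi> i - \<alpha> i * x i)\<^sup>2))"
        unfolding Z_def by (rule sum_ennreal[symmetric]) simp
      also have "\<dots> = (\<Sum>i<T. ennreal ((\<sigma> i)\<^sup>2 / s\<^sup>2) * ennreal ((\<xi> i - \<alpha> i * x i)\<^sup>2))"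
        by (intro sum.cong refl ennreal_mult') simp
      finally show "Z x \<xi> = (\<Sum>i<T. ennreal ((\<sigma> i)\<^sup>2 / s\<^sup>2) * ennreal ((\<xi> i - \<alpha> i * x i)\<^sup>2))" .
    qed
    also have "\<dots> = (\<Sum>i<T. ennreal ((\<sigma> i)\<^sup>2 / s\<^sup>2) * (\<integral>\<^sup>+\<xi>. ennreal ((\<xi> i - \<alpha> i * x i)\<^sup>2) \<partial>post x))"
      by (simp add: nn_integral_sum nn_integral_cmult)
    also have "\<dots> = (\<Sum>i<T. ennreal ((\<sigma> i)\<^sup>2 / s\<^sup>2 * (\<beta> i)\<^sup>2))"
    proof (intro sum.cong refl)
      fix i
      have "(\<integral>\<^sup>+\<xi>. ennreal ((\<xi> i - \<alpha> i * x i)\<^sup>2) \<partial>post x) = ennreal ((\<beta> i)\<^sup>2)"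
        by (subst nn_integral_gauss_prod_component[OF \<beta>_pos, where f = "\<lambda>z. ennreal ((z - \<alpha> i * x i)\<^sup>2)"])
           (auto simp: nn_integral_gauss_moments(1)[OF \<beta>_pos])
      then have "ennreal ((\<sigma> i)\<^sup>2 / s\<^sup>2) * (\<integral>\<^sup>+\<xi>. ennreal ((\<xi> i - \<alpha> i * x i)\<^sup>2) \<partial>post x)
          = ennreal ((\<sigma> i)\<^sup>2 / s\<^sup>2) * ennreal ((\<beta> i)\<^sup>2)" by (simp only:)
      also have "\<dots> = ennreal ((\<sigma> i)\<^sup>2 / s\<^sup>2 * (\<beta> i)\<^sup>2)" by (intro ennreal_mult'[symmetric]) simp
      finally show "ennreal ((\<sigma> i)\<^sup>2 / s\<^sup>2) * (\<integral>\<^sup>+\<xi>. ennreal ((\<xi> i - \<alpha> i * x i)\<^sup>2) \<partial>post x)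
          = ennreal ((\<sigma> i)\<^sup>2 / s\<^sup>2 * (\<beta> i)\<^sup>2)" .
    qed
    also have "\<dots> = ennreal Vs" by (intro sum_ennreal) auto
    finally show ?thesis .
  qed
  have inner: "coupling A x
     \<le> ennreal Vs * (\<Phi> x + (ennreal (3 * \<mu> / 2) * ennreal (w x) + ennreal (1 / (2 * \<mu>)) * \<Phi> x))" for x
  proof -
    define \<rho> where "\<rho> = emeasure (post x) (-A)"
    define \<zeta> where "\<zeta> = (\<integral>\<^sup>+\<xi>\<in>-A. Z x \<xi> \<partial>post x)"
    have \<Phi>: "\<Phi> x = ennreal (w x) * \<rho>"
      unfolding \<Phi>_def \<rho>_def by (subst nn_integral_p) auto
    have \<zeta>: "\<zeta> \<le> ennreal Vs * (ennreal (3 * \<mu> / 2) + ennreal (1 / (2 * \<mu>)) * \<rho>)"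
      unfolding \<zeta>_def \<rho>_def Z_def by (intro gauss_prod_truncated_moment \<beta>_pos post_A \<mu>) auto
    have in2: "(\<integral>\<^sup>+\<xi>'\<in>-A. ennreal (p \<xi> x * p \<xi>' x / w x) * div_pair \<xi> \<xi>' \<partial>G)
        \<le> ennreal (p \<xi> x) * (Z x \<xi> * \<rho> + \<zeta>)" for \<xi>
    proof -
      have "(\<integral>\<^sup>+\<xi>'\<in>-A. ennreal (p \<xi> x * p \<xi>' x / w x) * div_pair \<xi> \<xi>' \<partial>G)
          \<le> (\<integral>\<^sup>+\<xi>'. ennreal (p \<xi> x) * (ennreal (l x \<xi>') * ((Z x \<xi> + Z x \<xi>') * indicator (-A) \<xi>')) \<partial>G)"
      proof (intro nn_integral_mono)
        fix \<xi>'
        have "p \<xi> x * p \<xi>' x / w x = p \<xi> x * l x \<xi>'" using pos(3)[of x] by (simp add: p_eq[of \<xi>'])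
        then have "ennreal (p \<xi> x * p \<xi>' x / w x) = ennreal (p \<xi> x) * ennreal (l x \<xi>')"
          by (simp add: ennreal_mult' less_imp_le pos)
        moreover have "div_pair \<xi> \<xi>' \<le> Z x \<xi> + Z x \<xi>'"
          unfolding Z_def by (rule divergence_le)
        ultimately have "ennreal (p \<xi> x * p \<xi>' x / w x) * div_pair \<xi> \<xi>'
            \<le> ennreal (p \<xi> x) * ennreal (l x \<xi>') * (Z x \<xi> + Z x \<xi>')"
          by (simp add: mult_left_mono)
        then have "ennreal (p \<xi> x * p \<xi>' x / w x) * div_pair \<xi> \<xi>' * indicator (-A) \<xi>'
            \<le> ennreal (p \<xi> x) * ennreal (l x \<xi>') * (Z x \<xi> + Z x \<xi>') * indicator (-A) \<xi>'"
          by (rule mult_right_mono) simp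
        then show "ennreal (p \<xi> x * p \<xi>' x / w x) * div_pair \<xi> \<xi>' * indicator (-A) \<xi>'
            \<le> ennreal (p \<xi> x) * (ennreal (l x \<xi>') * ((Z x \<xi> + Z x \<xi>') * indicator (-A) \<xi>'))"
          by (simp only: mult.assoc)
      qed
      also have "\<dots> = ennreal (p \<xi> x) * (\<integral>\<^sup>+\<xi>'. (Z x \<xi> + Z x \<xi>') * indicator (-A) \<xi>' \<partial>post x)"
        unfolding post_eq by (subst nn_integral_cmult, measurable, subst nn_integral_density) auto
      also have "(\<integral>\<^sup>+\<xi>'. (Z x \<xi> + Z x \<xi>') * indicator (-A) \<xi>' \<partial>post x) = Z x \<xi> * \<rho> + \<zeta>"
        unfolding \<rho>_def \<zeta>_def by (simp add: distrib_right nn_integral_add nn_integral_cmult)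
      finally show ?thesis .
    qed
    \<comment> \<open>Dropping the restriction of \<open>\<xi>\<close> to \<open>A\<close> only
      increases the bound and leaves an integral over the whole posterior.\<close>
    have "coupling A x
      \<le> (\<integral>\<^sup>+\<xi>. ennreal (p \<xi> x) * (Z x \<xi> * \<rho> + \<zeta>) \<partial>G)"
    proof (intro nn_integral_mono)
      fix \<xi>
      show "(\<integral>\<^sup>+\<xi>'\<in>-A. ennreal (p \<xi> x * p \<xi>' x / w x) * div_pair \<xi> \<xi>' \<partial>G) * indicator A \<xi>
         \<le> ennreal (p \<xi> x) * (Z x \<xi> * \<rho> + \<zeta>)"
        using in2[of \<xi>] by (auto simp: indicator_def)
    qed
    also have "\<dots> = ennreal (w x) * (ennreal Vs * \<rho> + \<zeta>)"
    proof -
      have "(\<integral>\<^sup>+\<xi>. Z x \<xi> * \<rho> + \<zeta> \<partial>post x) = ennreal Vs * \<rho> + \<zeta>"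
        using prob_space.emeasure_space_1[OF prob_post[of x]] Zint[of x]
        by (simp add: nn_integral_add nn_integral_multc)
      then show ?thesis by (subst nn_integral_p) auto
    qed
    also have "\<dots> \<le> ennreal (w x) * (ennreal Vs * \<rho> + ennreal Vs * (ennreal (3 * \<mu> / 2) + ennreal (1 / (2 * \<mu>)) * \<rho>))"
      using \<zeta> by (intro mult_left_mono add_left_mono) auto
    also have "\<dots> = ennreal Vs * (\<Phi> x + (ennreal (3 * \<mu> / 2) * ennreal (w x) + ennreal (1 / (2 * \<mu>)) * \<Phi> x))"
      unfolding \<Phi> by (simp only: distrib_left distrib_right ac_simps)
    finally show ?thesis .
  qed
  have \<Phi>_int: "(\<integral>\<^sup>+x. \<Phi> x \<partial>P0) = emeasure G (-A)"
  proof -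
    have "(\<integral>\<^sup>+x. \<Phi> x \<partial>P0) = (\<integral>\<^sup>+\<xi>. (\<integral>\<^sup>+x. ennreal (p \<xi> x) * indicator (-A) \<xi> \<partial>P0) \<partial>G)"
      unfolding \<Phi>_def
      by (rule GP.Fubini') measurable
    also have "\<dots> = (\<integral>\<^sup>+\<xi>. indicator (-A) \<xi> \<partial>G)"
      by (intro nn_integral_cong, subst nn_integral_multc) (auto simp: p_int)
    finally show ?thesis by simp
  qed
  have "(\<integral>\<^sup>+x. coupling A x \<partial>P0)
    \<le> (\<integral>\<^sup>+x. ennreal Vs * (\<Phi> x + (ennreal (3 * \<mu> / 2) * ennreal (w x) + ennreal (1 / (2 * \<mu>)) * \<Phi> x)) \<partial>P0)"
    by (intro nn_integral_mono inner)
  also have "\<dots> = ennreal Vs * (emeasure G (-A) + (ennreal (3 * \<mu> / 2) + ennreal (1 / (2 * \<mu>)) * emeasure G (-A)))"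
    by (simp add: nn_integral_cmult nn_integral_add \<Phi>_int nn_integral_w)
  finally show ?thesis .
qed

abbreviation crisk :: "nat \<Rightarrow> real \<Rightarrow> real" where
  "crisk i \<equiv> coord_risk (v2_obs e) (v2_joint e s) ((\<sigma> i)\<^sup>2)"
abbreviation cgain :: "nat \<Rightarrow> real" where "cgain i \<equiv> gain (v2_obs e) (v2_joint e s) ((\<sigma> i)\<^sup>2)"
abbreviation cgain' :: "nat \<Rightarrow> real" where "cgain' i \<equiv> gain' (v2_obs e) (v2_joint e s) ((\<sigma> i)\<^sup>2)"

definition bayes_risk :: real where
  "bayes_risk = (\<Sum>i<T. cgain i)"

definition pointwise_risk :: "(nat \<Rightarrow> real) \<Rightarrow> real" where
  "pointwise_risk \<xi> = (\<Sum>i<T. crisk i (\<sigma> i * \<xi> i))"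

lemmas uv = v2_facts[OF e s]

text \<open>At \<open>z = 0\<close> the value is the gain minus
  \<open>(\<sigma> i)^2 * gain'\<close>, nonnegative by concavity; the same inequality bounds the
  slope in \<open>z^2\<close> by the gain.\<close>

lemma coord_risk_bounds:
  fixes z :: real and i :: nat
  defines "g \<equiv> cgain i"
  shows "0 \<le> crisk i (\<sigma> i * z)"
    "crisk i (\<sigma> i * z) \<le> g + g * z\<^sup>2"
proof -
  define g' where "g' = cgain' i"
  have g': "0 < g'" "(\<sigma> i)\<^sup>2 * g' \<le> g" unfolding g'_def g_def using uv by (auto intro: gain'_pos gain_ge)
  have eq: "crisk i (\<sigma> i * z) = g - (\<sigma> i)\<^sup>2 * g' + (\<sigma> i)\<^sup>2 * g' * z\<^sup>2"
    by (simp add: coord_risk_def g_def g'_def power_mult_distrib algebra_simps)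
  have n: "0 \<le> (\<sigma> i)\<^sup>2 * g'" using g' by simp
  show "0 \<le> crisk i (\<sigma> i * z)"
    unfolding eq using g' n by (intro add_nonneg_nonneg mult_nonneg_nonneg) auto
  have "(\<sigma> i)\<^sup>2 * g' * z\<^sup>2 \<le> g * z\<^sup>2" using g' by (intro mult_right_mono) auto
  then show "crisk i (\<sigma> i * z) \<le> g + g * z\<^sup>2"
    unfolding eq using n by simp
qed

lemma risk_to_predictive:
  "(\<integral>\<^sup>+x. ennreal (p \<xi> x) * ennreal (klsum \<xi> x) \<partial>P0) = ennreal (pointwise_risk \<xi>)"
proof -
  have "(\<integral>\<^sup>+x. ennreal (p \<xi> x) * ennreal (klsum \<xi> x) \<partial>P0)
     = (\<integral>\<^sup>+x. ennreal (klsum \<xi> x) \<partial>P_obs e (\<theta> \<xi>))"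
    unfolding P_obs_eq kl_gauss_def by (subst nn_integral_density) auto
  also have "\<dots> = ennreal (\<integral>x. klsum \<xi> x \<partial>P_obs e (\<theta> \<xi>))"
  proof (rule nn_integral_eq_integral)
    show "AE x in P_obs e (\<theta> \<xi>). 0 \<le> klsum \<xi> x"
      by (intro AE_I2 sum_nonneg kl_gauss_nonneg s S_pos)
    show "integrable (P_obs e (\<theta> \<xi>)) (\<lambda>x. klsum \<xi> x)"
      unfolding P_obs_def
      by (intro Bochner_Integration.integrable_sum integral_gauss_prod_component(1)[where f = "\<lambda>x. kl_gauss (\<sigma> i * \<xi> i) s (c i * x) (S i)" for i] e)
         (use integral_kl_gauss(1)[OF e s] in \<open>auto simp: \<theta>_def\<close>)
  qed
  also have "(\<integral>x. klsum \<xi> x \<partial>P_obs e (\<theta> \<xi>)) = pointwise_risk \<xi>"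
  proof -
    have i: "integrable (gauss (\<theta> \<xi> i) e) (\<lambda>x. kl_gauss (\<sigma> i * \<xi> i) s (c i * x) (S i))"
       "(\<integral>x. kl_gauss (\<sigma> i * \<xi> i) s (c i * x) (S i) \<partial>gauss (\<theta> \<xi> i) e) = crisk i (\<sigma> i * \<xi> i)" for i
      using integral_kl_gauss[OF e s, of "(\<sigma> i)\<^sup>2" "\<sigma> i * \<xi> i"] by (simp_all add: \<theta>_def)
    show ?thesis
      unfolding P_obs_def pointwise_risk_def i(2)[symmetric]
      using integral_gauss_prod_component[where m = "\<theta> \<xi>" and s = "\<lambda>_. e", OF e i(1)]
      by (subst Bochner_Integration.integral_sum) auto
  qed
  finally show ?thesis .
qed

lemma pointwise_risk_meas [measurable]: "pointwise_risk \<in> borel_measurable (gauss_prod m1 s1)"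
  unfolding pointwise_risk_def[abs_def] coord_risk_def by measurable

lemma nn_integral_pointwise_risk: "(\<integral>\<^sup>+\<xi>. ennreal (pointwise_risk \<xi>) \<partial>G) = ennreal bayes_risk"
proof -
  note m2 = gauss_second_moment[of 1 0 0, simplified]
  have cr: "crisk i (\<sigma> i * z)
     = cgain i + cgain' i * (\<sigma> i)\<^sup>2 * (z\<^sup>2 - 1)" for i z
    by (simp add: coord_risk_def power_mult_distrib algebra_simps)
  interpret g: prob_space "gauss 0 1" by (rule prob_space_gauss) simp
  have g1: "g.prob UNIV = 1" using g.prob_space by simp
  have i: "integrable (gauss 0 1) (\<lambda>z. crisk i (\<sigma> i * z))"
    "(\<integral>z. crisk i (\<sigma> i * z) \<partial>gauss 0 1) = cgain i" for i
    unfolding cr using m2 g1 by auto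
  have "(\<integral>\<^sup>+\<xi>. ennreal (pointwise_risk \<xi>) \<partial>G) = ennreal (\<integral>\<xi>. pointwise_risk \<xi> \<partial>G)"
    unfolding pointwise_risk_def
    using integral_gauss_prod_component(1)[where m = "\<lambda>_. 0" and s = "\<lambda>_. 1", OF _ i(1)] coord_risk_bounds(1)
    by (intro nn_integral_eq_integral) (auto intro!: sum_nonneg)
  also have "(\<integral>\<xi>. pointwise_risk \<xi> \<partial>G) = bayes_risk"
    unfolding pointwise_risk_def bayes_risk_def i(2)[symmetric]
    using integral_gauss_prod_component[where m = "\<lambda>_. 0" and s = "\<lambda>_. 1", OF _ i(1)]
    by (subst Bochner_Integration.integral_sum) auto
  finally show ?thesis .
qed

lemma bayes_risk_nonneg: "0 \<le> bayes_risk"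
  unfolding bayes_risk_def using uv by (intro sum_nonneg gain_nonneg) auto

text \<open>Each coordinate risk is at most its gain times \<open>1 + (\<xi> i)^2\<close>, so the
  truncated moment bound shows that a small set carries little of the Bayes risk.\<close>

lemma outside_risk_le:
  assumes E [measurable]: "E \<in> sets G" and \<mu>: "0 < \<mu>"
  shows "(\<integral>\<^sup>+\<xi>\<in>E. ennreal (pointwise_risk \<xi>) \<partial>G)
    \<le> ennreal bayes_risk * (emeasure G E + (ennreal (3 * \<mu> / 2) + ennreal (1 / (2 * \<mu>)) * emeasure G E))"
proof -
  let ?g = "\<lambda>i. cgain i"
  have g0: "0 \<le> ?g i" for i using uv by (intro gain_nonneg) auto
  have "(\<integral>\<^sup>+\<xi>\<in>E. ennreal (pointwise_risk \<xi>) \<partial>G)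
     \<le> (\<integral>\<^sup>+\<xi>. ennreal bayes_risk * indicator E \<xi> + ennreal (\<Sum>i<T. ?g i * (\<xi> i - 0)\<^sup>2) * indicator E \<xi> \<partial>G)"
  proof (intro nn_integral_mono)
    fix \<xi>
    have "pointwise_risk \<xi> \<le> bayes_risk + (\<Sum>i<T. ?g i * (\<xi> i - 0)\<^sup>2)"
      unfolding pointwise_risk_def bayes_risk_def sum.distrib[symmetric]
      using coord_risk_bounds(2) by (intro sum_mono) simp
    then have "ennreal (pointwise_risk \<xi>) \<le> ennreal (bayes_risk + (\<Sum>i<T. ?g i * (\<xi> i - 0)\<^sup>2))"
      by (rule ennreal_leI)
    also have "\<dots> = ennreal bayes_risk + ennreal (\<Sum>i<T. ?g i * (\<xi> i - 0)\<^sup>2)"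
      using bayes_risk_nonneg g0 by (intro ennreal_plus sum_nonneg mult_nonneg_nonneg) auto
    finally show "ennreal (pointwise_risk \<xi>) * indicator E \<xi> \<le> ennreal bayes_risk * indicator E \<xi> + ennreal (\<Sum>i<T. ?g i * (\<xi> i - 0)\<^sup>2) * indicator E \<xi>"
      by (auto simp: indicator_def)
  qed
  also have "\<dots> = ennreal bayes_risk * emeasure G E + (\<integral>\<^sup>+\<xi>\<in>E. ennreal (\<Sum>i<T. ?g i * (\<xi> i - 0)\<^sup>2) \<partial>G)"
    by (subst nn_integral_add) (auto simp: nn_integral_cmult)
  also have "(\<integral>\<^sup>+\<xi>\<in>E. ennreal (\<Sum>i<T. ?g i * (\<xi> i - 0)\<^sup>2) \<partial>G)
      \<le> ennreal (\<Sum>i<T. ?g i * 1\<^sup>2) * (ennreal (3 * \<mu> / 2) + ennreal (1 / (2 * \<mu>)) * emeasure G E)"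
    using g0 \<mu> by (intro gauss_prod_truncated_moment[where m = "\<lambda>_. 0" and s = "\<lambda>_. 1"]) auto
  finally show ?thesis by (simp add: bayes_risk_def distrib_left)
qed

text \<open>The Bayes risk is split at \<open>A\<close>. With \<open>\<mu>\<close> of the order of
  the square root of the excluded mass, the terms \<open>3 * \<mu> / 2\<close> and mass over
  \<open>2 * \<mu>\<close> of the truncated moments balance.\<close>

theorem risk_lower_bound:
  assumes Qh: "Qh \<in> pred_dists" and A [measurable]: "A \<in> sets G"
    and R: "\<And>\<xi>. \<xi> \<in> A \<Longrightarrow> risk e s (\<theta> \<xi>) Qh \<le> R"
    and \<mu>: "0 < \<mu>" "\<mu> \<le> 1" "emeasure G (-A) \<le> ennreal (\<mu>\<^sup>2)"
  shows "ennreal bayes_risk \<le> R + ennreal (3 * \<mu> * (bayes_risk + Vs))"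
proof -
  have cA [measurable]: "-A \<in> sets G" using sets.compl_sets[OF A] by (simp add: Compl_eq_Diff_UNIV)
  have "prob_algebra Q0 = prob_algebra Rinf"
    unfolding prob_algebra_def using subprob_algebra_cong[OF sets_gauss_prod] by simp
  then have Qh': "Qh \<in> P0 \<rightarrow>\<^sub>M prob_algebra Q0"
    using Qh by (simp add: pred_dists_def measurable_cong_sets[OF sets_gauss_prod refl])
  define X where "X = emeasure G (-A) + (ennreal (3 * \<mu> / 2) + ennreal (1 / (2 * \<mu>)) * emeasure G (-A))"
  \<comment> \<open>The parts add up to \<open>\<mu>^2 + 2 * \<mu>\<close>, which is at most
    \<open>3 * \<mu>\<close> as \<open>\<mu> \<le> 1\<close>.\<close>
  have X: "X \<le> ennreal (3 * \<mu>)"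
  proof -
    have "X \<le> ennreal (\<mu>\<^sup>2) + (ennreal (3 * \<mu> / 2) + ennreal (1 / (2 * \<mu>)) * ennreal (\<mu>\<^sup>2))"
      unfolding X_def using \<mu>(3) by (intro add_mono mult_left_mono order_refl) auto
    also have "ennreal (1 / (2 * \<mu>)) * ennreal (\<mu>\<^sup>2) = ennreal (\<mu> / 2)"
      using \<mu> by (subst ennreal_mult[symmetric]) (auto simp: power2_eq_square)
    also have "ennreal (\<mu>\<^sup>2) + (ennreal (3 * \<mu> / 2) + ennreal (\<mu> / 2)) = ennreal (\<mu>\<^sup>2 + (3 * \<mu> / 2 + \<mu> / 2))"
      using \<mu> by (subst ennreal_plus[symmetric], simp, simp)+ simp
    also have "\<dots> \<le> ennreal (3 * \<mu>)"
    proof (rule ennreal_leI)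
      have "\<mu>\<^sup>2 \<le> \<mu>" using \<mu> by (simp add: power2_eq_square mult_left_le_one_le)
      then show "\<mu>\<^sup>2 + (3 * \<mu> / 2 + \<mu> / 2) \<le> 3 * \<mu>" by simp
    qed
    finally show ?thesis .
  qed
  have Vs0: "0 \<le> Vs" by (intro sum_nonneg) auto
  have main: "(\<integral>\<^sup>+\<xi>\<in>A. ennreal (pointwise_risk \<xi>) \<partial>G) \<le> R * emeasure G A + ennreal Vs * X"
  proof -
    have "(\<integral>\<^sup>+\<xi>\<in>A. ennreal (pointwise_risk \<xi>) \<partial>G)
      = (\<integral>\<^sup>+\<xi>\<in>A. (\<integral>\<^sup>+x. ennreal (p \<xi> x) * (\<integral>\<^sup>+y. ennreal (klf (q \<xi> y) (w x * M x y / w x)) \<partial>Q0) \<partial>P0) \<partial>G)"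
      unfolding divergence_to_predictive risk_to_predictive ..
    also have "\<dots> \<le> R * emeasure G A + (\<integral>\<^sup>+x. coupling A x \<partial>P0)"
      by (rule bayes_lower_bound[OF A Qh']) (use R in \<open>auto simp: risk_def P_obs_eq Q_fut_eq\<close>)
    also have "\<dots> \<le> R * emeasure G A + ennreal Vs * X"
      unfolding X_def by (intro add_left_mono coupling_error_le A \<mu>)
    finally show ?thesis .
  qed
  have "ennreal bayes_risk = (\<integral>\<^sup>+\<xi>\<in>A. ennreal (pointwise_risk \<xi>) \<partial>G) + (\<integral>\<^sup>+\<xi>\<in>-A. ennreal (pointwise_risk \<xi>) \<partial>G)"
    unfolding nn_integral_pointwise_risk[symmetric]
    by (subst nn_integral_add[symmetric]) (auto intro!: nn_integral_cong simp: indicator_def)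
  also have "\<dots> \<le> (R * emeasure G A + ennreal Vs * X) + ennreal bayes_risk * X"
    unfolding X_def by (intro add_mono main[unfolded X_def] outside_risk_le cA \<mu>)
  also have "\<dots> \<le> (R * 1 + ennreal Vs * ennreal (3 * \<mu>)) + ennreal bayes_risk * ennreal (3 * \<mu>)"
    using X by (intro add_mono mult_left_mono G.emeasure_le_1) auto
  also have "\<dots> = R + ennreal (3 * \<mu> * (bayes_risk + Vs))"
  proof -
    have "ennreal Vs * ennreal (3 * \<mu>) + ennreal bayes_risk * ennreal (3 * \<mu>) = ennreal (3 * \<mu> * (bayes_risk + Vs))"
      using Vs0 bayes_risk_nonneg \<mu> by (subst (1 2) ennreal_mult[symmetric], simp_all, subst ennreal_plus[symmetric], simp_all add: algebra_simps)
    then show ?thesis by (simp add: add.assoc)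
  qed
  finally show ?thesis .
qed

end

section \<open>Asymptotic minimaxity\<close>

text \<open>Chebyshev's inequality: the variables \<open>(\<xi> i)^2 - 1\<close> are uncorrelated
  with variance \<open>3 - 1 = 2\<close>.\<close>

lemma gauss_chi_square_tail:
  assumes b: "\<And>i. 0 \<le> b i" and d: "0 < d"
  shows "emeasure (gauss_prod (\<lambda>_. 0) (\<lambda>_. 1)) {\<xi>. (\<Sum>i<n. b i) + d < (\<Sum>i<n. b i * (\<xi> i)\<^sup>2)}
    \<le> ennreal (2 * (\<Sum>i<n. (b i)\<^sup>2) / d\<^sup>2)"
proof -
  let ?G = "gauss_prod (\<lambda>_. 0) (\<lambda>_. 1)"
  interpret G: prob_space ?G by (intro prob_space_gauss_prod) simp
  have G1: "measure ?G UNIV = 1" using G.prob_space by simp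
  have m2: "integrable ?G (\<lambda>\<xi>. (\<xi> i)\<^sup>2)" "(\<integral>\<xi>. (\<xi> i)\<^sup>2 \<partial>?G) = 1" for i
    using integral_gauss_prod_component[where m = "\<lambda>_. 0" and s = "\<lambda>_. 1" and f = "\<lambda>z. z\<^sup>2" and i = i]
      gauss_second_moment[of 1 0 0] by auto
  have m4: "integrable ?G (\<lambda>\<xi>. (\<xi> i) ^ 4)" "(\<integral>\<xi>. (\<xi> i) ^ 4 \<partial>?G) = 3" for i
    using integral_gauss_prod_component[where m = "\<lambda>_. 0" and s = "\<lambda>_. 1" and f = "\<lambda>z. z ^ 4" and i = i]
      gauss_fourth_moment[of 1 0] by auto
  have m22: "integrable ?G (\<lambda>\<xi>. (\<xi> i)\<^sup>2 * (\<xi> j)\<^sup>2)" "(\<integral>\<xi>. (\<xi> i)\<^sup>2 * (\<xi> j)\<^sup>2 \<partial>?G) = 1" if "i \<noteq> j" for i j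
  proof -
    have "(\<integral>\<^sup>+\<xi>. ennreal ((\<xi> i)\<^sup>2 * (\<xi> j)\<^sup>2) \<partial>?G) = (\<integral>\<^sup>+\<xi>. (\<Prod>k\<in>{i, j}. ennreal ((\<xi> k)\<^sup>2)) \<partial>?G)"
      using that by (intro nn_integral_cong) (simp add: ennreal_mult)
    also have "\<dots> = (\<Prod>k\<in>{i, j}. \<integral>\<^sup>+z. ennreal (z\<^sup>2) \<partial>gauss 0 1)"
      unfolding gauss_prod_def
      by (intro nn_integral_PiM_prod[where M = "\<lambda>_. gauss 0 1" and f = "\<lambda>_ z. ennreal (z\<^sup>2)"] prob_space_gauss) auto
    also have "\<dots> = 1" using that nn_integral_gauss_moments(1)[of 1 0] by simp
    finally have *: "(\<integral>\<^sup>+\<xi>. ennreal ((\<xi> i)\<^sup>2 * (\<xi> j)\<^sup>2) \<partial>?G) = 1" .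
    show "integrable ?G (\<lambda>\<xi>. (\<xi> i)\<^sup>2 * (\<xi> j)\<^sup>2)"
      using * by (intro integrableI_nonneg) auto
    show "(\<integral>\<xi>. (\<xi> i)\<^sup>2 * (\<xi> j)\<^sup>2 \<partial>?G) = 1"
      by (subst integral_eq_nn_integral) (auto simp: *)
  qed
  have cov: "integrable ?G (\<lambda>\<xi>. ((\<xi> i)\<^sup>2 - 1) * ((\<xi> j)\<^sup>2 - 1))"
    "(\<integral>\<xi>. ((\<xi> i)\<^sup>2 - 1) * ((\<xi> j)\<^sup>2 - 1) \<partial>?G) = (if i = j then 2 else 0)" for i j
  proof -
    have e: "((\<xi> i)\<^sup>2 - 1) * ((\<xi> j)\<^sup>2 - 1) = (\<xi> i)\<^sup>2 * (\<xi> j)\<^sup>2 - (\<xi> i)\<^sup>2 - (\<xi> j)\<^sup>2 + (1::real)" for \<xi> :: "nat \<Rightarrow> real"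
      by (simp add: algebra_simps)
    have i: "integrable ?G (\<lambda>\<xi>. (\<xi> i)\<^sup>2 * (\<xi> j)\<^sup>2)" "(\<integral>\<xi>. (\<xi> i)\<^sup>2 * (\<xi> j)\<^sup>2 \<partial>?G) = (if i = j then 3 else 1)"
      using m4[of i] m22[of i j] by (cases "i = j"; simp add: power_add[symmetric])+
    show "integrable ?G (\<lambda>\<xi>. ((\<xi> i)\<^sup>2 - 1) * ((\<xi> j)\<^sup>2 - 1))"
      unfolding e using i m2 by auto
    show "(\<integral>\<xi>. ((\<xi> i)\<^sup>2 - 1) * ((\<xi> j)\<^sup>2 - 1) \<partial>?G) = (if i = j then 2 else 0)"
      unfolding e using i m2 G1 by auto
  qed
  define X where "X \<xi> = (\<Sum>i<n. b i * ((\<xi> i)\<^sup>2 - 1))" for \<xi> :: "nat \<Rightarrow> real"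
  have X2: "(X \<xi>)\<^sup>2 = (\<Sum>i<n. \<Sum>j<n. b i * b j * (((\<xi> i)\<^sup>2 - 1) * ((\<xi> j)\<^sup>2 - 1)))" for \<xi>
    unfolding X_def power2_eq_square sum_product by (intro sum.cong refl) simp
  have intX: "integrable ?G (\<lambda>\<xi>. (X \<xi>)\<^sup>2)"
    unfolding X2 by (intro Bochner_Integration.integrable_sum integrable_mult_right cov)
  have "(\<integral>\<xi>. (X \<xi>)\<^sup>2 \<partial>?G) = (\<Sum>i<n. \<Sum>j<n. b i * b j * (if i = j then 2 else 0))"
    unfolding X2 using cov
    by (subst Bochner_Integration.integral_sum, simp, intro sum.cong refl,
        subst Bochner_Integration.integral_sum, simp, intro sum.cong refl, simp)
  also have "\<dots> = 2 * (\<Sum>i<n. (b i)\<^sup>2)"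
    by (simp add: sum_distrib_left power2_eq_square if_distrib[where f = "\<lambda>z. _ * z"] mult.commute cong: if_cong)
  finally have varX: "(\<integral>\<xi>. (X \<xi>)\<^sup>2 \<partial>?G) = 2 * (\<Sum>i<n. (b i)\<^sup>2)" .
  let ?E = "{\<xi>. (\<Sum>i<n. b i) + d < (\<Sum>i<n. b i * (\<xi> i)\<^sup>2)}"
  have E: "?E \<in> sets ?G"
  proof -
    have "{\<xi> \<in> space ?G. (\<Sum>i<n. b i) + d < (\<Sum>i<n. b i * (\<xi> i)\<^sup>2)} \<in> sets ?G" by measurable
    then show ?thesis by simp
  qed
  have "emeasure ?G ?E = (\<integral>\<^sup>+\<xi>. indicator ?E \<xi> \<partial>?G)" using E by simp
  also have "\<dots> \<le> (\<integral>\<^sup>+\<xi>. ennreal ((X \<xi>)\<^sup>2 / d\<^sup>2) \<partial>?G)"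
  proof (intro nn_integral_mono)
    fix \<xi>
    show "indicator ?E \<xi> \<le> ennreal ((X \<xi>)\<^sup>2 / d\<^sup>2)"
    proof (cases "\<xi> \<in> ?E")
      case True
      then have "d < X \<xi>" by (simp add: X_def right_diff_distrib sum_subtractf)
      then have "d\<^sup>2 \<le> (X \<xi>)\<^sup>2" using d by (intro power_mono) auto
      then have "1 \<le> (X \<xi>)\<^sup>2 / d\<^sup>2" using d by simp
      then show ?thesis using True by simp
    qed simp
  qed
  also have "\<dots> = ennreal (\<integral>\<xi>. (X \<xi>)\<^sup>2 / d\<^sup>2 \<partial>?G)"
    using intX by (intro nn_integral_eq_integral) auto
  also have "(\<integral>\<xi>. (X \<xi>)\<^sup>2 / d\<^sup>2 \<partial>?G) = 2 * (\<Sum>i<n. (b i)\<^sup>2) / d\<^sup>2"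
    by (simp add: varX)
  finally show ?thesis .
qed

section \<open>The minimax lower bound at fixed noise levels\<close>

context ellipsoid
begin

text \<open>Shrinking the variances costs at most the fraction \<open>\<delta>\<close> of
  \<open>D\<close>. The conditioning error is \<open>3 * \<mu>\<close> times the Bayes risk, at most
  \<open>D\<close>, plus \<open>Vs\<close>, at most \<open>2 * (1 + C) * D\<close>; this is the
  origin of \<open>3 + 2 * C\<close>.\<close>

lemma minimax_risk_ge:
  assumes \<delta>: "0 < \<delta>" "\<delta> < 1" and \<mu>: "0 < \<mu>" "\<mu> \<le> 1" and C: "e\<^sup>2 \<le> C * s\<^sup>2"
    and tail: "2 * (\<Sum>i<T. ((a i)\<^sup>2 * t i)\<^sup>2) \<le> \<mu>\<^sup>2 * (\<delta> * B)\<^sup>2"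
  shows "ennreal ((1 - \<delta> - 3 * \<mu> * (3 + 2 * C)) * D) \<le> minimax_risk a B e s"
proof -
  define \<sigma> where "\<sigma> i = sqrt ((1 - \<delta>) * t i)" for i
  have \<sigma>2: "(\<sigma> i)\<^sup>2 = (1 - \<delta>) * t i" for i
    using \<delta> t_nonneg[of i] by (simp add: \<sigma>_def)
  interpret gp: gaussian_prior e s \<sigma> T
    by unfold_locales (auto simp: e s \<sigma>_def t_zero)
  have br: "(1 - \<delta>) * D \<le> gp.bayes_risk" "gp.bayes_risk \<le> D"
  proof -
    show "(1 - \<delta>) * D \<le> gp.bayes_risk"
      unfolding gp.bayes_risk_def D_def sum_distrib_left \<sigma>2
      using \<delta> t_nonneg by (intro sum_mono gain_scale[OF v_pos vu]) auto
    show "gp.bayes_risk \<le> D"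
      unfolding gp.bayes_risk_def D_def \<sigma>2
      using \<delta> t_nonneg by (intro sum_mono gain_mono[OF v_pos vu] mult_left_le_one_le mult_nonneg_nonneg) auto
  qed
  have C0: "0 \<le> C" using C e s by (smt (verit) mult_neg_pos zero_less_power)
  have ratio: "(u - v) / v = e\<^sup>2 / s\<^sup>2"
    using uv_diff v_pos by (simp add: v2_obs_def)
  have Vs: "gp.Vs \<le> 2 * (1 + C) * D"
  proof -
    have "gp.Vs \<le> (\<Sum>i<T. 2 * (1 + C) * gain u v ((\<sigma> i)\<^sup>2))"
    proof (intro sum_mono)
      fix i
      have "(\<sigma> i)\<^sup>2 / s\<^sup>2 * (gp.\<beta> i)\<^sup>2 = (u - v) / v * ((\<sigma> i)\<^sup>2 / (u + (\<sigma> i)\<^sup>2))"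
        unfolding ratio gp.\<beta>_def by (simp add: power_divide gp.r_sq v2_obs_def add.commute)
      also have "\<dots> \<le> 2 * (1 + C) * gain u v ((\<sigma> i)\<^sup>2)"
        using C s by (intro shrink_le_gain[OF v_pos vu]) (auto simp: ratio pos_divide_le_eq)
      finally show "(\<sigma> i)\<^sup>2 / s\<^sup>2 * (gp.\<beta> i)\<^sup>2 \<le> 2 * (1 + C) * gain u v ((\<sigma> i)\<^sup>2)" .
    qed
    also have "\<dots> = 2 * (1 + C) * gp.bayes_risk"
      by (simp add: gp.bayes_risk_def sum_distrib_left)
    also have "\<dots> \<le> 2 * (1 + C) * D" using br C0 by (intro mult_left_mono) auto
    finally show ?thesis .
  qed
  \<comment> \<open>The ellipsoid pulled back to \<open>\<xi>\<close>. Coordinates from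
    \<open>T\<close> on are zero, so its condition is a finite sum.\<close>
  define A where "A = {\<xi>. (\<Sum>i<T. (a i)\<^sup>2 * (gp.\<theta> \<xi> i)\<^sup>2) \<le> B}"
  have A: "A \<in> sets gp.G"
  proof -
    have "{\<xi> \<in> space gp.G. (\<Sum>i<T. (a i)\<^sup>2 * (gp.\<theta> \<xi> i)\<^sup>2) \<le> B} \<in> sets gp.G"
      unfolding gp.\<theta>_def by measurable
    then show ?thesis by (simp add: A_def)
  qed
  have sub: "gp.\<theta> \<xi> \<in> Theta a B" if "\<xi> \<in> A" for \<xi>
  proof -
    have z: "gp.\<theta> \<xi> i = 0" if "i \<notin> {..<T}" for i using that by (simp add: gp.\<theta>_def gp.\<sigma>_tail)
    have "summable (\<lambda>i. (gp.\<theta> \<xi> i)\<^sup>2)" "summable (\<lambda>i. (a i)\<^sup>2 * (gp.\<theta> \<xi> i)\<^sup>2)"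
      by (rule summable_finite[of "{..<T}"]; simp add: z)+
    moreover have "(\<Sum>i. (a i)\<^sup>2 * (gp.\<theta> \<xi> i)\<^sup>2) = (\<Sum>i<T. (a i)\<^sup>2 * (gp.\<theta> \<xi> i)\<^sup>2)"
      using z by (intro suminf_finite) auto
    ultimately show ?thesis using that by (simp add: Theta_def A_def)
  qed
  have mA: "emeasure gp.G (-A) \<le> ennreal (\<mu>\<^sup>2)"
  proof -
    let ?b = "\<lambda>i. (1 - \<delta>) * ((a i)\<^sup>2 * t i)"
    \<comment> \<open>Under the shrunk prior the quadratic form has mean
      \<open>(1 - \<delta>) * B\<close>, at distance \<open>\<delta> * B\<close> from the
      boundary.\<close>
    have sumb: "(\<Sum>i<T. ?b i) + \<delta> * B = B"
    proof -
      have "(\<Sum>i<T. ?b i) = (1 - \<delta>) * B" unfolding sum_distrib_left[symmetric] sum_t ..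
      then show ?thesis by (simp only: left_diff_distrib)
    qed
    have eq: "-A = {\<xi>. (\<Sum>i<T. ?b i) + \<delta> * B < (\<Sum>i<T. ?b i * (\<xi> i)\<^sup>2)}"
      unfolding sumb A_def gp.\<theta>_def by (auto simp: power_mult_distrib \<sigma>2 algebra_simps not_le)
    have "emeasure gp.G (-A) \<le> ennreal (2 * (\<Sum>i<T. (?b i)\<^sup>2) / (\<delta> * B)\<^sup>2)"
      unfolding eq using \<delta> B t_nonneg by (intro gauss_chi_square_tail) auto
    also have "\<dots> \<le> ennreal (\<mu>\<^sup>2)"
    proof (rule ennreal_leI)
      have "(\<Sum>i<T. (?b i)\<^sup>2) \<le> (\<Sum>i<T. ((a i)\<^sup>2 * t i)\<^sup>2)"
        using \<delta> t_nonneg by (intro sum_mono power_mono mult_left_le_one_le mult_nonneg_nonneg) auto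
      then have "2 * (\<Sum>i<T. (?b i)\<^sup>2) \<le> \<mu>\<^sup>2 * (\<delta> * B)\<^sup>2" using tail by linarith
      then show "2 * (\<Sum>i<T. (?b i)\<^sup>2) / (\<delta> * B)\<^sup>2 \<le> \<mu>\<^sup>2" using \<delta> B by (simp add: pos_divide_le_eq)
    qed
    finally show ?thesis .
  qed
  show ?thesis
    unfolding minimax_risk_def
  proof (rule INF_greatest)
    fix Qh assume Qh: "Qh \<in> pred_dists"
    define R where "R = (SUP \<theta>\<in>Theta a B. risk e s \<theta> Qh)"
    have "ennreal gp.bayes_risk \<le> R + ennreal (3 * \<mu> * (gp.bayes_risk + gp.Vs))"
      unfolding R_def by (intro gp.risk_lower_bound[OF Qh A _ \<mu> mA] SUP_upper sub)
    moreover have "3 * \<mu> * (gp.bayes_risk + gp.Vs) \<le> 3 * \<mu> * (3 + 2 * C) * D"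
    proof -
      have "gp.bayes_risk + gp.Vs \<le> (3 + 2 * C) * D" using br Vs by (simp add: algebra_simps)
      then have "3 * \<mu> * (gp.bayes_risk + gp.Vs) \<le> 3 * \<mu> * ((3 + 2 * C) * D)"
        using \<mu> by (intro mult_left_mono) auto
      then show ?thesis by (simp add: mult.assoc)
    qed
    ultimately have "ennreal ((1 - \<delta>) * D) \<le> R + ennreal (3 * \<mu> * (3 + 2 * C) * D)"
      using br(1) by (meson add_left_mono ennreal_leI order_trans)
    then have "ennreal ((1 - \<delta>) * D) - ennreal (3 * \<mu> * (3 + 2 * C) * D) \<le> R"
      by (simp add: ennreal_minus_le_iff add.commute)
    moreover have "0 \<le> 3 * \<mu> * (3 + 2 * C) * D" using \<mu> C0 D_pos by simp
    ultimately have "ennreal ((1 - \<delta>) * D - 3 * \<mu> * (3 + 2 * C) * D) \<le> R"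
      by (simp add: ennreal_minus)
    then show "ennreal ((1 - \<delta> - 3 * \<mu> * (3 + 2 * C)) * D) \<le> R"
      by (simp add: left_diff_distrib)
  qed
qed

section \<open>The profile of the optimal variances beyond the first \<open>d\<close>
  coordinates\<close>

lemma at_nonneg: "0 \<le> (a i)\<^sup>2 * t i"
  by (rule mult_nonneg_nonneg[OF zero_le_power2 t_nonneg])

lemma sum_at_le: "finite I \<Longrightarrow> (\<Sum>i\<in>I. (a i)\<^sup>2 * t i) \<le> B"
  using sum_le_suminf[OF sums_summable[OF lam(2)], of I] at_nonneg sums_unique[OF lam(2)] by simp

text \<open>The profile \<open>a\<^sub>i\<^sup>2 t\<^sub>i\<close> is unimodal: as \<open>lam a\<^sub>i\<^sup>2 t\<^sub>i\<close> is proportional to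
  \<open>t / ((u + t) (v + t))\<close>, it decreases once \<open>t\<^sub>i\<close> is below \<open>sqrt (u v)\<close>.\<close>
lemma at_antimono_tail:
  assumes "(t j)\<^sup>2 \<le> u * v" "j \<le> i"
  shows "(a i)\<^sup>2 * t i \<le> (a j)\<^sup>2 * t j"
proof (cases "t i = 0")
  case False
  then have i: "0 < t i" using t_nonneg[of i] by simp
  have ij: "t i \<le> t j" by (rule t_antimono[OF assms(2)])
  then have j: "0 < t j" using i by simp
  have "t i * t j \<le> t j * t j" using ij j by (intro mult_right_mono) auto
  \<comment> \<open>This product is the difference that appears on cross-multiplying
    \<open>t / ((u + t) * (v + t))\<close> at \<open>i\<close> and \<open>j\<close>.\<close>
  then have "0 \<le> (t j - t i) * (u * v - t i * t j)"
    using ij assms(1) by (intro mult_nonneg_nonneg) (auto simp: power2_eq_square)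
  then have "t i * ((u + t j) * (v + t j)) \<le> t j * ((u + t i) * (v + t i))"
    by (simp add: algebra_simps)
  then have "t i / ((u + t i) * (v + t i)) \<le> t j / ((u + t j) * (v + t j))"
    using i j u_pos v_pos by (simp add: divide_le_eq pos_le_divide_eq mult.commute)
  then have "(u - v) / 2 * (t i / ((u + t i) * (v + t i))) \<le> (u - v) / 2 * (t j / ((u + t j) * (v + t j)))"
    using vu by (intro mult_left_mono) auto
  then have "t i * gain' u v (t i) \<le> t j * gain' u v (t j)"
    by (simp add: gain'_def mult.commute)
  then have "lam * ((a i)\<^sup>2 * t i) \<le> lam * ((a j)\<^sup>2 * t j)"
    unfolding gain'_t_eq[OF i] gain'_t_eq[OF j] by (simp add: ac_simps)
  then show ?thesis using lam(1) by simp
qed (use at_nonneg in simp)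

text \<open>Each of the first \<open>d\<close> terms \<open>a^2 * t\<close> is at most
  \<open>\<eta>\<close>. If \<open>t (d - 1)\<close> exceeded \<open>k * e^2\<close>, monotonicity
  would make the first \<open>d\<close> variances sum to at least \<open>k / 2\<close>. But indices
  below \<open>N\<close> contribute less than \<open>k / 4\<close>, as \<open>\<eta>\<close> is
  small, and the others at most \<open>k / 4\<close>, as \<open>4 * B / k \<le> (a i)^2\<close>
  there and the budget is \<open>B\<close>. So the profile already decreases at
  \<open>d - 1\<close>.\<close>

lemma sum_at_sq_le:
  fixes N d :: nat
  assumes d: "d = nat \<lfloor>1 / e\<^sup>2\<rfloor>" and e1: "e\<^sup>2 \<le> 1"
    and k: "0 < k" "(k * e\<^sup>2)\<^sup>2 \<le> u * v"
    and N: "\<And>i. N \<le> i \<Longrightarrow> 4 * B / k \<le> (a i)\<^sup>2"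
    and \<eta>: "0 < \<eta>" "N * (\<eta> / (a 0)\<^sup>2) < k / 4"
    and sum: "(\<Sum>i<d. ((a i)\<^sup>2 * t i)\<^sup>2) \<le> \<eta>\<^sup>2"
  shows "(\<Sum>i<T. ((a i)\<^sup>2 * t i)\<^sup>2) \<le> \<eta>\<^sup>2 + \<eta> * B"
proof -
  have e2: "0 < e\<^sup>2" using e by simp
  define z where "z = 1 / e\<^sup>2"
  have "1 \<le> z" using e1 e2 by (simp add: z_def)
  then have z: "1 \<le> \<lfloor>z\<rfloor>" "z - 1 \<le> of_int \<lfloor>z\<rfloor>" by linarith+
  then have "real d = of_int \<lfloor>z\<rfloor>" "1 \<le> (of_int \<lfloor>z\<rfloor> :: real)" by (simp_all add: d z_def)
  \<comment> \<open>The average of the two lower bounds 1 and \<open>z - 1\<close> for the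
    floor.\<close>
  moreover from this z have "z / 2 \<le> real d" by linarith
  ultimately have d1: "1 \<le> d" "1 / (2 * e\<^sup>2) \<le> real d" by (simp_all add: z_def)
  have at_le: "(a i)\<^sup>2 * t i \<le> \<eta>" if "i < d" for i
  proof -
    have "((a i)\<^sup>2 * t i)\<^sup>2 \<le> (\<Sum>i<d. ((a i)\<^sup>2 * t i)\<^sup>2)" using that by (intro member_le_sum) auto
    then show ?thesis using sum \<eta>(1) by (meson order_trans less_imp_le power2_le_imp_le)
  qed
  have "(t (d - 1))\<^sup>2 \<le> u * v"
  proof (rule ccontr)
    assume "\<not> (t (d - 1))\<^sup>2 \<le> u * v"
    then have "(k * e\<^sup>2)\<^sup>2 < (t (d - 1))\<^sup>2" using k(2) by simp
    then have tk: "k * e\<^sup>2 < t (d - 1)" using t_nonneg by (rule power2_less_imp_less)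
    have "k / 2 = (1 / (2 * e\<^sup>2)) * (k * e\<^sup>2)" using e2 by simp
    also have "\<dots> \<le> real d * (k * e\<^sup>2)" using d1(2) k(1) e2 by (intro mult_right_mono) auto
    also have "\<dots> = (\<Sum>i<d. k * e\<^sup>2)" by simp
    also have "\<dots> \<le> (\<Sum>i<d. t i)"
    proof (intro sum_mono)
      fix i assume "i \<in> {..<d}"
      then have "t (d - 1) \<le> t i" by (intro t_antimono) auto
      then show "k * e\<^sup>2 \<le> t i" using tk by simp
    qed
    also have "\<dots> \<le> (\<Sum>i<d. (if i < N then \<eta> / (a 0)\<^sup>2 else 0) + k / (4 * B) * ((a i)\<^sup>2 * t i))"
    proof (intro sum_mono)
      fix i assume i: "i \<in> {..<d}"
      show "t i \<le> (if i < N then \<eta> / (a 0)\<^sup>2 else 0) + k / (4 * B) * ((a i)\<^sup>2 * t i)"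
      proof (cases "i < N")
        case True
        have "(a 0)\<^sup>2 * t i \<le> (a i)\<^sup>2 * t i" using a_sq_mono[of 0 i] t_nonneg[of i] by (intro mult_right_mono) auto
        also have "\<dots> \<le> \<eta>" using at_le i by simp
        finally have "t i \<le> \<eta> / (a 0)\<^sup>2" using a_sq_pos[of 0] by (simp add: pos_le_divide_eq mult.commute)
        moreover have "0 \<le> k / (4 * B) * ((a i)\<^sup>2 * t i)" using k(1) B by (intro mult_nonneg_nonneg[OF _ at_nonneg]) auto
        ultimately show ?thesis using True by simp
      next
        case False
        have "4 * B / k * t i \<le> (a i)\<^sup>2 * t i" using N[of i] False t_nonneg[of i] by (intro mult_right_mono) auto
        then have "k / (4 * B) * (4 * B / k * t i) \<le> k / (4 * B) * ((a i)\<^sup>2 * t i)"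
          using k(1) B by (intro mult_left_mono) auto
        then show ?thesis using False k(1) B by simp
      qed
    qed
    also have "\<dots> = (\<Sum>i<d. if i < N then \<eta> / (a 0)\<^sup>2 else 0) + k / (4 * B) * (\<Sum>i<d. (a i)\<^sup>2 * t i)"
      by (simp add: sum.distrib sum_distrib_left)
    also have "\<dots> \<le> N * (\<eta> / (a 0)\<^sup>2) + k / (4 * B) * B"
    proof (intro add_mono mult_left_mono sum_at_le)
      have "(\<Sum>i<d. if i < N then \<eta> / (a 0)\<^sup>2 else 0) = (\<Sum>i\<in>{..<d} \<inter> {..<N}. \<eta> / (a 0)\<^sup>2)"
        by (intro sum.mono_neutral_cong_right) auto
      also have "\<dots> \<le> (\<Sum>i<N. \<eta> / (a 0)\<^sup>2)" using \<eta>(1) by (intro sum_mono2) auto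
      finally show "(\<Sum>i<d. if i < N then \<eta> / (a 0)\<^sup>2 else 0) \<le> N * (\<eta> / (a 0)\<^sup>2)" by simp
    qed (use k(1) B in auto)
    also have "k / (4 * B) * B = k / 4" using B by simp
    also have "N * (\<eta> / (a 0)\<^sup>2) + k / 4 < k / 4 + k / 4" using \<eta>(2) by (rule add_strict_right_mono)
    finally show False by simp
  qed
  \<comment> \<open>The profile decreases from \<open>d - 1\<close>, the last index covered by the
    bound \<open>at_le\<close>, so all later terms inherit it.\<close>
  then have tail: "(a i)\<^sup>2 * t i \<le> \<eta>" if "d \<le> i" for i
    using at_antimono_tail[of "d - 1" i] at_le[of "d - 1"] that d1 by fastforce
  \<comment> \<open>Beyond \<open>d\<close> a square is at most \<open>\<eta>\<close> times the term
    itself, and all terms together sum to \<open>B\<close>.\<close>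
  have "(\<Sum>i<T. ((a i)\<^sup>2 * t i)\<^sup>2) \<le> (\<Sum>i<T. (if i < d then ((a i)\<^sup>2 * t i)\<^sup>2 else 0) + \<eta> * ((a i)\<^sup>2 * t i))"
  proof (intro sum_mono)
    fix i
    show "((a i)\<^sup>2 * t i)\<^sup>2 \<le> (if i < d then ((a i)\<^sup>2 * t i)\<^sup>2 else 0) + \<eta> * ((a i)\<^sup>2 * t i)"
      using tail[of i] at_nonneg[of i] \<eta>(1) by (auto simp: power2_eq_square[of "_ * _"] intro!: mult_right_mono)
  qed
  also have "\<dots> = (\<Sum>i<T. if i < d then ((a i)\<^sup>2 * t i)\<^sup>2 else 0) + \<eta> * B"
    by (simp add: sum.distrib sum_distrib_left[symmetric] sum_t)
  also have "(\<Sum>i<T. if i < d then ((a i)\<^sup>2 * t i)\<^sup>2 else 0) = (\<Sum>i\<in>{..<T} \<inter> {..<d}. ((a i)\<^sup>2 * t i)\<^sup>2)"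
    by (intro sum.mono_neutral_cong_right) auto
  also have "\<dots> \<le> (\<Sum>i<d. ((a i)\<^sup>2 * t i)\<^sup>2)" by (intro sum_mono2) auto
  also have "\<dots> \<le> \<eta>\<^sup>2" by (rule sum)
  finally show ?thesis by simp
qed

end

section \<open>Passage to the limit of vanishing noise\<close>

theorem theorem3p1:
  fixes a :: "nat \<Rightarrow> real" and B :: real and epst :: "real \<Rightarrow> real"
  assumes a_pos: "0 < a 0"
    and a_mono: "mono a"
    and a_inf: "filterlim a at_top sequentially"
    and B_pos: "B > 0"
    and epst_pos: "\<And>e. e > 0 \<Longrightarrow> epst e > 0"
    and epst_O: "(\<lambda>e. 1 / epst e) \<in> O[at_right 0](\<lambda>e. 1 / e)"
    and small: "((\<lambda>e. ln (1 / e\<^sup>2) *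
                 (\<Sum>i<nat \<lfloor>1 / e\<^sup>2\<rfloor>. (a i)^4 * (tau_star a B e (epst e) i)^4))
                 \<longlongrightarrow> 0) (at_right 0)"
  shows "(((\<lambda>e. minimax_risk a B e (epst e) /
               ennreal (\<Sum>i<T_star a B e (epst e).
                 1/2 * ln ((1 + (tau_star a B e (epst e) i)\<^sup>2 / v2_joint e (epst e))
                         / (1 + (tau_star a B e (epst e) i)\<^sup>2 / v2_obs e))))
           \<longlongrightarrow> 1) (at_right 0))
         \<and> (\<exists>h :: real \<Rightarrow> real. (h \<longlongrightarrow> 0) (at_right 0) \<and>
           (\<forall>\<^sub>F e in at_right 0.
              (SUP \<theta>\<in>Theta a B. risk e (epst e) \<theta> (bayes_pred e (epst e) (tau_star a B e (epst e))))
              = ennreal (1 + h e) * minimax_risk a B e (epst e)))"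
proof -
  define DD where "DD e = (\<Sum>i<T_star a B e (epst e).
                 1/2 * ln ((1 + (tau_star a B e (epst e) i)\<^sup>2 / v2_joint e (epst e))
                         / (1 + (tau_star a B e (epst e) i)\<^sup>2 / v2_obs e)))" for e
  define SR where "SR e = (SUP \<theta>\<in>Theta a B. risk e (epst e) \<theta> (bayes_pred e (epst e) (tau_star a B e (epst e))))" for e
  define R where "R e = minimax_risk a B e (epst e)" for e
  have ell: "ellipsoid a B e (epst e)" if "0 < e" for e
    using a_pos a_mono a_inf B_pos epst_pos that by unfold_locales auto
  have DD: "0 < DD e" "SR e \<le> ennreal (DD e)" "R e \<le> SR e" if "0 < e" for e
  proof -
    interpret ellipsoid a B e "epst e" by (rule ell[OF that])
    show "0 < DD e" using D_pos unfolding D_eq DD_def .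
    show "SR e \<le> ennreal (DD e)" using sup_risk_bayes_pred_le unfolding D_eq DD_def SR_def .
    show "R e \<le> SR e" unfolding R_def SR_def by (rule minimax_risk_le)
  qed
  obtain c where c: "0 < c" "\<forall>\<^sub>F e in at_right 0. norm (1 / epst e) \<le> c * norm (1 / e)"
    using epst_O by (elim landau_o.bigE)
  have pos: "\<forall>\<^sub>F e in at_right (0::real). 0 < e" by (rule eventually_at_right_less)
  have lower: "\<forall>\<^sub>F e in at_right 0. ennreal ((1 - \<epsilon>) * DD e) \<le> R e" if \<epsilon>: "0 < \<epsilon>" "\<epsilon> < 1" for \<epsilon>
  proof -
    \<comment> \<open>Half of \<open>\<epsilon>\<close> is spent on the shrinkage, the other half on
      the conditioning error \<open>3 * \<mu> * (3 + 2 * C)\<close>.\<close>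
    define \<delta> where "\<delta> = \<epsilon> / 2"
    define C where "C = c\<^sup>2"
    define \<mu> where "\<mu> = min 1 (\<epsilon> / (6 * (3 + 2 * C)))"
    \<comment> \<open>From \<open>e^2 \<le> C * s^2\<close> it follows that
      \<open>v = e^2 * s^2 / (e^2 + s^2)\<close> is at least \<open>e^2 / (1 + C)\<close>, that is
      \<open>k * e^2 \<le> v\<close>.\<close>
    define k where "k = 1 / (1 + C)"
    have C: "0 < C" using c by (simp add: C_def)
    have \<delta>: "0 < \<delta>" "\<delta> < 1" using \<epsilon> by (auto simp: \<delta>_def)
    have \<mu>: "0 < \<mu>" "\<mu> \<le> 1" using \<epsilon> C by (auto simp: \<mu>_def)
    have k: "0 < k" using C by (simp add: k_def)
    have budget: "\<delta> + 3 * \<mu> * (3 + 2 * C) \<le> \<epsilon>"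
    proof -
      have "\<mu> \<le> \<epsilon> / (6 * (3 + 2 * C))" by (simp add: \<mu>_def)
      then have "\<mu> * (6 * (3 + 2 * C)) \<le> \<epsilon>" using C by (simp add: pos_le_divide_eq)
      moreover have "3 * \<mu> * (3 + 2 * C) = \<mu> * (6 * (3 + 2 * C)) / 2" by simp
      ultimately show ?thesis by (simp only: \<delta>_def)
    qed
    \<comment> \<open>This index does not depend on the noise level and is fixed before
      \<open>e\<close>; level 1 merely instantiates the locale.\<close>
    obtain N where N: "\<And>i. N \<le> i \<Longrightarrow> 4 * B / k \<le> (a i)\<^sup>2"
      using ellipsoid.a_sq_unbounded[OF ell[of 1]] by auto
    \<comment> \<open>\<open>\<eta>\<close> will bound the individual terms \<open>a^2 * t\<close>.
      It is made small enough for Chebyshev's bound at level \<open>\<mu>\<close> and for the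
      contribution of the first \<open>N\<close> coordinates.\<close>
    have "\<forall>\<^sub>F \<eta> in at_right (0::real). 2 * (\<eta>\<^sup>2 + \<eta> * B) < \<mu>\<^sup>2 * (\<delta> * B)\<^sup>2 \<and> N * (\<eta> / (a 0)\<^sup>2) < k / 4 \<and> 0 < \<eta>"
    proof (intro eventually_conj eventually_at_right_less)
      have "((\<lambda>\<eta>::real. 2 * (\<eta>\<^sup>2 + \<eta> * B)) \<longlongrightarrow> 2 * (0\<^sup>2 + 0 * B)) (at_right 0)"
        by (intro tendsto_intros)
      then show "\<forall>\<^sub>F \<eta> in at_right 0. 2 * (\<eta>\<^sup>2 + \<eta> * B) < \<mu>\<^sup>2 * (\<delta> * B)\<^sup>2"
        using \<mu> \<delta> B_pos by (intro order_tendstoD(2)[where y = "2 * (0\<^sup>2 + 0 * B)"]) auto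
      have "((\<lambda>\<eta>::real. N * (\<eta> / (a 0)\<^sup>2)) \<longlongrightarrow> N * (0 / (a 0)\<^sup>2)) (at_right 0)"
        using a_pos by (intro tendsto_intros) auto
      then show "\<forall>\<^sub>F \<eta> in at_right 0. N * (\<eta> / (a 0)\<^sup>2) < k / 4"
        using k by (intro order_tendstoD(2)[where y = "N * (0 / (a 0)\<^sup>2)"]) auto
    qed
    then obtain \<eta> where \<eta>: "2 * (\<eta>\<^sup>2 + \<eta> * B) < \<mu>\<^sup>2 * (\<delta> * B)\<^sup>2" "N * (\<eta> / (a 0)\<^sup>2) < k / 4" "0 < \<eta>"
      by (metis (no_types, lifting) eventually_happens' trivial_limit_at_right_real)
    have "\<forall>\<^sub>F e in at_right 0. ln (1 / e\<^sup>2) * (\<Sum>i<nat \<lfloor>1 / e\<^sup>2\<rfloor>. (a i)^4 * (tau_star a B e (epst e) i)^4) < \<eta>\<^sup>2"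
      using \<eta>(3) by (intro order_tendstoD(2)[OF small]) simp
    moreover have "\<forall>\<^sub>F e in at_right (0::real). 1 \<le> ln (1 / e\<^sup>2)" by real_asymp
    moreover have "\<forall>\<^sub>F e in at_right (0::real). e\<^sup>2 \<le> 1" by real_asymp
    ultimately show ?thesis
      using pos c(2)
    proof eventually_elim
      case (elim e)
      interpret ellipsoid a B e "epst e" by (rule ell[OF elim(4)])
      have "1 / epst e \<le> c / e" using elim(4,5) s by simp
      then have "e \<le> c * epst e" using elim(4) s by (simp add: field_simps)
      then have "e\<^sup>2 \<le> (c * epst e)\<^sup>2" using elim(4) by (intro power_mono) auto
      then have eC: "e\<^sup>2 \<le> C * (epst e)\<^sup>2" by (simp add: C_def power_mult_distrib)
      have kv: "k * e\<^sup>2 \<le> v"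
      proof -
        have "e\<^sup>2 + (epst e)\<^sup>2 \<le> (1 + C) * (epst e)\<^sup>2" using eC by (simp add: algebra_simps)
        then have "e\<^sup>2 * (e\<^sup>2 + (epst e)\<^sup>2) \<le> e\<^sup>2 * ((1 + C) * (epst e)\<^sup>2)" by (intro mult_left_mono) auto
        moreover have "0 < e\<^sup>2 + (epst e)\<^sup>2" using elim(4) by (intro add_pos_nonneg) auto
        ultimately show ?thesis
          using C elim(4) s by (simp add: k_def v2_joint_eq divide_le_eq le_divide_eq mult_ac)
      qed
      have kuv: "(k * e\<^sup>2)\<^sup>2 \<le> u * v"
      proof -
        have "(k * e\<^sup>2) * (k * e\<^sup>2) \<le> u * v"
          using kv vu k elim(4) v_pos by (intro mult_mono) auto
        then show ?thesis by (simp add: power2_eq_square)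
      qed
      have "(\<Sum>i<nat \<lfloor>1 / e\<^sup>2\<rfloor>. ((a i)\<^sup>2 * t i)\<^sup>2) = (\<Sum>i<nat \<lfloor>1 / e\<^sup>2\<rfloor>. (a i)^4 * (tau_star a B e (epst e) i)^4)"
        by (intro sum.cong refl) (simp add: power_mult_distrib tau_star_sq[symmetric] power_mult[symmetric])
      also have "\<dots> \<le> ln (1 / e\<^sup>2) * (\<Sum>i<nat \<lfloor>1 / e\<^sup>2\<rfloor>. (a i)^4 * (tau_star a B e (epst e) i)^4)"
        using mult_right_mono[OF elim(2), of "\<Sum>i<nat \<lfloor>1 / e\<^sup>2\<rfloor>. (a i)^4 * (tau_star a B e (epst e) i)^4"]
        by (simp add: sum_nonneg)
      also have "\<dots> \<le> \<eta>\<^sup>2" using elim(1) by simp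
      finally have "(\<Sum>i<T. ((a i)\<^sup>2 * t i)\<^sup>2) \<le> \<eta>\<^sup>2 + \<eta> * B"
        using sum_at_sq_le[OF refl elim(3) k kuv N \<eta>(3,2)] by simp
      then have "2 * (\<Sum>i<T. ((a i)\<^sup>2 * t i)\<^sup>2) \<le> 2 * (\<eta>\<^sup>2 + \<eta> * B)" by (rule mult_left_mono) simp
      then have "2 * (\<Sum>i<T. ((a i)\<^sup>2 * t i)\<^sup>2) \<le> \<mu>\<^sup>2 * (\<delta> * B)\<^sup>2"
        by (rule order_trans[OF _ less_imp_le[OF \<eta>(1)]])
      then have "ennreal ((1 - \<delta> - 3 * \<mu> * (3 + 2 * C)) * D) \<le> R e"
        unfolding R_def by (intro minimax_risk_ge \<delta> \<mu> eC)
      moreover have "(1 - \<epsilon>) * D \<le> (1 - \<delta> - 3 * \<mu> * (3 + 2 * C)) * D"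
        using budget D_pos by (intro mult_right_mono) auto
      ultimately have "ennreal ((1 - \<epsilon>) * D) \<le> R e" by (meson ennreal_leI order_trans)
      then show ?case unfolding D_eq DD_def .
    qed
  qed
  \<comment> \<open>All these risks lie below the finite \<open>DD\<close>, so the limits can be
    taken among real numbers.\<close>
  have fin: "R e = ennreal (enn2real (R e))" "SR e = ennreal (enn2real (SR e))"
    "enn2real (R e) \<le> enn2real (SR e)" "enn2real (SR e) \<le> DD e" if "0 < e" for e
  proof -
    have "SR e < top" by (rule order_le_less_trans[OF DD(2)[OF that]]) simp
    moreover from this have "R e < top" by (rule order_le_less_trans[OF DD(3)[OF that]])
    ultimately have 1: "SR e < top" "R e < top" by simp_all
    then show "R e = ennreal (enn2real (R e))" "SR e = ennreal (enn2real (SR e))" by simp_all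
    show "enn2real (R e) \<le> enn2real (SR e)" using 1 DD(3)[OF that] by (intro enn2real_mono)
    show "enn2real (SR e) \<le> DD e"
      using DD(1,2)[OF that] by (intro enn2real_leI) auto
  qed
  define \<rho> where "\<rho> e = enn2real (R e) / DD e" for e
  have \<rho>: "(\<rho> \<longlongrightarrow> 1) (at_right 0)"
  proof (rule order_tendstoI)
    fix y :: real assume y: "y < 1"
    define \<epsilon> where "\<epsilon> = min (1/2) ((1 - y) / 2)"
    have \<epsilon>: "0 < \<epsilon>" "\<epsilon> < 1" "y < 1 - \<epsilon>" using y by (auto simp: \<epsilon>_def min_def field_simps)
    show "\<forall>\<^sub>F e in at_right 0. y < \<rho> e"
      using lower[OF \<epsilon>(1,2)] pos
    proof eventually_elim
      case (elim e)
      have "(1 - \<epsilon>) * DD e \<le> enn2real (R e)"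
        using elim(1) fin(1)[OF elim(2)] by (metis enn2real_nonneg ennreal_le_iff)
      then have "1 - \<epsilon> \<le> \<rho> e" using DD(1)[OF elim(2)] by (simp add: \<rho>_def pos_le_divide_eq)
      then show ?case using \<epsilon>(3) by simp
    qed
  next
    fix y :: real assume y: "1 < y"
    show "\<forall>\<^sub>F e in at_right 0. \<rho> e < y"
      using pos
    proof eventually_elim
      case (elim e)
      have "enn2real (R e) \<le> DD e" using fin(3,4)[OF elim] by simp
      then have "\<rho> e \<le> 1" using DD(1)[OF elim] by (simp add: \<rho>_def pos_divide_le_eq)
      then show ?case using y by simp
    qed
  qed
  have "((\<lambda>e. ennreal (\<rho> e)) \<longlongrightarrow> ennreal 1) (at_right 0)"
    by (rule tendsto_ennrealI[OF \<rho>])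
  then have "((\<lambda>e. R e / ennreal (DD e)) \<longlongrightarrow> 1) (at_right 0)"
    unfolding ennreal_1
  proof (rule Lim_transform_eventually)
    show "\<forall>\<^sub>F e in at_right 0. ennreal (\<rho> e) = R e / ennreal (DD e)"
      using pos
    proof eventually_elim
      case (elim e)
      have "ennreal (enn2real (R e)) / ennreal (DD e) = ennreal (\<rho> e)"
        unfolding \<rho>_def using DD(1)[OF elim] by (intro divide_ennreal) auto
      then show ?case using fin(1)[OF elim] by simp
    qed
  qed
  moreover have "\<exists>h :: real \<Rightarrow> real. (h \<longlongrightarrow> 0) (at_right 0) \<and> (\<forall>\<^sub>F e in at_right 0. SR e = ennreal (1 + h e) * R e)"
  proof (intro exI conjI)
    \<comment> \<open>The quotient is meaningful where the minimax risk is positive, which holds for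
      all small \<open>e\<close> because \<open>\<rho>\<close> tends to 1.\<close>
    define h where "h e = enn2real (SR e) / enn2real (R e) - 1" for e
    have \<rho>_pos: "\<forall>\<^sub>F e in at_right 0. 0 < \<rho> e" using \<rho> by (rule order_tendstoD) simp
    then have R_pos: "\<forall>\<^sub>F e in at_right 0. 0 < enn2real (R e) \<and> 0 < e"
      using pos by eventually_elim (auto simp: \<rho>_def zero_less_divide_iff dest: DD(1))
    \<comment> \<open>Since \<open>R\<close> \<le> \<open>SR\<close> \<le> \<open>DD\<close>, the
      relative excess lies between 0 and \<open>1 / \<rho> - 1\<close>.\<close>
    show "(h \<longlongrightarrow> 0) (at_right 0)"
    proof (rule tendsto_sandwich)
      show "\<forall>\<^sub>F e in at_right 0. 0 \<le> h e"
        using R_pos by eventually_elim (auto simp: h_def fin(3))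
      show "\<forall>\<^sub>F e in at_right 0. h e \<le> 1 / \<rho> e - 1"
        using R_pos by eventually_elim (auto simp: h_def \<rho>_def fin(4) divide_right_mono)
      have "((\<lambda>e. 1 / \<rho> e - 1) \<longlongrightarrow> 1 / 1 - 1) (at_right 0)"
        by (intro tendsto_intros \<rho>) auto
      then show "((\<lambda>e. 1 / \<rho> e - 1) \<longlongrightarrow> 0) (at_right 0)" by simp
    qed simp
    show "\<forall>\<^sub>F e in at_right 0. SR e = ennreal (1 + h e) * R e"
      using R_pos
    proof eventually_elim
      case (elim e)
      have "ennreal (1 + h e) * ennreal (enn2real (R e)) = ennreal ((1 + h e) * enn2real (R e))"
        by (rule ennreal_mult''[symmetric]) simp
      also have "(1 + h e) * enn2real (R e) = enn2real (SR e)" using elim by (simp add: h_def)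
      finally show ?case using fin(1,2)[of e] elim by simp
    qed
  qed
  ultimately show ?thesis unfolding R_def SR_def DD_def by blast
qed

end
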